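(* Let $n\ge 2$. For each $i=1,\dots,n$ let $\Phi_i=\{\varphi_{i,k}\}_{k=-\infty}^{\infty}$ be a sequence of Blaschke products which has a least common multiple $\varphi_i$, and let $$\mathcal{Q}_{\bm{\Phi}}=\bigvee_{k=-\infty}^{\infty}\mathcal{Q}_{\varphi_{1,k}}\otimes\cdots\otimes\mathcal{Q}_{\varphi_{n,k}}\subseteq H^2(\mathbb{D}^n).$$ Then $$\operatorname{co-rank}\mathcal{Q}_{\bm{\Phi}}=\sup_{(\xi_1,\dots,\xi_n)\in\Lambda}\operatorname{co-rank}\mathcal{Q}(\xi_1,\dots,\xi_n)=\sup_{(\xi_1,\dots,\xi_n)\in\Lambda}\#\tilde{Z}(\xi_1,\dots,\xi_n).$$
   Context: $\mathbb{N}$ includes $0$. $H^2(\mathbb{D}^n)$ is the Hardy space over the open unit polydisc, identified with the $n$-fold Hilbert space tensor product $H^2(\mathbb{D})\otimes\cdots\otimes H^2(\mathbb{D})$; $M_{z_i}$ is multiplication by $z_i$. $\bigvee$ denotes closed linear span. A quotient module $\mathcal{Q}$ of $H^2(\mathbb{D}^n)$ is a closed subspace whose orthogonal complement is invariant under all $M_{z_i}$; thus $\mathcal{Q}$ is invariant under all $M_{z_i}^*$. For a commuting $n$-tuple $T=(T_1,\dots,T_n)$ of bounded operators on a separable Hilbert space $\mathcal{H}$ and $S\subseteq\mathcal{H}$, let $[S]_T=\bigvee\{p(T_1,\dots,T_n)h: p\in\mathbb{C}[z_1,\dots,z_n],\,h\in S\}$ (with $[\emptyset]_T=\{0\}$),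 and $\operatorname{rank}T=\inf\{\#S: S\subseteq\mathcal{H},\,[S]_T=\mathcal{H}\}\in\mathbb{N}\cup\{\infty\}$. For a quotient module, $\operatorname{co-rank}\mathcal{Q}=\operatorname{rank}(M_{z_1}^*|_{\mathcal{Q}},\dots,M_{z_n}^*|_{\mathcal{Q}})$. For an inner function $\varphi$ on $\mathbb{D}$, $\mathcal{Q}_\varphi=H^2(\mathbb{D})\ominus\varphi H^2(\mathbb{D})$. For $\alpha\in\mathbb{D}$, $b_\alpha(z)=\frac{z-\alpha}{1-\bar\alpha z}$. A Blaschke product is an inner function $\varphi=\prod_m b_{\alpha_m}^{l_m}$ (finite or countable product, with the factors multiplied by unimodular constants as needed for convergence), with distinct $\alpha_m\in\mathbb{D}$, integers $l_m\ge1$, and $\sum_m l_m(1-|\alpha_m|)<\infty$. For such $\varphi$ put $\mathcal{I}_\varphi=\{b_{\alpha_m}^{l_m}\}_m$, and for $\xi=b_{\alpha}^{l}$ with $l\ge1$ put $P(\xi)=b_\alpha$. Divisibility $|$ is divisibility among inner functions. $\operatorname{ord}(\varphi,b_\alpha)$ is the order of the zero of $\varphi$ at $\alpha$. A least common multiple of a sequence $\{\varphi_{i,k}\}_{k\in\mathbb{Z}}$ of Blaschke products is a Blaschke product $\varphi_i$ such that $\varphi_{i,k}|\varphi_i$ for all $k$, and such that any Blaschke product $\psi$ with $\varphi_{i,k}|\psi$ for all $k$ and $\psi|\varphi_i$ is a constant multiple of $\varphi_i$. Put $\Lambda_k=\mathcal{I}_{\varphi_{1,k}}\times\cdots\times\mathcal{I}_{\varphi_{n,k}}$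 for $k\in\mathbb{Z}$ and $\Lambda=\bigcup_{k\in\mathbb{Z}}\Lambda_k$. For $(\xi_1,\dots,\xi_n)\in\Lambda$ put $l_{i,k}=\operatorname{ord}(\varphi_{i,k},P(\xi_i))$, $Z(\xi_1,\dots,\xi_n)=\{k\in\mathbb{Z}: P(\xi_i)|\varphi_{i,k}\text{ for all }i=1,\dots,n\}$, and $$\mathcal{Q}(\xi_1,\dots,\xi_n)=\bigvee_{k\in Z(\xi_1,\dots,\xi_n)}\mathcal{Q}_{P(\xi_1)^{l_{1,k}}}\otimes\cdots\otimes\mathcal{Q}_{P(\xi_n)^{l_{n,k}}}.$$ $\tilde{Z}(\xi_1,\dots,\xi_n)$ denotes a subset of $Z(\xi_1,\dots,\xi_n)$ of minimal cardinality such that $\mathcal{Q}(\xi_1,\dots,\xi_n)=\bigvee_{k\in\tilde{Z}(\xi_1,\dots,\xi_n)}\mathcal{Q}_{P(\xi_1)^{l_{1,k}}}\otimes\cdots\otimes\mathcal{Q}_{P(\xi_n)^{l_{n,k}}}$. Suprema are taken in $\mathbb{N}\cup\{\infty\}$. *)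

theory Defs
  imports
    "HOL-Complex_Analysis.Complex_Analysis"
    "HOL-Library.Extended_Nat"
    "HOL-Library.Function_Algebras"
    "HOL-Library.Poly_Mapping"
begin

section \<open>Hardy spaces\<close>

text \<open>
  The Hardy spaces of the disc and of the polydisc are both spaces of power series with
  square-summable coefficients. They are introduced together, for a family \<open>e\<close> of monomials on a
  domain \<open>D\<close>. So that equality of elements is equality of functions, elements are taken to be \<open>0\<close>
  outside \<open>D\<close>.
\<close>

definition hardy_expansion ::
    "('k \<Rightarrow> 'x \<Rightarrow> complex) \<Rightarrow> 'x set \<Rightarrow> ('x \<Rightarrow> complex) \<Rightarrow> ('k \<Rightarrow> complex) \<Rightarrow> bool" where
  "hardy_expansion e D f a \<longleftrightarrow>
     (\<lambda>k. (cmod (a k))\<^sup>2) summable_on UNIV \<and>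
     (\<forall>x\<in>D. ((\<lambda>k. a k * e k x) has_sum f x) UNIV) \<and>
     (\<forall>x. x \<notin> D \<longrightarrow> f x = 0)"

definition hardy :: "('k \<Rightarrow> 'x \<Rightarrow> complex) \<Rightarrow> 'x set \<Rightarrow> ('x \<Rightarrow> complex) set" where
  "hardy e D = {f. \<exists>a. hardy_expansion e D f a}"

definition hardy_coeff ::
    "('k \<Rightarrow> 'x \<Rightarrow> complex) \<Rightarrow> 'x set \<Rightarrow> ('x \<Rightarrow> complex) \<Rightarrow> 'k \<Rightarrow> complex" where
  "hardy_coeff e D f = (THE a. hardy_expansion e D f a)"

definition hardy_inner ::
    "('k \<Rightarrow> 'x \<Rightarrow> complex) \<Rightarrow> 'x set \<Rightarrow> ('x \<Rightarrow> complex) \<Rightarrow> ('x \<Rightarrow> complex) \<Rightarrow> complex" where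
  "hardy_inner e D f g = (\<Sum>\<^sub>\<infinity>k. hardy_coeff e D f k * cnj (hardy_coeff e D g k))"

abbreviation disc :: "complex set" where
  "disc \<equiv> ball 0 1"

definition H2_disc :: "(complex \<Rightarrow> complex) set" where
  "H2_disc = hardy (\<lambda>(k::nat) z. z ^ k) disc"

definition inner_disc :: "(complex \<Rightarrow> complex) \<Rightarrow> (complex \<Rightarrow> complex) \<Rightarrow> complex" where
  "inner_disc = hardy_inner (\<lambda>(k::nat) z. z ^ k) disc"

definition polydisc :: "(complex ^ 'n) set" where
  "polydisc = {z. \<forall>i. z $ i \<in> disc}"

definition monomial :: "('n::finite \<Rightarrow> nat) \<Rightarrow> complex ^ 'n \<Rightarrow> complex" where
  "monomial k z = (\<Prod>i\<in>UNIV. (z $ i) ^ k i)"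

definition H2 :: "(complex ^ 'n::finite \<Rightarrow> complex) set" where
  "H2 = hardy monomial polydisc"

definition inner_H2 ::
    "(complex ^ 'n::finite \<Rightarrow> complex) \<Rightarrow> (complex ^ 'n \<Rightarrow> complex) \<Rightarrow> complex" where
  "inner_H2 = hardy_inner monomial polydisc"

definition norm_H2 :: "(complex ^ 'n::finite \<Rightarrow> complex) \<Rightarrow> real" where
  "norm_H2 f = sqrt (Re (inner_H2 f f))"

definition fscale :: "complex \<Rightarrow> ('x \<Rightarrow> complex) \<Rightarrow> 'x \<Rightarrow> complex" where
  "fscale c f = (\<lambda>x. c * f x)"

global_interpretation cfun: vector_space "fscale :: complex \<Rightarrow> ('x \<Rightarrow> complex) \<Rightarrow> 'x \<Rightarrow> complex"
  by unfold_locales (simp_all add: fscale_def fun_eq_iff algebra_simps)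

definition closed_span ::
    "(complex ^ 'n::finite \<Rightarrow> complex) set \<Rightarrow> (complex ^ 'n \<Rightarrow> complex) set" where
  "closed_span S = {f \<in> H2. \<forall>\<epsilon>>0. \<exists>g\<in>cfun.span S. norm_H2 (f - g) < \<epsilon>}"


section \<open>Rank and co-rank\<close>

text \<open>
  The power \<open>T\<^sup>k\<close> of an operator tuple; the order of composition is immaterial because the tuples
  considered commute.
\<close>

definition op_power ::
    "('n::finite \<Rightarrow> 'h \<Rightarrow> 'h) \<Rightarrow> ('n \<Rightarrow> nat) \<Rightarrow> 'h \<Rightarrow> 'h" where
  "op_power T k h = Finite_Set.fold (\<lambda>i. T i ^^ k i) h UNIV"

text \<open>
  A polynomial in the variables \<open>z\<^sub>i\<close>, \<open>i :: 'n\<close>, is the finitely supported family of its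
  coefficients, indexed by exponents \<open>k :: 'n \<Rightarrow> nat\<close>.
\<close>

definition poly_op ::
    "('n::finite \<Rightarrow> ('x \<Rightarrow> complex) \<Rightarrow> ('x \<Rightarrow> complex)) \<Rightarrow> (('n \<Rightarrow> nat) \<Rightarrow>\<^sub>0 complex) \<Rightarrow>
     ('x \<Rightarrow> complex) \<Rightarrow> ('x \<Rightarrow> complex)" where
  "poly_op T p h = (\<Sum>k\<in>Poly_Mapping.keys p. fscale (Poly_Mapping.lookup p k) (op_power T k h))"

definition generated ::
    "('n::finite \<Rightarrow> (complex ^ 'n \<Rightarrow> complex) \<Rightarrow> (complex ^ 'n \<Rightarrow> complex)) \<Rightarrow>
     (complex ^ 'n \<Rightarrow> complex) set \<Rightarrow> (complex ^ 'n \<Rightarrow> complex) set" where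
  "generated T S = closed_span {poly_op T p h | p h. h \<in> S}"

definition ecard :: "'a set \<Rightarrow> enat" where
  "ecard S = (if finite S then enat (card S) else \<infinity>)"

text \<open>The rank of the restriction of the tuple \<open>T\<close> to a closed joint invariant subspace \<open>Q\<close>.\<close>

definition rank_on ::
    "(complex ^ 'n \<Rightarrow> complex) set \<Rightarrow>
     ('n::finite \<Rightarrow> (complex ^ 'n \<Rightarrow> complex) \<Rightarrow> (complex ^ 'n \<Rightarrow> complex)) \<Rightarrow> enat" where
  "rank_on Q T = Inf {ecard S | S. S \<subseteq> Q \<and> generated T S = Q}"

definition M_z :: "'n \<Rightarrow> (complex ^ 'n \<Rightarrow> complex) \<Rightarrow> (complex ^ 'n \<Rightarrow> complex)" where
  "M_z i f = (\<lambda>z. z $ i * f z)"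

definition M_z_adj ::
    "'n::finite \<Rightarrow> (complex ^ 'n \<Rightarrow> complex) \<Rightarrow> (complex ^ 'n \<Rightarrow> complex)" where
  "M_z_adj i f =
     (if f \<in> H2 then (THE g. g \<in> H2 \<and> (\<forall>h\<in>H2. inner_H2 (M_z i h) f = inner_H2 h g)) else 0)"

definition co_rank :: "(complex ^ 'n::finite \<Rightarrow> complex) set \<Rightarrow> enat" where
  "co_rank Q = rank_on Q M_z_adj"


section \<open>Blaschke products\<close>

text \<open>
  Functions on the disc are functions \<open>complex \<Rightarrow> complex\<close> of which only the values on \<open>disc\<close>
  matter.
\<close>

definition inner_function :: "(complex \<Rightarrow> complex) \<Rightarrow> bool" where
  "inner_function f \<longleftrightarrow>
     f holomorphic_on disc \<and> bounded (f ` disc) \<and>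
     (AE t in lborel. \<exists>w. cmod w = 1 \<and> ((\<lambda>r. f (of_real r * cis t)) \<longlongrightarrow> w) (at_left 1))"

definition inner_dvd :: "(complex \<Rightarrow> complex) \<Rightarrow> (complex \<Rightarrow> complex) \<Rightarrow> bool" where
  "inner_dvd f g \<longleftrightarrow> (\<exists>h. inner_function h \<and> (\<forall>z\<in>disc. g z = f z * h z))"

definition blaschke_factor :: "complex \<Rightarrow> complex \<Rightarrow> complex" where
  "blaschke_factor \<alpha> z = (z - \<alpha>) / (1 - cnj \<alpha> * z)"

text \<open>
  \<open>A\<close> is the set of the distinct \<open>\<alpha>\<^sub>m\<close>, \<open>l\<close> gives their exponents and \<open>c\<close> the unimodular
  constants. The product is the limit of the finite partial products, so that it is an ordinary
  product for finite \<open>A\<close>; the summability condition makes \<open>A\<close> countable.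
\<close>

definition blaschke_factorization ::
    "(complex \<Rightarrow> complex) \<Rightarrow> complex set \<Rightarrow> (complex \<Rightarrow> nat) \<Rightarrow> bool" where
  "blaschke_factorization \<phi> A l \<longleftrightarrow>
     A \<subseteq> disc \<and> (\<forall>\<alpha>\<in>A. 1 \<le> l \<alpha>) \<and>
     (\<lambda>\<alpha>. real (l \<alpha>) * (1 - cmod \<alpha>)) summable_on A \<and>
     (\<exists>c. (\<forall>\<alpha>\<in>A. cmod (c \<alpha>) = 1) \<and>
        (\<forall>z\<in>disc. ((\<lambda>F. \<Prod>\<alpha>\<in>F. c \<alpha> * blaschke_factor \<alpha> z ^ l \<alpha>) \<longlongrightarrow> \<phi> z)
           (finite_subsets_at_top A)))"

definition blaschke_product :: "(complex \<Rightarrow> complex) \<Rightarrow> bool" where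
  "blaschke_product \<phi> \<longleftrightarrow> inner_function \<phi> \<and> (\<exists>A l. blaschke_factorization \<phi> A l)"

definition blaschke_lcm :: "(int \<Rightarrow> complex \<Rightarrow> complex) \<Rightarrow> (complex \<Rightarrow> complex) \<Rightarrow> bool" where
  "blaschke_lcm \<Phi> \<phi> \<longleftrightarrow>
     blaschke_product \<phi> \<and> (\<forall>k. inner_dvd (\<Phi> k) \<phi>) \<and>
     (\<forall>\<psi>. blaschke_product \<psi> \<and> (\<forall>k. inner_dvd (\<Phi> k) \<psi>) \<and> inner_dvd \<psi> \<phi> \<longrightarrow>
        (\<exists>c. \<forall>z\<in>disc. \<psi> z = c * \<phi> z))"

text \<open>
  \<open>blaschke_parts \<phi>\<close>, \<open>prime_part \<xi>\<close> and \<open>blaschke_ord \<phi> b\<close> are \<open>\<I>\<^sub>\<phi>\<close>, \<open>P(\<xi>)\<close> and \<open>ord(\<phi>, b)\<close>. The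
  descriptions below are unique, since \<open>\<alpha>\<close> is the only zero of \<open>b\<^sub>\<alpha>\<close> in the disc.
\<close>

definition blaschke_parts :: "(complex \<Rightarrow> complex) \<Rightarrow> (complex \<Rightarrow> complex) set" where
  "blaschke_parts \<phi> =
     {\<lambda>z. blaschke_factor \<alpha> z ^ l \<alpha> | \<alpha> A l. blaschke_factorization \<phi> A l \<and> \<alpha> \<in> A}"

definition prime_part :: "(complex \<Rightarrow> complex) \<Rightarrow> complex \<Rightarrow> complex" where
  "prime_part \<xi> = (THE b. \<exists>\<alpha>\<in>disc. \<exists>l\<ge>1. b = blaschke_factor \<alpha> \<and>
                      \<xi> = (\<lambda>z. blaschke_factor \<alpha> z ^ (l::nat)))"

definition blaschke_ord :: "(complex \<Rightarrow> complex) \<Rightarrow> (complex \<Rightarrow> complex) \<Rightarrow> nat" where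
  "blaschke_ord \<phi> b = nat (zorder \<phi> (THE \<alpha>. \<alpha> \<in> disc \<and> b = blaschke_factor \<alpha>))"


section \<open>Quotient modules\<close>

definition model_space :: "(complex \<Rightarrow> complex) \<Rightarrow> (complex \<Rightarrow> complex) set" where
  "model_space \<phi> = {f \<in> H2_disc. \<forall>g\<in>H2_disc. inner_disc f (\<lambda>z. \<phi> z * g z) = 0}"

text \<open>
  Under the identification of \<open>H\<^sup>2(\<D>\<^sup>n)\<close> with the Hilbert space tensor power of \<open>H\<^sup>2(\<D>)\<close>, the
  elementary tensor of the \<open>f\<^sub>i\<close> is the function \<open>z \<mapsto> \<Prod>\<^sub>i f\<^sub>i(z\<^sub>i)\<close>.
\<close>

definition tensor :: "('n::finite \<Rightarrow> (complex \<Rightarrow> complex) set) \<Rightarrow> (complex ^ 'n \<Rightarrow> complex) set" where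
  "tensor V = closed_span {\<lambda>z. \<Prod>i\<in>UNIV. f i (z $ i) | f. \<forall>i. f i \<in> V i}"

text \<open>In the following, \<open>\<phi> i k\<close> is \<open>\<phi>\<^bsub>i,k\<^esub>\<close> and \<open>\<xi> i\<close> is \<open>\<xi>\<^sub>i\<close>.\<close>

definition Q_Phi :: "('n::finite \<Rightarrow> int \<Rightarrow> complex \<Rightarrow> complex) \<Rightarrow> (complex ^ 'n \<Rightarrow> complex) set" where
  "Q_Phi \<phi> = closed_span (\<Union>k. tensor (\<lambda>i. model_space (\<phi> i k)))"

definition Lambda :: "('n \<Rightarrow> int \<Rightarrow> complex \<Rightarrow> complex) \<Rightarrow> ('n \<Rightarrow> complex \<Rightarrow> complex) set" where
  "Lambda \<phi> = (\<Union>k. {\<xi>. \<forall>i. \<xi> i \<in> blaschke_parts (\<phi> i k)})"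

definition Z_set ::
    "('n \<Rightarrow> int \<Rightarrow> complex \<Rightarrow> complex) \<Rightarrow> ('n \<Rightarrow> complex \<Rightarrow> complex) \<Rightarrow> int set" where
  "Z_set \<phi> \<xi> = {k. \<forall>i. inner_dvd (prime_part (\<xi> i)) (\<phi> i k)}"

definition Q_join ::
    "('n::finite \<Rightarrow> int \<Rightarrow> complex \<Rightarrow> complex) \<Rightarrow> ('n \<Rightarrow> complex \<Rightarrow> complex) \<Rightarrow> int set \<Rightarrow>
     (complex ^ 'n \<Rightarrow> complex) set" where
  "Q_join \<phi> \<xi> W = closed_span (\<Union>k\<in>W. tensor (\<lambda>i.
     model_space (\<lambda>z. prime_part (\<xi> i) z ^ blaschke_ord (\<phi> i k) (prime_part (\<xi> i)))))"

definition Q_xi ::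
    "('n::finite \<Rightarrow> int \<Rightarrow> complex \<Rightarrow> complex) \<Rightarrow> ('n \<Rightarrow> complex \<Rightarrow> complex) \<Rightarrow>
     (complex ^ 'n \<Rightarrow> complex) set" where
  "Q_xi \<phi> \<xi> = Q_join \<phi> \<xi> (Z_set \<phi> \<xi>)"

text \<open>\<open>W\<close> is a possible choice of the set \<open>Z\<close>-tilde, which is not unique.\<close>

definition minimal_Z ::
    "('n::finite \<Rightarrow> int \<Rightarrow> complex \<Rightarrow> complex) \<Rightarrow> ('n \<Rightarrow> complex \<Rightarrow> complex) \<Rightarrow> int set \<Rightarrow> bool" where
  "minimal_Z \<phi> \<xi> W \<longleftrightarrow>
     W \<subseteq> Z_set \<phi> \<xi> \<and> Q_xi \<phi> \<xi> = Q_join \<phi> \<xi> W \<and>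
     (\<forall>W'. W' \<subseteq> Z_set \<phi> \<xi> \<and> Q_xi \<phi> \<xi> = Q_join \<phi> \<xi> W' \<longrightarrow> ecard W \<le> ecard W')"

lemma minimal_Z_exists: "\<exists>W. minimal_Z \<phi> \<xi> W"
proof -
  define P where "P W \<longleftrightarrow> W \<subseteq> Z_set \<phi> \<xi> \<and> Q_xi \<phi> \<xi> = Q_join \<phi> \<xi> W" for W
  define m where "m = (LEAST x. \<exists>W. P W \<and> ecard W = x)"
  have "P (Z_set \<phi> \<xi>)"
    by (simp add: P_def Q_xi_def)
  then have "\<exists>x W. P W \<and> ecard W = x"
    by blast
  then have "\<exists>W. P W \<and> ecard W = m"
    unfolding m_def by (rule LeastI_ex)
  then obtain W where W: "P W" "ecard W = m"
    by blast
  have "ecard W \<le> ecard W'" if "P W'" for W'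
    unfolding W(2) m_def using that by (intro Least_le) blast
  with W(1) show ?thesis
    unfolding minimal_Z_def P_def by blast
qed

end

theory Submission
  imports Defs
begin

text \<open>
  Write \<open>k\<^sub>\<alpha>\<^sup>j\<close> for the vector representing the \<open>j\<close>-th Taylor coefficient at \<open>\<alpha>\<close> (up to lower
  order terms). For a Blaschke product \<open>\<phi>\<close> the space \<open>\<Q>\<^sub>\<phi>\<close> is the closed span of the \<open>k\<^sub>\<alpha>\<^sup>j\<close> with
  \<open>j < ord(\<phi>, \<alpha>)\<close>, so \<open>\<Q>\<^sub>\<Phi>\<close> is the closed span of the tensor products \<open>k\<^sub>\<alpha>\<^sup>j\<close> with \<open>\<alpha>\<close> in the
  polydisc and \<open>j\<close> in a set \<open>N(\<alpha>)\<close> of multi-indices that is a union of boxes, one for each \<open>k\<close>.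
  Because the least common multiples exist, every \<open>N(\<alpha>)\<close> is finite. The operator \<open>M\<^sub>z\<^sub>i\<^sup>* - cnj \<alpha>\<^sub>i\<close>
  lowers \<open>j\<^sub>i\<close> by one, so both \<open>co-rank \<Q>(\<xi>)\<close> and the least number of boxes covering \<open>N(\<alpha>)\<close> are
  the number of maximal elements of \<open>N(\<alpha>)\<close>.

  For the lower bound on \<open>co-rank \<Q>\<^sub>\<Phi>\<close>, dividing the least common multiples by suitable powers of
  \<open>z\<^sub>i - \<alpha>\<^sub>i\<close> gives one functional for each maximal element of \<open>N(\<alpha>)\<close>; these are linearly
  independent on \<open>\<Q>\<^sub>\<Phi>\<close> and are joint eigenfunctionals of the operators. For the upper bound,
  combine one maximal \<open>k\<^sub>\<alpha>\<^sup>j\<close> at each of the countably many points \<open>\<alpha>\<close> into a single vector with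
  very rapidly decreasing weights; polynomials in the operators that isolate one point among
  finitely many then recover each summand in the limit.
\<close>

section \<open>The Hilbert space of square-summable families\<close>

text \<open>The analytic core is the identification of \<open>\<Q>\<^sub>\<phi>\<close> with a
  closed span of jets, because an infinite Blaschke product is given only as a pointwise limit. All
  work is therefore done with coefficient families: finite products multiply and divide
  isometrically, since z - \<alpha> and 1 - \<open>cnj \<alpha>\<close> z give multiplications of
  equal norm, and bounded sequences that converge pointwise converge weakly. The quotient of a least
  common multiple by a power of z_i - \<alpha>_i keeps its full order at every other point. Distinct
  points differ in some coordinate, and there the quotient annihilates every jet that occurs; so the
  tensor product of the quotients sees only jets at \<alpha>, and of these only the ones of at least
  the chosen order. Maximality of that order makes it an eigenfunctional. A supremum, not a sum,
  over the points appears because generators for different points can be merged: if r is the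
  supremum, each of r vectors carries one order at every point.\<close>

definition sq_summable :: "('k \<Rightarrow> complex) \<Rightarrow> bool" where
  "sq_summable a \<longleftrightarrow> (\<lambda>k. (cmod (a k))\<^sup>2) summable_on UNIV"

lemma sq_summable_mult:
  assumes "sq_summable a" "sq_summable b"
  shows "(\<lambda>k. cmod (a k * b k)) summable_on UNIV"
  by (rule abs_summable_product)
    (use assms in \<open>simp_all add: sq_summable_def norm_mult power2_eq_square\<close>)

lemma sq_summable_comparison:
  assumes "sq_summable b" "\<And>k. cmod (a k) \<le> cmod (b k)"
  shows "sq_summable a"
  using assms(1) unfolding sq_summable_def
  by (rule summable_on_comparison_test) (use assms(2) in \<open>auto intro: power_mono\<close>)

lemma sq_summable_scale: "sq_summable a \<Longrightarrow> sq_summable (\<lambda>k. c * a k)"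
  unfolding sq_summable_def by (simp add: norm_mult power_mult_distrib summable_on_cmult_right)

lemma sq_summable_add:
  assumes "sq_summable a" "sq_summable b"
  shows "sq_summable (\<lambda>k. a k + b k)"
proof -
  have "(\<lambda>k. 2 * (cmod (a k))\<^sup>2 + 2 * (cmod (b k))\<^sup>2) summable_on UNIV"
    using assms unfolding sq_summable_def by (intro summable_on_add summable_on_cmult_right)
  then show ?thesis
    unfolding sq_summable_def
  proof (rule summable_on_comparison_test)
    fix k
    have "(cmod (a k + b k))\<^sup>2 \<le> (cmod (a k) + cmod (b k))\<^sup>2"
      by (intro power_mono norm_triangle_ineq) auto
    also have "\<dots> \<le> 2 * (cmod (a k))\<^sup>2 + 2 * (cmod (b k))\<^sup>2"
      using sum_squares_bound[of "cmod (a k)" "cmod (b k)"] by (simp add: power2_sum)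
    finally show "(cmod (a k + b k))\<^sup>2 \<le> 2 * (cmod (a k))\<^sup>2 + 2 * (cmod (b k))\<^sup>2" .
  qed auto
qed

lemma sq_summable_zero: "sq_summable (\<lambda>k. 0)"
  by (simp add: sq_summable_def)

lemma sq_summable_finite_support:
  assumes "finite {k. a k \<noteq> 0}"
  shows "sq_summable a"
  unfolding sq_summable_def
  by (rule finite_nonzero_values_imp_summable_on) (use assms in simp)

text \<open>A type rather than a carrier set, so that topology, series and the contraction principle
  come from type classes. The arbitrary index type serves one and several variables alike.\<close>

typedef 'k ell2 = "{a :: 'k \<Rightarrow> complex. sq_summable a}"
  morphisms coef Abs_ell2
  using sq_summable_zero by blast

lemma sq_summable_coef [simp]: "sq_summable (coef x)"
  using coef by blast

lemma coef_Abs [simp]: "sq_summable a \<Longrightarrow> coef (Abs_ell2 a) = a"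
  by (simp add: Abs_ell2_inverse)

lemma ell2_eqI: "(\<And>k. coef x k = coef y k) \<Longrightarrow> x = y"
  by (metis coef_inverse ext)

definition cinner :: "'k ell2 \<Rightarrow> 'k ell2 \<Rightarrow> complex" where
  "cinner x y = (\<Sum>\<^sub>\<infinity>k. coef x k * cnj (coef y k))"

definition scaleC :: "complex \<Rightarrow> 'k ell2 \<Rightarrow> 'k ell2" where
  "scaleC c x = Abs_ell2 (\<lambda>k. c * coef x k)"

lemma coef_scaleC [simp]: "coef (scaleC c x) k = c * coef x k"
  by (simp add: scaleC_def sq_summable_scale)

lemma cinner_summable: "(\<lambda>k. coef x k * cnj (coef y k)) summable_on UNIV"
proof -
  have "sq_summable (\<lambda>k. cnj (coef y k))"
    by (rule sq_summable_comparison[of "coef y"]) auto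
  then have "(\<lambda>k. cmod (coef x k * cnj (coef y k))) summable_on UNIV"
    by (intro sq_summable_mult) simp_all
  then show ?thesis
    by (rule abs_summable_summable)
qed

lemma cinner_self: "cinner x x = of_real (\<Sum>\<^sub>\<infinity>k. (cmod (coef x k))\<^sup>2)"
proof -
  have "cinner x x = (\<Sum>\<^sub>\<infinity>k. of_real ((cmod (coef x k))\<^sup>2))"
    unfolding cinner_def by (intro infsum_cong) (rule complex_norm_square[symmetric])
  also have "\<dots> = of_real (\<Sum>\<^sub>\<infinity>k. (cmod (coef x k))\<^sup>2)"
    by (rule infsumI, rule has_sum_of_real, rule has_sum_infsum)
      (use sq_summable_coef[of x] in \<open>simp only: sq_summable_def\<close>)
  finally show ?thesis .
qed

instantiation ell2 :: (type) real_vector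
begin

definition zero_ell2 :: "'a ell2" where "zero_ell2 = Abs_ell2 (\<lambda>k. 0)"
definition plus_ell2 :: "'a ell2 \<Rightarrow> 'a ell2 \<Rightarrow> 'a ell2" where
  "plus_ell2 x y = Abs_ell2 (\<lambda>k. coef x k + coef y k)"
definition uminus_ell2 :: "'a ell2 \<Rightarrow> 'a ell2" where "uminus_ell2 x = scaleC (-1) x"
definition minus_ell2 :: "'a ell2 \<Rightarrow> 'a ell2 \<Rightarrow> 'a ell2" where
  "minus_ell2 x y = x + - (y :: 'a ell2)"
definition scaleR_ell2 :: "real \<Rightarrow> 'a ell2 \<Rightarrow> 'a ell2" where
  "scaleR_ell2 r x = scaleC (of_real r) x"

instance
proof
  fix x y z :: "'a ell2" and a b :: real
  note d = zero_ell2_def plus_ell2_def uminus_ell2_def minus_ell2_def scaleR_ell2_def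
    sq_summable_zero sq_summable_add sq_summable_scale
  show "x + y + z = x + (y + z)" "x + y = y + x" "0 + x = x" "- x + x = 0" "x - y = x + - y"
    by (auto intro!: ell2_eqI simp: d)
  show "a *\<^sub>R (x + y) = a *\<^sub>R x + a *\<^sub>R y" "(a + b) *\<^sub>R x = a *\<^sub>R x + b *\<^sub>R x"
    "a *\<^sub>R b *\<^sub>R x = (a * b) *\<^sub>R x" "1 *\<^sub>R x = x"
    by (auto intro!: ell2_eqI simp: d algebra_simps)
qed

end

lemma coef_zero [simp]: "coef 0 k = 0"
  by (simp add: zero_ell2_def sq_summable_zero)

lemma coef_add [simp]: "coef (x + y) k = coef x k + coef y k"
  by (simp add: plus_ell2_def sq_summable_add)

lemma cinner_add_left: "cinner (x + y) z = cinner x z + cinner y z"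
  unfolding cinner_def coef_add by (simp add: algebra_simps infsum_add cinner_summable)

lemma cinner_scaleC_left [simp]: "cinner (scaleC c x) z = c * cinner x z"
  unfolding cinner_def by (simp add: mult.assoc infsum_cmult_right')

instantiation ell2 :: (type) real_inner
begin

definition inner_ell2 :: "'a ell2 \<Rightarrow> 'a ell2 \<Rightarrow> real" where
  "inner_ell2 x y = Re (cinner x y)"
definition norm_ell2 :: "'a ell2 \<Rightarrow> real" where "norm_ell2 x = sqrt (inner x x)"
definition sgn_ell2 :: "'a ell2 \<Rightarrow> 'a ell2" where "sgn_ell2 x = x /\<^sub>R norm x"
definition dist_ell2 :: "'a ell2 \<Rightarrow> 'a ell2 \<Rightarrow> real" where "dist_ell2 x y = norm (x - y)"
definition uniformity_ell2 :: "('a ell2 \<times> 'a ell2) filter" where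
  "uniformity_ell2 = (INF e\<in>{0<..}. principal {(x, y). dist x y < e})"
definition open_ell2 :: "'a ell2 set \<Rightarrow> bool" where
  "open_ell2 U \<longleftrightarrow> (\<forall>x\<in>U. eventually (\<lambda>(x', y). x' = x \<longrightarrow> y \<in> U) uniformity)"

instance
proof
  fix x y z :: "'a ell2" and a b :: real
  show "inner x y = inner y x"
  proof -
    have "cinner y x = cnj (cinner x y)"
      unfolding cinner_def by (subst infsum_cnj[symmetric]) (simp add: mult.commute)
    then show ?thesis by (simp add: inner_ell2_def)
  qed
  show "inner (x + y) z = inner x z + inner y z"
    by (simp add: inner_ell2_def cinner_add_left)
  show "inner (a *\<^sub>R x) y = a * inner x y"
    by (simp add: inner_ell2_def scaleR_ell2_def)
  show "0 \<le> inner x x"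
    by (simp add: inner_ell2_def cinner_self infsum_nonneg)
  show "(inner x x = 0) = (x = 0)"
  proof
    assume "inner x x = 0"
    then have 0: "(\<Sum>\<^sub>\<infinity>k. (cmod (coef x k))\<^sup>2) = 0"
      by (simp add: inner_ell2_def cinner_self)
    have "(cmod (coef x k))\<^sup>2 = 0" for k
      by (rule nonneg_infsum_le_0D[where A = UNIV])
        (use 0 sq_summable_coef[of x] in \<open>auto simp: sq_summable_def\<close>)
    then show "x = 0" by (intro ell2_eqI) simp
  qed (simp add: inner_ell2_def cinner_self)
qed (simp_all add: sgn_ell2_def dist_ell2_def uniformity_ell2_def open_ell2_def norm_ell2_def)

end

lemma coef_uminus [simp]: "coef (- x) k = - coef x k"
  by (simp add: uminus_ell2_def)

lemma coef_diff [simp]: "coef (x - y) k = coef x k - coef y k"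
  unfolding minus_ell2_def coef_add coef_uminus by simp

lemma coef_scaleR [simp]: "coef (r *\<^sub>R x) k = of_real r * coef x k"
  by (simp add: scaleR_ell2_def)

lemma scaleR_scaleC: "r *\<^sub>R x = scaleC (of_real r) x"
  by (simp add: scaleR_ell2_def)

global_interpretation cvec: vector_space "scaleC :: complex \<Rightarrow> 'k ell2 \<Rightarrow> 'k ell2"
  by unfold_locales (auto intro!: ell2_eqI simp: algebra_simps)

lemma cinner_commute: "cinner y x = cnj (cinner x y)"
  unfolding cinner_def by (subst infsum_cnj[symmetric]) (simp add: mult.commute)

lemma cinner_add_right: "cinner x (y + z) = cinner x y + cinner x z"
  by (simp add: cinner_commute[of x] cinner_add_left)

lemma cinner_scaleC_right [simp]: "cinner x (scaleC c y) = cnj c * cinner x y"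
  by (simp add: cinner_commute[of x])

lemma cinner_zero_left [simp]: "cinner 0 x = 0"
  by (simp add: cinner_def)

lemma cinner_zero_right [simp]: "cinner x 0 = 0"
  by (simp add: cinner_commute[of x])

lemma cinner_uminus_left: "cinner (- x) y = - cinner x y"
  using cinner_add_left[of x "-x" y] by (simp add: eq_neg_iff_add_eq_0 add.commute)

lemma cinner_diff_left: "cinner (x - y) z = cinner x z - cinner y z"
  using cinner_add_left[of x "-y" z] by (simp add: cinner_uminus_left)

lemma cinner_diff_right: "cinner x (y - z) = cinner x y - cinner x z"
  by (simp add: cinner_commute[of x] cinner_diff_left)

lemma cinner_sum_right: "cinner x (sum f A) = (\<Sum>a\<in>A. cinner x (f a))"
  by (induction A rule: infinite_finite_induct) (auto simp: cinner_add_right)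

lemma Re_cinner: "Re (cinner x y) = inner x y"
  by (simp add: inner_ell2_def)

lemma cinner_norm: "cinner x x = of_real ((norm x)\<^sup>2)"
  unfolding power2_norm_eq_inner[of x] cinner_self inner_ell2_def by simp

lemma norm_sq_ell2: "((\<lambda>k. (cmod (coef x k))\<^sup>2) has_sum (norm x)\<^sup>2) UNIV"
proof -
  have "(norm x)\<^sup>2 = (\<Sum>\<^sub>\<infinity>k. (cmod (coef x k))\<^sup>2)"
    unfolding power2_norm_eq_inner[of x] inner_ell2_def cinner_self by simp
  then show ?thesis
    using sq_summable_coef[of x] unfolding sq_summable_def by simp
qed

lemma norm_scaleC [simp]: "norm (scaleC c x) = cmod c * norm x"
proof -
  have "of_real ((norm (scaleC c x))\<^sup>2) = c * cnj c * of_real ((norm x)\<^sup>2)"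
    unfolding cinner_norm[symmetric] by simp
  also have "\<dots> = of_real ((cmod c * norm x)\<^sup>2)"
    by (simp only: complex_norm_square[symmetric] power_mult_distrib of_real_mult)
  finally have "(norm (scaleC c x))\<^sup>2 = (cmod c * norm x)\<^sup>2"
    by (simp only: of_real_eq_iff)
  then show ?thesis by (simp add: power2_eq_iff_nonneg)
qed

lemma cmod_cinner_le: "cmod (cinner x y) \<le> norm x * norm y"
proof (cases "cinner x y = 0")
  case False
  \<comment> \<open>The phase that turns the inner product into its modulus; the claim then follows
    from the real Cauchy-Schwarz inequality.\<close>
  define c where "c = cnj (cinner x y) / of_real (cmod (cinner x y))"
  have "cmod c = 1"
    using False by (simp add: c_def norm_divide)
  have "cinner (scaleC c x) y = of_real (cmod (cinner x y))"
    using False by (simp add: c_def complex_norm_square[symmetric] mult.commute[of "cnj _"] power2_eq_square)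
  then have "cmod (cinner x y) = inner (scaleC c x) y"
    by (simp only: Re_cinner[symmetric] Re_complex_of_real)
  also have "\<dots> \<le> norm (scaleC c x) * norm y"
    by (rule norm_cauchy_schwarz)
  finally show ?thesis
    by (simp add: \<open>cmod c = 1\<close>)
qed simp

lemma bounded_linear_cinner_left: "bounded_linear (\<lambda>x. cinner x y)"
  by (rule bounded_linear_intro[where K = "norm y"])
    (simp_all add: cinner_add_left scaleR_scaleC cmod_cinner_le scaleR_conv_of_real)

lemma bounded_linear_scaleC: "bounded_linear (scaleC c)"
  by (rule bounded_linear_intro[where K = "cmod c"])
    (auto intro!: ell2_eqI simp: algebra_simps)

lemmas tendsto_cinner_left = bounded_linear.tendsto[OF bounded_linear_cinner_left]
lemmas tendsto_scaleC = bounded_linear.tendsto[OF bounded_linear_scaleC]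

definition unit_vec :: "'k \<Rightarrow> 'k ell2" where
  "unit_vec k = Abs_ell2 (\<lambda>j. if j = k then 1 else 0)"

lemma coef_unit_vec [simp]: "coef (unit_vec k) j = (if j = k then 1 else 0)"
  unfolding unit_vec_def by (subst coef_Abs) (auto intro: sq_summable_finite_support)

lemma cinner_unit_vec [simp]: "cinner x (unit_vec k) = coef x k"
proof -
  have "cinner x (unit_vec k) = infsum (\<lambda>j. coef x j * cnj (coef (unit_vec k) j)) {k}"
    unfolding cinner_def by (rule infsum_cong_neutral) auto
  then show ?thesis by simp
qed

lemma bounded_linear_coef: "bounded_linear (\<lambda>x. coef x k)"
  using bounded_linear_cinner_left[of "unit_vec k"] by simp

lemma sum_cmod_coef_le:
  assumes "finite F"
  shows "(\<Sum>k\<in>F. (cmod (coef x k))\<^sup>2) \<le> (norm x)\<^sup>2"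
  by (rule finite_sum_le_has_sum[OF norm_sq_ell2]) (use assms in auto)

lemma ell2_of_bounded_sums:
  assumes "\<And>F. finite F \<Longrightarrow> (\<Sum>k\<in>F. (cmod (a k))\<^sup>2) \<le> C\<^sup>2" and "C \<ge> 0"
  shows "sq_summable a" "norm (Abs_ell2 a) \<le> C"
proof -
  have "(\<lambda>k. (cmod (a k))\<^sup>2) summable_on UNIV"
    by (rule nonneg_bdd_above_summable_on) (auto intro!: bdd_aboveI2[where M = "C\<^sup>2"] assms)
  then show a: "sq_summable a"
    by (simp add: sq_summable_def)
  have "(norm (Abs_ell2 a))\<^sup>2 \<le> C\<^sup>2"
    by (rule has_sum_le_finite_sums[OF norm_sq_ell2]) (use a assms in auto)
  then show "norm (Abs_ell2 a) \<le> C"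
    using \<open>C \<ge> 0\<close> by (rule power2_le_imp_le)
qed

instance ell2 :: (type) complete_space
proof
  fix X :: "nat \<Rightarrow> 'a ell2"
  assume X: "Cauchy X"
  have "Cauchy (\<lambda>n. coef (X n) k)" for k
    by (rule bounded_linear.Cauchy[OF bounded_linear_coef X])
  then have "\<exists>l. (\<lambda>n. coef (X n) k) \<longlonglongrightarrow> l" for k
    by (simp add: Cauchy_convergent_iff convergent_def)
  then obtain a where a: "\<And>k. (\<lambda>n. coef (X n) k) \<longlonglongrightarrow> a k"
    by metis
  \<comment> \<open>The Cauchy bound is uniform in the finite set F, so it survives the
    coordinatewise limit in m with n fixed.\<close>
  have key: "\<exists>N. \<forall>n\<ge>N. \<forall>F. finite F \<longrightarrow> (\<Sum>k\<in>F. (cmod (coef (X n) k - a k))\<^sup>2) \<le> e\<^sup>2"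
    if "e > 0" for e :: real
  proof -
    obtain N where N: "\<And>m n. m \<ge> N \<Longrightarrow> n \<ge> N \<Longrightarrow> norm (X n - X m) < e"
      using X \<open>e > 0\<close> unfolding Cauchy_def dist_norm by blast
    have "(\<Sum>k\<in>F. (cmod (coef (X n) k - a k))\<^sup>2) \<le> e\<^sup>2" if "n \<ge> N" "finite F" for n F
    proof (rule tendsto_upperbound)
      show "(\<lambda>m. \<Sum>k\<in>F. (cmod (coef (X n) k - coef (X m) k))\<^sup>2) \<longlonglongrightarrow>
          (\<Sum>k\<in>F. (cmod (coef (X n) k - a k))\<^sup>2)"
        by (intro tendsto_intros a)
      show "\<forall>\<^sub>F m in sequentially. (\<Sum>k\<in>F. (cmod (coef (X n) k - coef (X m) k))\<^sup>2) \<le> e\<^sup>2"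
      proof (rule eventually_sequentiallyI)
        fix m assume "m \<ge> N"
        have "(\<Sum>k\<in>F. (cmod (coef (X n - X m) k))\<^sup>2) \<le> (norm (X n - X m))\<^sup>2"
          by (rule sum_cmod_coef_le) fact
        also have "\<dots> \<le> e\<^sup>2"
          using N[OF \<open>m \<ge> N\<close> \<open>n \<ge> N\<close>] by (intro power_mono) auto
        finally show "(\<Sum>k\<in>F. (cmod (coef (X n) k - coef (X m) k))\<^sup>2) \<le> e\<^sup>2"
          by simp
      qed
    qed simp
    then show ?thesis by blast
  qed
  obtain N where N: "\<And>F. finite F \<Longrightarrow> (\<Sum>k\<in>F. (cmod (coef (X N) k - a k))\<^sup>2) \<le> 1\<^sup>2"
    using key[of 1] by auto
  have "sq_summable (\<lambda>k. coef (X N) k - a k)"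
    by (rule ell2_of_bounded_sums(1)[OF N]) auto
  then have "sq_summable (\<lambda>k. coef (X N) k + (-1) * (coef (X N) k - a k))"
    by (intro sq_summable_add sq_summable_scale) auto
  then have sa: "sq_summable a" by simp
  have "X \<longlonglongrightarrow> Abs_ell2 a"
  proof (rule LIMSEQ_I)
    fix r :: real assume "r > 0"
    then obtain N where N: "\<And>n F. n \<ge> N \<Longrightarrow> finite F \<Longrightarrow>
        (\<Sum>k\<in>F. (cmod (coef (X n) k - a k))\<^sup>2) \<le> (r/2)\<^sup>2"
      using key[of "r/2"] by auto
    have "norm (X n - Abs_ell2 a) < r" if "n \<ge> N" for n
    proof -
      have "norm (Abs_ell2 (\<lambda>k. coef (X n) k - a k)) \<le> r / 2"
        by (rule ell2_of_bounded_sums(2)[OF N[OF that]]) (use \<open>r > 0\<close> in auto)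
      moreover have "Abs_ell2 (\<lambda>k. coef (X n) k - a k) = X n - Abs_ell2 a"
        using ell2_of_bounded_sums(1)[OF N[OF that]] \<open>r > 0\<close> sa by (intro ell2_eqI) simp
      ultimately show ?thesis using \<open>r > 0\<close> by simp
    qed
    then show "\<exists>no. \<forall>n\<ge>no. norm (X n - Abs_ell2 a) < r" by blast
  qed
  then show "convergent X" by (auto simp: convergent_def)
qed

instance ell2 :: (type) banach ..

section \<open>Closed subspaces and orthogonal projection\<close>

definition closed_cspace :: "'k ell2 set \<Rightarrow> bool" where
  "closed_cspace V \<longleftrightarrow> cvec.subspace V \<and> closed V"

definition clspan :: "'k ell2 set \<Rightarrow> 'k ell2 set" where
  "clspan B = closure (cvec.span B)"

text \<open>\<open>bounded_linear\<close> speaks of real scalars only, so complex homogeneity is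
  added.\<close>

definition bounded_clinear :: "('k ell2 \<Rightarrow> 'j ell2) \<Rightarrow> bool" where
  "bounded_clinear f \<longleftrightarrow> bounded_linear f \<and> (\<forall>c x. f (scaleC c x) = scaleC c (f x))"

lemma bounded_clinearI:
  assumes "\<And>x y. f (x + y) = f x + f y" "\<And>c x. f (scaleC c x) = scaleC c (f x)"
    "\<And>x. norm (f x) \<le> norm x * K"
  shows "bounded_clinear f"
  unfolding bounded_clinear_def
  using assms by (auto intro!: bounded_linear_intro[of f K] simp: scaleR_scaleC)

context
  fixes f :: "'k ell2 \<Rightarrow> 'j ell2"
  assumes f: "bounded_clinear f"
begin

lemma bounded_clinear_linear: "bounded_linear f"
  using f by (simp add: bounded_clinear_def)

lemma bounded_clinear_scaleC: "f (scaleC c x) = scaleC c (f x)"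
  using f by (simp add: bounded_clinear_def)

lemma bounded_clinear_add: "f (x + y) = f x + f y"
  using bounded_clinear_linear by (simp add: linear_add bounded_linear.linear)

lemma bounded_clinear_diff: "f (x - y) = f x - f y"
  using bounded_clinear_linear by (simp add: linear_diff bounded_linear.linear)

lemma bounded_clinear_zero: "f 0 = 0"
  using bounded_clinear_linear by (simp add: linear_0 bounded_linear.linear)

lemma bounded_clinear_tendsto: "(g \<longlongrightarrow> l) F \<Longrightarrow> ((\<lambda>x. f (g x)) \<longlongrightarrow> f l) F"
  using bounded_clinear_linear by (rule bounded_linear.tendsto)

end

lemma closed_cspaceD:
  assumes "closed_cspace V"
  shows "closed V" "0 \<in> V" "x \<in> V \<Longrightarrow> y \<in> V \<Longrightarrow> x + y \<in> V" "x \<in> V \<Longrightarrow> scaleC c x \<in> V"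
    "x \<in> V \<Longrightarrow> y \<in> V \<Longrightarrow> x - y \<in> V" "(\<And>i. i \<in> I \<Longrightarrow> g i \<in> V) \<Longrightarrow> sum g I \<in> V"
  using assms unfolding closed_cspace_def
  by (auto intro: cvec.subspace_0 cvec.subspace_add cvec.subspace_scale cvec.subspace_diff
      cvec.subspace_sum)

lemma closed_cspaceI:
  assumes "0 \<in> V" "\<And>x y. x \<in> V \<Longrightarrow> y \<in> V \<Longrightarrow> x + y \<in> V" "\<And>c x. x \<in> V \<Longrightarrow> scaleC c x \<in> V"
    "\<And>x l. (\<And>n. x n \<in> V) \<Longrightarrow> x \<longlonglongrightarrow> l \<Longrightarrow> l \<in> V"
  shows "closed_cspace V"
  unfolding closed_cspace_def closed_sequential_limits cvec.subspace_def using assms by blast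

lemma closed_cspace_clspan: "closed_cspace (clspan B)"
proof -
  have "cvec.subspace (closure (cvec.span B))"
  proof (rule cvec.subspaceI)
    show "0 \<in> closure (cvec.span B)"
      using closure_subset cvec.span_zero by blast
  next
    fix x y assume "x \<in> closure (cvec.span B)" "y \<in> closure (cvec.span B)"
    then obtain X Y where X: "\<And>n. X n \<in> cvec.span B" "X \<longlonglongrightarrow> x"
      and Y: "\<And>n. Y n \<in> cvec.span B" "Y \<longlonglongrightarrow> y"
      unfolding closure_sequential by blast
    then have "(\<lambda>n. X n + Y n) \<longlonglongrightarrow> x + y" "\<And>n. X n + Y n \<in> cvec.span B"
      by (auto intro: tendsto_add cvec.span_add)
    then show "x + y \<in> closure (cvec.span B)"
      unfolding closure_sequential by (intro exI[of _ "\<lambda>n. X n + Y n"]) auto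
  next
    fix c x assume "x \<in> closure (cvec.span B)"
    then obtain X where X: "\<And>n. X n \<in> cvec.span B" "X \<longlonglongrightarrow> x"
      unfolding closure_sequential by blast
    then have "(\<lambda>n. scaleC c (X n)) \<longlonglongrightarrow> scaleC c x" "\<And>n. scaleC c (X n) \<in> cvec.span B"
      by (auto intro: tendsto_scaleC cvec.span_scale)
    then show "scaleC c x \<in> closure (cvec.span B)"
      unfolding closure_sequential by (intro exI[of _ "\<lambda>n. scaleC c (X n)"]) auto
  qed
  then show ?thesis
    by (simp add: closed_cspace_def clspan_def)
qed

lemma span_subset_clspan: "cvec.span B \<subseteq> clspan B"
  unfolding clspan_def by (rule closure_subset)

lemma clspan_superset: "B \<subseteq> clspan B"
  using cvec.span_superset span_subset_clspan by blast

lemma clspan_base: "x \<in> B \<Longrightarrow> x \<in> clspan B"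
  using clspan_superset by blast

lemma clspan_minimal: "B \<subseteq> V \<Longrightarrow> closed_cspace V \<Longrightarrow> clspan B \<subseteq> V"
  unfolding clspan_def closed_cspace_def
  by (intro closure_minimal cvec.span_minimal) auto

lemma clspan_subset: "B \<subseteq> clspan C \<Longrightarrow> clspan B \<subseteq> clspan C"
  by (rule clspan_minimal[OF _ closed_cspace_clspan])

lemma clspan_mono: "B \<subseteq> C \<Longrightarrow> clspan B \<subseteq> clspan C"
  using clspan_superset by (intro clspan_subset) blast

lemma clspan_eqI: "B \<subseteq> clspan C \<Longrightarrow> C \<subseteq> clspan B \<Longrightarrow> clspan B = clspan C"
  by (intro equalityI clspan_subset)

lemma clspan_Union_clspan: "clspan (\<Union>i\<in>I. clspan (B i)) = clspan (\<Union>i\<in>I. B i)"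
proof (rule clspan_eqI)
  show "(\<Union>i\<in>I. clspan (B i)) \<subseteq> clspan (\<Union>i\<in>I. B i)"
    by (intro UN_least clspan_mono) auto
  show "(\<Union>i\<in>I. B i) \<subseteq> clspan (\<Union>i\<in>I. clspan (B i))"
    by (rule order_trans[OF UN_mono[OF order_refl clspan_superset] clspan_superset])
qed

lemma closed_cspace_UNIV: "closed_cspace UNIV"
  by (rule closed_cspaceI) auto

lemma closed_cspace_vimage:
  assumes "bounded_clinear f" "closed_cspace V"
  shows "closed_cspace {x. f x \<in> V}"
proof (rule closed_cspaceI)
  fix x l assume "\<And>n. x n \<in> {x. f x \<in> V}" and l: "x \<longlonglongrightarrow> l"
  then have "f (x n) \<in> V" for n by blast
  from closed_sequentially[OF closed_cspaceD(1)[OF assms(2)] this bounded_clinear_tendsto[OF assms(1) l]]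
  show "l \<in> {x. f x \<in> V}" by blast
qed (use assms in \<open>auto simp: bounded_clinear_zero bounded_clinear_add bounded_clinear_scaleC
    closed_cspaceD\<close>)

lemma clspan_image_subset:
  assumes "bounded_clinear f" "closed_cspace V" "f ` B \<subseteq> V"
  shows "f ` clspan B \<subseteq> V"
  using clspan_minimal[OF _ closed_cspace_vimage[OF assms(1,2)], of B] assms(3) by blast

lemma closed_cspace_orthogonal: "closed_cspace {x. \<forall>y\<in>Y. cinner x y = 0}"
proof (rule closed_cspaceI)
  fix x :: "nat \<Rightarrow> 'a ell2" and l
  assume x: "\<And>n. x n \<in> {x. \<forall>y\<in>Y. cinner x y = 0}" "x \<longlonglongrightarrow> l"
  show "l \<in> {x. \<forall>y\<in>Y. cinner x y = 0}"
  proof safe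
    fix y assume "y \<in> Y"
    have "(\<lambda>n. cinner (x n) y) \<longlonglongrightarrow> cinner l y"
      by (rule tendsto_cinner_left) (rule x(2))
    moreover have "(\<lambda>n. cinner (x n) y) = (\<lambda>n. 0)"
      using x(1) \<open>y \<in> Y\<close> by auto
    ultimately show "cinner l y = 0"
      using LIMSEQ_unique tendsto_const by metis
  qed
qed (auto simp: cinner_add_left)

lemma cinner_eq_0_clspan:
  assumes "\<And>b. b \<in> B \<Longrightarrow> cinner b y = 0" "x \<in> clspan B"
  shows "cinner x y = 0"
  using clspan_minimal[OF _ closed_cspace_orthogonal[of "{y}"], of B] assms by blast

lemma minimal_distance_orthogonal:
  fixes e :: "'k ell2"
  assumes V: "cvec.subspace V" and min: "\<And>v. v \<in> V \<Longrightarrow> norm e \<le> norm (e - v)" and v: "v \<in> V"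
  shows "cinner e v = 0"
proof -
  have real: "inner e v = 0" if "v \<in> V" for v
  proof (cases "v = 0")
    case False
    \<comment> \<open>The real t at which the norm of e - t v is least.\<close>
    define t where "t = inner e v / (norm v)\<^sup>2"
    have "t *\<^sub>R v \<in> V"
      unfolding scaleR_scaleC using V that by (rule cvec.subspace_scale)
    from min[OF this] have "(norm e)\<^sup>2 \<le> (norm (e - t *\<^sub>R v))\<^sup>2"
      by (simp add: power_mono)
    also have "\<dots> = (norm e)\<^sup>2 - 2 * t * inner e v + t\<^sup>2 * (norm v)\<^sup>2"
      unfolding power2_norm_eq_inner
      by (simp add: inner_diff_left inner_diff_right inner_commute[of v e] power2_eq_square algebra_simps)
    also have "\<dots> = (norm e)\<^sup>2 - (inner e v)\<^sup>2 / (norm v)\<^sup>2"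
      using False by (simp add: t_def power2_eq_square field_simps)
    finally have "(inner e v)\<^sup>2 / (norm v)\<^sup>2 \<le> 0" by simp
    then show ?thesis
      using False by (simp add: divide_le_0_iff)
  qed simp
  \<comment> \<open>The real statement for \<i> v gives the imaginary part.\<close>
  have "scaleC \<i> v \<in> V"
    using V v by (rule cvec.subspace_scale)
  then have "Re (cinner e (scaleC \<i> v)) = 0"
    unfolding Re_cinner by (rule real)
  moreover have "Re (cinner e v) = 0"
    unfolding Re_cinner using v by (rule real)
  ultimately show ?thesis
    by (simp add: complex_eq_iff)
qed

lemma parallelogram:
  fixes x y :: "'a :: real_inner"
  shows "(norm (x + y))\<^sup>2 + (norm (x - y))\<^sup>2 = 2 * (norm x)\<^sup>2 + 2 * (norm y)\<^sup>2"
  by (simp add: power2_norm_eq_inner inner_add_left inner_add_right inner_diff_left inner_diff_right)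

lemma orthogonal_projection_exists:
  fixes x :: "'k ell2"
  assumes V: "closed_cspace V"
  shows "\<exists>p\<in>V. \<forall>v\<in>V. cinner (x - p) v = 0"
proof -
  define d where "d = (INF v\<in>V. (norm (x - v))\<^sup>2)"
  have bdd: "bdd_below ((\<lambda>v. (norm (x - v))\<^sup>2) ` V)"
    by (rule bdd_belowI2[of _ 0]) auto
  have d: "d \<le> (norm (x - v))\<^sup>2" if "v \<in> V" for v
    unfolding d_def using bdd that by (rule cINF_lower)
  have "\<exists>v\<in>V. (norm (x - v))\<^sup>2 < d + 1 / Suc n" for n
    using cInf_lessD[of "(\<lambda>v. (norm (x - v))\<^sup>2) ` V" "d + 1 / Suc n"] closed_cspaceD(2)[OF V]
    by (auto simp: d_def)
  then obtain p where p: "\<And>n. p n \<in> V" "\<And>n. (norm (x - p n))\<^sup>2 < d + 1 / Suc n"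
    by metis
  \<comment> \<open>The midpoint of \<open>p m\<close> and \<open>p n\<close> lies in V, so its
    squared distance from x is at least d; the parallelogram law turns this into a bound on the
    difference.\<close>
  have cauchy: "(norm (p m - p n))\<^sup>2 \<le> 2 / Suc m + 2 / Suc n" for m n
  proof -
    have "(1/2) *\<^sub>R (p m + p n) \<in> V"
      unfolding scaleR_scaleC by (intro closed_cspaceD[OF V] p)
    then have "4 * d \<le> 4 * (norm (x - (1/2) *\<^sub>R (p m + p n)))\<^sup>2"
      using d by simp
    also have "x - (1/2) *\<^sub>R (p m + p n) = (1/2) *\<^sub>R ((x - p m) + (x - p n))"
      by (simp add: algebra_simps) (simp flip: scaleR_add_left)
    also have "4 * (norm ((1/2) *\<^sub>R ((x - p m) + (x - p n))))\<^sup>2 = (norm ((x - p m) + (x - p n)))\<^sup>2"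
      by (simp add: power_divide)
    also have "\<dots> = 2 * (norm (x - p m))\<^sup>2 + 2 * (norm (x - p n))\<^sup>2 - (norm (p m - p n))\<^sup>2"
      using parallelogram[of "x - p m" "x - p n"] by (simp add: norm_minus_commute)
    finally show ?thesis
      using p(2)[of m] p(2)[of n] by simp
  qed
  have "Cauchy p"
  proof (rule metric_CauchyI)
    fix e :: real assume "e > 0"
    obtain M where M: "4 / e\<^sup>2 < real M"
      using reals_Archimedean2 by blast
    have "dist (p m) (p n) < e" if "m \<ge> M" "n \<ge> M" for m n
    proof -
      have M0: "4 < e\<^sup>2 * real (Suc M)"
        using M \<open>e > 0\<close> by (simp add: field_simps) (smt (verit) zero_less_power)
      have "(norm (p m - p n))\<^sup>2 \<le> 2 / Suc m + 2 / Suc n" by (rule cauchy)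
      also have "\<dots> \<le> 2 / Suc M + 2 / Suc M"
        using that by (intro add_mono divide_left_mono) auto
      also have "\<dots> < e\<^sup>2"
      proof -
        have "2 / real (Suc M) + 2 / real (Suc M) = 4 / real (Suc M)"
          by (simp flip: add_divide_distrib)
        also have "\<dots> < e\<^sup>2"
          using M0 by (subst pos_divide_less_eq) auto
        finally show ?thesis by simp
      qed
      finally show ?thesis
        using \<open>e > 0\<close> by (simp add: dist_norm power2_less_imp_less)
    qed
    then show "\<exists>M. \<forall>m\<ge>M. \<forall>n\<ge>M. dist (p m) (p n) < e" by blast
  qed
  then obtain q where q: "p \<longlonglongrightarrow> q"
    by (auto simp: Cauchy_convergent_iff convergent_def)
  have "q \<in> V"
    using closed_cspaceD(1)[OF V] p(1) q by (rule closed_sequentially)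
  have "(norm (x - q))\<^sup>2 \<le> d + 0"
  proof (rule LIMSEQ_le)
    show "(\<lambda>n. (norm (x - p n))\<^sup>2) \<longlonglongrightarrow> (norm (x - q))\<^sup>2"
      by (intro tendsto_intros q)
    show "(\<lambda>n. d + 1 / Suc n) \<longlonglongrightarrow> d + 0"
      by (intro tendsto_intros LIMSEQ_Suc[OF lim_1_over_n])
  qed (use p(2) in \<open>auto intro: less_imp_le\<close>)
  have "norm (x - q) \<le> norm (x - q - v)" if "v \<in> V" for v
  proof (rule power2_le_imp_le)
    have "d \<le> (norm (x - (q + v)))\<^sup>2"
      using closed_cspaceD(3)[OF V \<open>q \<in> V\<close> that] by (rule d)
    then show "(norm (x - q))\<^sup>2 \<le> (norm (x - q - v))\<^sup>2"
      using \<open>(norm (x - q))\<^sup>2 \<le> d + 0\<close> unfolding diff_diff_eq by linarith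
  qed simp
  then have "\<forall>v\<in>V. cinner (x - q) v = 0"
    using minimal_distance_orthogonal[of V "x - q"] V by (auto simp: closed_cspace_def)
  with \<open>q \<in> V\<close> show ?thesis by blast
qed

text \<open>The difference between a vector of U and its projection to the closed span of B is
  orthogonal to B, hence 0. Closed spans are computed this way throughout.\<close>

lemma clspan_eq_if_total:
  assumes U: "closed_cspace U" and "B \<subseteq> U"
    and total: "\<And>x. x \<in> U \<Longrightarrow> (\<And>b. b \<in> B \<Longrightarrow> cinner x b = 0) \<Longrightarrow> x = 0"
  shows "clspan B = U"
proof
  show "clspan B \<subseteq> U"
    by (rule clspan_minimal) fact+
  show "U \<subseteq> clspan B"
  proof
    fix x assume "x \<in> U"
    obtain p where p: "p \<in> clspan B" "\<And>v. v \<in> clspan B \<Longrightarrow> cinner (x - p) v = 0"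
      using orthogonal_projection_exists[OF closed_cspace_clspan] by blast
    have "x - p = 0"
    proof (rule total)
      show "x - p \<in> U"
        using \<open>clspan B \<subseteq> U\<close> p(1) \<open>x \<in> U\<close> by (intro closed_cspaceD[OF U]) auto
    qed (use p(2) clspan_base in blast)
    with p(1) show "x \<in> clspan B" by simp
  qed
qed

lemma clspan_unit_vec: "clspan (range unit_vec) = UNIV"
proof (rule clspan_eq_if_total[OF closed_cspace_UNIV])
  fix x :: "'a ell2" assume *: "\<And>b. b \<in> range unit_vec \<Longrightarrow> cinner x b = 0"
  show "x = 0"
    using *[of "unit_vec _"] by (intro ell2_eqI) simp
qed auto

section \<open>Weak limits\<close>

text \<open>The filter is arbitrary because the fact serves both sequences and pairs of indices;
  along pairs it expresses the Cauchy condition.\<close>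

lemma closed_cspace_weak_null:
  fixes x :: "'i \<Rightarrow> 'k ell2"
  assumes bound: "\<And>i. norm (x i) \<le> C"
  shows "closed_cspace {z. ((\<lambda>i. cinner (x i) z) \<longlongrightarrow> 0) F}"
proof (rule closed_cspaceI)
  fix y z :: "'k ell2" and c
  assume y: "y \<in> {z. ((\<lambda>i. cinner (x i) z) \<longlongrightarrow> 0) F}"
  then show "scaleC c y \<in> {z. ((\<lambda>i. cinner (x i) z) \<longlongrightarrow> 0) F}"
    by (auto intro: tendsto_mult_right_zero)
  assume "z \<in> {z. ((\<lambda>i. cinner (x i) z) \<longlongrightarrow> 0) F}"
  with y show "y + z \<in> {z. ((\<lambda>i. cinner (x i) z) \<longlongrightarrow> 0) F}"
    by (auto simp: cinner_add_right intro: tendsto_add_zero)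
next
  fix Z :: "nat \<Rightarrow> 'k ell2" and l
  assume Z: "\<And>n. Z n \<in> {z. ((\<lambda>i. cinner (x i) z) \<longlongrightarrow> 0) F}" "Z \<longlonglongrightarrow> l"
  have "((\<lambda>i. cinner (x i) l) \<longlongrightarrow> 0) F"
  proof (rule tendstoI)
    fix e :: real assume "e > 0"
    have "(\<lambda>n. (\<bar>C\<bar> + 1) * norm (l - Z n)) \<longlonglongrightarrow> (\<bar>C\<bar> + 1) * norm (l - l)"
      by (intro tendsto_intros Z)
    then have "\<forall>\<^sub>F n in sequentially. (\<bar>C\<bar> + 1) * norm (l - Z n) < e / 2"
      by (rule order_tendstoD) (use \<open>e > 0\<close> in auto)
    then obtain n where n: "(\<bar>C\<bar> + 1) * norm (l - Z n) < e / 2"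
      using eventually_happens trivial_limit_sequentially by blast
    have "\<forall>\<^sub>F i in F. dist (cinner (x i) (Z n)) 0 < e / 2"
      using Z(1)[of n] \<open>e > 0\<close> by (intro tendstoD) auto
    then show "\<forall>\<^sub>F i in F. dist (cinner (x i) l) 0 < e"
    proof eventually_elim
      case (elim i)
      have "cmod (cinner (x i) (l - Z n)) \<le> norm (x i) * norm (l - Z n)"
        by (rule cmod_cinner_le)
      also have "\<dots> \<le> (\<bar>C\<bar> + 1) * norm (l - Z n)"
        using bound[of i] by (intro mult_right_mono) auto
      finally have "cmod (cinner (x i) l - cinner (x i) (Z n)) < e / 2"
        using n by (simp add: cinner_diff_right)
      with elim show ?case
        using norm_triangle_sub[of "cinner (x i) l" "cinner (x i) (Z n)"] by simp
    qed
  qed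
  then show "l \<in> {z. ((\<lambda>i. cinner (x i) z) \<longlongrightarrow> 0) F}" by simp
qed simp

lemma weak_null_if_total:
  assumes "\<And>i. norm (x i) \<le> C" "clspan T = UNIV"
    and "\<And>t. t \<in> T \<Longrightarrow> ((\<lambda>i. cinner (x i) t) \<longlongrightarrow> 0) F"
  shows "((\<lambda>i. cinner (x i) z) \<longlongrightarrow> 0) F"
  using clspan_minimal[OF _ closed_cspace_weak_null[where F = F and x = x, OF assms(1)], of T] assms(2,3) by blast

lemma Cauchy_iff_tendsto_prod:
  fixes f :: "nat \<Rightarrow> complex"
  shows "Cauchy f \<longleftrightarrow> ((\<lambda>(m, n). f m - f n) \<longlongrightarrow> 0) (sequentially \<times>\<^sub>F sequentially)"
  unfolding Cauchy_def tendsto_iff eventually_prod_sequentially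
  by (auto simp: dist_norm norm_minus_commute)

text \<open>Boundedness spreads the Cauchy property from the total set T to all vectors. The limits
  against unit vectors are the coordinates of y, and finite partial sums carry the norm bound
  over.\<close>

lemma weak_limit_exists:
  fixes x :: "nat \<Rightarrow> 'k ell2"
  assumes bound: "\<And>n. norm (x n) \<le> C" and T: "clspan T = UNIV"
    and conv: "\<And>t. t \<in> T \<Longrightarrow> convergent (\<lambda>n. cinner (x n) t)"
  shows "\<exists>y. norm y \<le> C \<and> (\<forall>z. (\<lambda>n. cinner (x n) z) \<longlonglongrightarrow> cinner y z)"
proof -
  have "convergent (\<lambda>n. cinner (x n) z)" for z
  proof -
    have "((\<lambda>i. cinner (x (fst i) - x (snd i)) z) \<longlongrightarrow> 0) (sequentially \<times>\<^sub>F sequentially)"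
    proof (rule weak_null_if_total[OF _ T])
      show "norm (x (fst i) - x (snd i)) \<le> C + C" for i
        using bound[of "fst i"] bound[of "snd i"] norm_triangle_ineq4[of "x (fst i)" "x (snd i)"] by linarith
      show "((\<lambda>i. cinner (x (fst i) - x (snd i)) t) \<longlongrightarrow> 0) (sequentially \<times>\<^sub>F sequentially)"
        if "t \<in> T" for t
        using conv[OF that] unfolding Cauchy_convergent_iff[symmetric] Cauchy_iff_tendsto_prod
        by (simp add: cinner_diff_left case_prod_unfold)
    qed
    then show ?thesis
      unfolding Cauchy_convergent_iff[symmetric] Cauchy_iff_tendsto_prod
      by (simp add: cinner_diff_left case_prod_unfold)
  qed
  from this[of "unit_vec _"] obtain a where a: "\<And>k. (\<lambda>n. coef (x n) k) \<longlonglongrightarrow> a k"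
    unfolding convergent_def cinner_unit_vec by metis
  have C: "C \<ge> 0"
    using bound[of 0] norm_ge_zero order_trans by blast
  have sums: "(\<Sum>k\<in>F. (cmod (a k))\<^sup>2) \<le> C\<^sup>2" if "finite F" for F
  proof (rule tendsto_upperbound)
    show "(\<lambda>n. \<Sum>k\<in>F. (cmod (coef (x n) k))\<^sup>2) \<longlonglongrightarrow> (\<Sum>k\<in>F. (cmod (a k))\<^sup>2)"
      by (intro tendsto_intros a)
    have "(\<Sum>k\<in>F. (cmod (coef (x n) k))\<^sup>2) \<le> C\<^sup>2" for n
      by (rule order_trans[OF sum_cmod_coef_le[OF that]]) (use bound in \<open>auto intro: power_mono\<close>)
    then show "\<forall>\<^sub>F n in sequentially. (\<Sum>k\<in>F. (cmod (coef (x n) k))\<^sup>2) \<le> C\<^sup>2"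
      by simp
  qed simp
  define y where "y = Abs_ell2 a"
  have y: "coef y = a" "norm y \<le> C"
    using ell2_of_bounded_sums[OF sums C] by (simp_all add: y_def)
  have "(\<lambda>n. cinner (x n - y) z) \<longlonglongrightarrow> 0" for z
  proof (rule weak_null_if_total[OF _ clspan_unit_vec])
    show "norm (x n - y) \<le> C + C" for n
      using bound[of n] y(2) norm_triangle_ineq4[of "x n" y] by linarith
    show "(\<lambda>n. cinner (x n - y) t) \<longlonglongrightarrow> 0" if "t \<in> range unit_vec" for t
    proof -
      obtain k where "t = unit_vec k" using \<open>t \<in> range unit_vec\<close> by blast
      moreover have "(\<lambda>n. coef (x n) k - a k) \<longlonglongrightarrow> 0"
        using a[of k] by (simp add: LIM_zero_iff)
      ultimately show ?thesis by (simp add: y(1))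
    qed
  qed
  then show ?thesis
    using y(2) by (auto simp: cinner_diff_left LIM_zero_iff)
qed

text \<open>The solution is the fixed point of the contraction y \<mapsto> x + \<alpha> T y. It is
  applied to the forward and to the backward shift.\<close>

lemma neumann_solution:
  fixes T :: "'k ell2 \<Rightarrow> 'k ell2"
  assumes T: "bounded_clinear T" "\<And>x. norm (T x) \<le> norm x" and \<alpha>: "cmod \<alpha> < 1"
  shows "\<exists>y. y - scaleC \<alpha> (T y) = x"
proof -
  have "\<exists>!y. x + scaleC \<alpha> (T y) = y"
  proof (rule banach_fix_type)
    have "dist (x + scaleC \<alpha> (T y)) (x + scaleC \<alpha> (T z)) \<le> cmod \<alpha> * dist y z" for y z
    proof -
      have "dist (x + scaleC \<alpha> (T y)) (x + scaleC \<alpha> (T z)) = norm (scaleC \<alpha> (T (y - z)))"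
        by (simp add: dist_norm bounded_clinear_diff[OF T(1)] cvec.scale_right_diff_distrib)
      also have "\<dots> \<le> cmod \<alpha> * dist y z"
        using T(2)[of "y - z"] by (simp add: dist_norm mult_left_mono)
      finally show ?thesis .
    qed
    then show "\<forall>y z. dist (x + scaleC \<alpha> (T y)) (x + scaleC \<alpha> (T z)) \<le> cmod \<alpha> * dist y z"
      by blast
  qed (use \<alpha> in auto)
  then obtain y where "x + scaleC \<alpha> (T y) = y" by blast
  then have "y - scaleC \<alpha> (T y) = x"
    by (metis add_diff_cancel_right')
  then show ?thesis by blast
qed

section \<open>Functions with square-summable coefficients\<close>

definition hfun :: "('k \<Rightarrow> 'x \<Rightarrow> complex) \<Rightarrow> 'x set \<Rightarrow> 'k ell2 \<Rightarrow> 'x \<Rightarrow> complex" where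
  "hfun e D a x = (if x \<in> D then \<Sum>\<^sub>\<infinity>k. coef a k * e k x else 0)"

text \<open>The reproducing kernel; the conjugation makes the inner product with it evaluation at
  x.\<close>

definition kern :: "('k \<Rightarrow> 'x \<Rightarrow> complex) \<Rightarrow> 'x \<Rightarrow> 'k ell2" where
  "kern e x = Abs_ell2 (\<lambda>k. cnj (e k x))"

text \<open>Totality of the kernels is uniqueness of the coefficients in Hilbert space form. It
  makes \<open>hfun\<close> injective, so that \<open>hardy_coeff\<close> is well defined.\<close>

locale hardy_family =
  fixes e :: "'k \<Rightarrow> 'x \<Rightarrow> complex" and D :: "'x set"
  assumes sq_summable_e: "x \<in> D \<Longrightarrow> sq_summable (\<lambda>k. e k x)"
    and kern_total: "clspan (kern e ` D) = UNIV"
begin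

lemma coef_kern: "x \<in> D \<Longrightarrow> coef (kern e x) k = cnj (e k x)"
  unfolding kern_def
  by (subst coef_Abs) (auto intro: sq_summable_comparison[OF sq_summable_e])

lemma hfun_cinner: "x \<in> D \<Longrightarrow> hfun e D a x = cinner a (kern e x)"
  by (simp add: hfun_def cinner_def coef_kern)

lemma hfun_outside: "x \<notin> D \<Longrightarrow> hfun e D a x = 0"
  by (simp add: hfun_def)

lemma hfun_has_sum: "x \<in> D \<Longrightarrow> ((\<lambda>k. coef a k * e k x) has_sum hfun e D a x) UNIV"
  using cinner_summable[of a "kern e x"] by (simp add: hfun_def coef_kern)

lemma hfun_eqI:
  assumes "\<And>x. x \<in> D \<Longrightarrow> hfun e D a x = hfun e D b x"
  shows "a = b"
proof -
  have "cinner (kern e x) (a - b) = 0" if "x \<in> D" for x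
    using assms[OF that] that
    by (subst cinner_commute) (simp add: hfun_cinner cinner_diff_left)
  then have "cinner z (a - b) = 0" for z
    using cinner_eq_0_clspan[of "kern e ` D" "a - b" z] kern_total by auto
  from this[of "a - b"] show ?thesis
    by (simp add: cinner_norm)
qed

lemma inj_hfun: "inj (hfun e D)"
  by (rule injI) (auto intro: hfun_eqI)

lemma hardy_expansion_iff: "hardy_expansion e D f b \<longleftrightarrow> sq_summable b \<and> f = hfun e D (Abs_ell2 b)"
proof
  assume h: "hardy_expansion e D f b"
  then have b: "sq_summable b"
    by (simp add: hardy_expansion_def sq_summable_def)
  moreover have "f = hfun e D (Abs_ell2 b)"
    using h b by (auto simp: hardy_expansion_def hfun_def fun_eq_iff infsumI)
  ultimately show "sq_summable b \<and> f = hfun e D (Abs_ell2 b)" by blast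
next
  assume "sq_summable b \<and> f = hfun e D (Abs_ell2 b)"
  then show "hardy_expansion e D f b"
    using hfun_has_sum[of _ "Abs_ell2 b"]
    by (auto simp: hardy_expansion_def sq_summable_def[symmetric] hfun_outside)
qed

lemma hardy_eq_range: "hardy e D = range (hfun e D)"
  unfolding hardy_def hardy_expansion_iff
  by auto (metis coef_inverse sq_summable_coef)

lemma hardy_coeff_hfun: "hardy_coeff e D (hfun e D a) = coef a"
  unfolding hardy_coeff_def hardy_expansion_iff
  by (rule the_equality) (auto simp: coef_inverse dest: injD[OF inj_hfun])

lemma hardy_inner_hfun: "hardy_inner e D (hfun e D a) (hfun e D b) = cinner a b"
  by (simp add: hardy_inner_def hardy_coeff_hfun cinner_def)

lemma hfun_add: "hfun e D (a + b) = hfun e D a + hfun e D b"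
proof
  show "hfun e D (a + b) x = (hfun e D a + hfun e D b) x" for x
    by (cases "x \<in> D") (simp_all add: hfun_cinner hfun_outside cinner_add_left)
qed

lemma hfun_diff: "hfun e D (a - b) = hfun e D a - hfun e D b"
proof
  show "hfun e D (a - b) x = (hfun e D a - hfun e D b) x" for x
    by (cases "x \<in> D") (simp_all add: hfun_cinner hfun_outside cinner_diff_left)
qed

lemma hfun_scaleC: "hfun e D (scaleC c a) = fscale c (hfun e D a)"
proof
  show "hfun e D (scaleC c a) x = fscale c (hfun e D a) x" for x
    by (cases "x \<in> D") (simp_all add: hfun_cinner hfun_outside fscale_def)
qed

lemma hfun_zero: "hfun e D 0 = 0"
  by (auto simp: hfun_def fun_eq_iff)

text \<open>Pointwise convergence is convergence against the kernels, which are total. This is the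
  passage from finite to infinite Blaschke products.\<close>

lemma hfun_weak_limit:
  fixes x :: "nat \<Rightarrow> 'k ell2"
  assumes "\<And>n. norm (x n) \<le> C"
    and lim: "\<And>z. z \<in> D \<Longrightarrow> (\<lambda>n. hfun e D (x n) z) \<longlonglongrightarrow> f z"
  shows "\<exists>y. norm y \<le> C \<and> (\<forall>z\<in>D. hfun e D y z = f z)"
proof -
  have "convergent (\<lambda>n. cinner (x n) t)" if "t \<in> kern e ` D" for t
    using that lim by (auto simp: hfun_cinner intro: convergentI)
  from weak_limit_exists[OF assms(1) kern_total this]
  obtain y where y: "norm y \<le> C" "\<And>z. (\<lambda>n. cinner (x n) z) \<longlonglongrightarrow> cinner y z"
    by blast
  have "hfun e D y z = f z" if "z \<in> D" for z
    using y(2)[of "kern e z"] lim[OF that] LIMSEQ_unique by (simp add: hfun_cinner that) blast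
  with y(1) show ?thesis by blast
qed

end

section \<open>Shifts\<close>

text \<open>For injective g, \<open>push g\<close> is an isometry with adjoint
  \<open>pull g\<close>. Maps that raise exponents give the shifts in one and several
  variables.\<close>

definition pull :: "('k \<Rightarrow> 'j) \<Rightarrow> 'j ell2 \<Rightarrow> 'k ell2" where
  "pull g a = Abs_ell2 (\<lambda>k. coef a (g k))"

definition push :: "('k \<Rightarrow> 'j) \<Rightarrow> 'k ell2 \<Rightarrow> 'j ell2" where
  "push g a = Abs_ell2 (\<lambda>j. if j \<in> range g then coef a (inv g j) else 0)"

lemma norm_sq_summable: "(\<lambda>k. (cmod (coef a k))\<^sup>2) summable_on A"
  using summable_on_subset_banach[OF has_sum_imp_summable[OF norm_sq_ell2[of a]]] by simp

context
  fixes g :: "'k \<Rightarrow> 'j"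
  assumes g: "inj g"
begin

lemma pull_has_sum: "((\<lambda>k. (cmod (coef a (g k)))\<^sup>2) has_sum (\<Sum>\<^sub>\<infinity>j\<in>range g. (cmod (coef a j))\<^sup>2)) UNIV"
proof -
  have "(\<lambda>j. (cmod (coef a j))\<^sup>2) summable_on range g"
    by (rule norm_sq_summable)
  then have "((\<lambda>j. (cmod (coef a j))\<^sup>2) has_sum (\<Sum>\<^sub>\<infinity>j\<in>range g. (cmod (coef a j))\<^sup>2)) (range g)"
    by simp
  then show ?thesis
    by (subst (asm) has_sum_reindex[OF g]) (simp add: o_def)
qed

lemma coef_pull: "coef (pull g a) k = coef a (g k)"
  unfolding pull_def
  by (subst coef_Abs) (use pull_has_sum[of a] in \<open>auto simp: sq_summable_def has_sum_imp_summable\<close>)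

lemma norm_pull_le: "norm (pull g a) \<le> norm a"
proof (rule power2_le_imp_le)
  have "(norm (pull g a))\<^sup>2 = (\<Sum>\<^sub>\<infinity>j\<in>range g. (cmod (coef a j))\<^sup>2)"
    using norm_sq_ell2[of "pull g a"] pull_has_sum[of a] by (auto simp: coef_pull dest: has_sum_unique)
  also have "\<dots> \<le> (\<Sum>\<^sub>\<infinity>j. (cmod (coef a j))\<^sup>2)"
    by (rule infsum_mono2) (auto intro: norm_sq_summable)
  also have "\<dots> = (norm a)\<^sup>2"
    using norm_sq_ell2[of a] by (rule infsumI)
  finally show "(norm (pull g a))\<^sup>2 \<le> (norm a)\<^sup>2" .
qed simp

lemma bounded_clinear_pull: "bounded_clinear (pull g)"
  by (rule bounded_clinearI[where K = 1]) (auto intro!: ell2_eqI simp: coef_pull norm_pull_le)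

lemma coef_push: "coef (push g a) j = (if j \<in> range g then coef a (inv g j) else 0)"
proof -
  have "((\<lambda>j. (cmod (coef a (inv g j)))\<^sup>2) has_sum (norm a)\<^sup>2) (range g)"
    by (subst has_sum_reindex[OF g]) (use norm_sq_ell2[of a] g in \<open>simp add: o_def\<close>)
  moreover have "((\<lambda>j. (cmod (if j \<in> range g then coef a (inv g j) else 0))\<^sup>2) has_sum (norm a)\<^sup>2) UNIV \<longleftrightarrow>
      ((\<lambda>j. (cmod (coef a (inv g j)))\<^sup>2) has_sum (norm a)\<^sup>2) (range g)"
    by (rule has_sum_cong_neutral) auto
  ultimately show ?thesis
    unfolding push_def by (subst coef_Abs) (auto simp: sq_summable_def has_sum_imp_summable)
qed

lemma coef_push_image [simp]: "coef (push g a) (g k) = coef a k"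
  using g by (simp add: coef_push)

lemma pull_push [simp]: "pull g (push g a) = a"
  by (rule ell2_eqI) (simp add: coef_pull)

lemma cinner_push: "cinner (push g a) b = cinner a (pull g b)"
proof -
  have "cinner (push g a) b = (\<Sum>\<^sub>\<infinity>j\<in>range g. coef (push g a) j * cnj (coef b j))"
    unfolding cinner_def by (rule infsum_cong_neutral) (auto simp: coef_push)
  also have "\<dots> = cinner a (pull g b)"
    unfolding cinner_def by (subst infsum_reindex[OF g]) (simp add: o_def coef_pull)
  finally show ?thesis .
qed

lemma norm_push [simp]: "norm (push g a) = norm a"
proof -
  have "(of_real ((norm (push g a))\<^sup>2) :: complex) = of_real ((norm a)\<^sup>2)"
    unfolding cinner_norm[symmetric] cinner_push by simp
  then show ?thesis
    by (simp only: of_real_eq_iff) simp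
qed

lemma bounded_clinear_push: "bounded_clinear (push g)"
  by (rule bounded_clinearI[where K = 1]) (auto intro!: ell2_eqI simp: coef_push)

end

section \<open>The Hardy space of the disc\<close>

abbreviation (input) z_pow :: "nat \<Rightarrow> complex \<Rightarrow> complex" where
  "z_pow \<equiv> \<lambda>k z. z ^ k"

abbreviation H1 :: "nat ell2 \<Rightarrow> complex \<Rightarrow> complex" where
  "H1 \<equiv> hfun z_pow disc"

abbreviation ker1 :: "complex \<Rightarrow> nat ell2" where
  "ker1 \<equiv> kern z_pow"

lemma sq_summable_z_pow:
  assumes "z \<in> disc"
  shows "sq_summable (\<lambda>k. z_pow k z)"
proof -
  have "summable (\<lambda>k. ((cmod z)\<^sup>2) ^ k)"
    using assms by (intro summable_geometric) (auto simp: power2_eq_square abs_square_less_1 intro: mult_le_one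
        simp flip: power2_eq_square)
  then have "(\<lambda>k. ((cmod z)\<^sup>2) ^ k) summable_on UNIV"
    by (subst summable_on_UNIV_nonneg_real_iff) auto
  then show ?thesis
    by (simp add: sq_summable_def norm_power power_mult[symmetric] mult.commute)
qed

lemma coef_ker1: "z \<in> disc \<Longrightarrow> coef (ker1 z) k = cnj z ^ k"
  unfolding kern_def
  by (subst coef_Abs) (auto intro!: sq_summable_comparison[OF sq_summable_z_pow[of z]] simp: norm_power)

text \<open>The power series with coefficients of a vanishes on the disc, and isolation of zeros
  forbids a nonzero coefficient of positive index; index 0 is evaluation at 0.\<close>

lemma eq_zero_if_orthogonal_ker1:
  assumes "\<And>z. z \<in> disc \<Longrightarrow> cinner a (ker1 z) = 0"
  shows "a = 0"
proof (rule ell2_eqI)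
  fix m
  have sums: "(\<lambda>k. coef a k * z ^ k) sums 0" if "norm z < 1" for z
  proof -
    have z: "z \<in> disc" using that by simp
    have "((\<lambda>k. coef a k * z ^ k) has_sum 0) UNIV"
      using cinner_summable[of a "ker1 z"] assms[OF z]
      unfolding cinner_def by (simp add: coef_ker1[OF z] has_sum_iff)
    then show ?thesis by (rule has_sum_imp_sums)
  qed
  show "coef a m = coef 0 m"
  proof (cases "m = 0")
    case True
    then show ?thesis using sums[of 0] by simp
  next
    case False
    show ?thesis
    proof (rule ccontr)
      assume "coef a m \<noteq> coef 0 m"
      then have "coef a m \<noteq> 0" "0 < m" using False by auto
      with sums show False
      proof (rule_tac powser_0_nonzero[of 1 0 "coef a" "\<lambda>_. 0" m])
        fix s :: real assume "0 < s" "\<And>z::complex. z \<in> cball 0 s - {0} \<Longrightarrow> (0::complex) \<noteq> 0"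
        from this(2)[of "of_real s"] this(1) show False by auto
      qed auto
    qed
  qed
qed

interpretation H1: hardy_family z_pow disc
proof
  show "clspan (ker1 ` disc) = UNIV"
    by (rule clspan_eq_if_total) (auto intro: closed_cspace_UNIV eq_zero_if_orthogonal_ker1)
qed (rule sq_summable_z_pow)

lemma H1_sums: "z \<in> disc \<Longrightarrow> (\<lambda>k. coef a k * z ^ k) sums H1 a z"
  by (rule has_sum_imp_sums) (rule H1.hfun_has_sum)

lemma H1_holomorphic: "H1 a holomorphic_on disc"
  by (rule power_series_holomorphic[of 0 1 "coef a"]) (use H1_sums[of _ a] in simp)

lemma H1_analytic: "z \<in> disc \<Longrightarrow> H1 a analytic_on {z}"
  using H1_holomorphic[of a] by (meson analytic_at open_ball)

lemma H1_nonzero_point: "a \<noteq> 0 \<Longrightarrow> \<exists>z\<in>disc. H1 a z \<noteq> 0"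
  using H1.hfun_eqI[of a 0] unfolding H1.hfun_zero by (metis zero_fun_apply)

lemma H1_eventually_nonzero:
  assumes "a \<noteq> 0" "z \<in> disc"
  shows "\<forall>\<^sub>F w in at z. H1 a w \<noteq> 0 \<and> w \<in> disc"
proof -
  obtain b where "b \<in> disc" "H1 a b \<noteq> 0"
    using H1_nonzero_point[OF assms(1)] by blast
  then show ?thesis
    using non_zero_neighbour_alt[OF H1_holomorphic open_ball connected_ball \<open>z \<in> disc\<close>] by blast
qed

abbreviation shift :: "nat ell2 \<Rightarrow> nat ell2" where
  "shift \<equiv> push Suc"

abbreviation bshift :: "nat ell2 \<Rightarrow> nat ell2" where
  "bshift \<equiv> pull Suc"

lemma bshift_ker1: "z \<in> disc \<Longrightarrow> bshift (ker1 z) = scaleC (cnj z) (ker1 z)"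
  by (rule ell2_eqI) (simp add: coef_pull coef_ker1)

lemma H1_shift: "z \<in> disc \<Longrightarrow> H1 (shift a) z = z * H1 a z"
  by (simp add: H1.hfun_cinner cinner_push bshift_ker1)

lemma H1_unit_vec_0: "z \<in> disc \<Longrightarrow> H1 (unit_vec 0) z = 1"
  by (subst H1.hfun_cinner, simp, subst cinner_commute, simp add: coef_ker1)

lemma coef_shift_0 [simp]: "coef (shift a) 0 = 0"
  by (simp add: coef_push)

text \<open>This and the next operator are the numerator and the denominator of
  \<open>blaschke_factor \<alpha>\<close>, acting by multiplication.\<close>

definition lin_mult :: "complex \<Rightarrow> nat ell2 \<Rightarrow> nat ell2" where
  "lin_mult \<alpha> u = shift u - scaleC \<alpha> u"

definition colin_mult :: "complex \<Rightarrow> nat ell2 \<Rightarrow> nat ell2" where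
  "colin_mult \<alpha> u = u - scaleC (cnj \<alpha>) (shift u)"

lemmas shift_simps = bounded_clinear_add[OF bounded_clinear_push[OF inj_Suc]]
  bounded_clinear_diff[OF bounded_clinear_push[OF inj_Suc]]
  bounded_clinear_scaleC[OF bounded_clinear_push[OF inj_Suc]]

lemma H1_lin_mult: "z \<in> disc \<Longrightarrow> H1 (lin_mult \<alpha> u) z = (z - \<alpha>) * H1 u z"
  using H1_shift[of z u]
  by (simp add: lin_mult_def H1.hfun_cinner cinner_diff_left left_diff_distrib)

lemma H1_colin_mult: "z \<in> disc \<Longrightarrow> H1 (colin_mult \<alpha> u) z = (1 - cnj \<alpha> * z) * H1 u z"
  using H1_shift[of z u]
  by (simp add: colin_mult_def H1.hfun_cinner cinner_diff_left left_diff_distrib)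

lemma H1_lin_mult_power: "z \<in> disc \<Longrightarrow> H1 ((lin_mult \<alpha> ^^ n) u) z = (z - \<alpha>) ^ n * H1 u z"
  by (induction n) (simp_all add: H1_lin_mult)

lemma H1_colin_mult_power:
  "z \<in> disc \<Longrightarrow> H1 ((colin_mult \<alpha> ^^ n) u) z = (1 - cnj \<alpha> * z) ^ n * H1 u z"
  by (induction n) (simp_all add: H1_colin_mult)

lemma lin_mult_zero [simp]: "lin_mult \<alpha> 0 = 0"
  by (rule H1.hfun_eqI) (simp add: H1_lin_mult H1.hfun_zero)

lemma lin_mult_power_zero [simp]: "(lin_mult \<alpha> ^^ n) 0 = 0"
  by (induction n) simp_all

lemma lin_colin_mult_commute: "lin_mult \<alpha> (colin_mult \<beta> u) = colin_mult \<beta> (lin_mult \<alpha> u)"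
  by (rule H1.hfun_eqI) (simp add: H1_lin_mult H1_colin_mult)

text \<open>The Hilbert space form of |z - \<alpha>| = |1 - \<open>cnj \<alpha>\<close> z| on the
  unit circle: the expansions of both squares agree because the shift is isometric. Hence Blaschke
  factors act isometrically.\<close>

lemma norm_lin_mult: "norm (lin_mult \<alpha> u) = norm (colin_mult \<alpha> u)"
proof -
  have "cinner (lin_mult \<alpha> u) (lin_mult \<alpha> u) = cinner (colin_mult \<alpha> u) (colin_mult \<alpha> u)"
  proof -
    have [simp]: "cinner (shift u) (shift u) = cinner u u"
      by (simp add: cinner_push)
    show ?thesis
      by (simp add: lin_mult_def colin_mult_def cinner_diff_left cinner_diff_right algebra_simps)
  qed
  then have "(norm (lin_mult \<alpha> u))\<^sup>2 = (norm (colin_mult \<alpha> u))\<^sup>2"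
    unfolding cinner_norm by (simp only: of_real_eq_iff)
  then show ?thesis
    by simp
qed

lemma norm_lin_mult_power: "norm ((lin_mult \<alpha> ^^ n) u) = norm ((colin_mult \<alpha> ^^ n) u)"
proof (induction n arbitrary: u)
  case (Suc n)
  have comm: "colin_mult \<alpha> ((lin_mult \<alpha> ^^ n) u) = (lin_mult \<alpha> ^^ n) (colin_mult \<alpha> u)" for u
    by (induction n) (simp_all add: lin_colin_mult_commute[symmetric])
  have "norm ((lin_mult \<alpha> ^^ Suc n) u) = norm (colin_mult \<alpha> ((lin_mult \<alpha> ^^ n) u))"
    by (simp add: norm_lin_mult)
  also have "\<dots> = norm ((colin_mult \<alpha> ^^ n) (colin_mult \<alpha> u))"
    by (simp add: comm Suc.IH)
  finally show ?case
    by (simp add: funpow_swap1)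
qed simp

lemma bounded_clinear_shift: "bounded_clinear shift"
  by (rule bounded_clinear_push) simp

lemma bounded_clinear_bshift: "bounded_clinear bshift"
  by (rule bounded_clinear_pull) simp

lemma colin_mult_surj:
  assumes "\<alpha> \<in> disc"
  shows "\<exists>u. colin_mult \<alpha> u = y"
  unfolding colin_mult_def
  by (rule neumann_solution[OF bounded_clinear_shift]) (use assms in auto)

text \<open>If y - \<alpha> \<open>bshift y\<close> = f, then
  \<open>lin_mult \<alpha> (bshift y)\<close> differs from f by a constant only, because
  \<open>shift (bshift y)\<close> drops just the constant term of y. Evaluation at \<alpha> shows
  that this constant is 0.\<close>

lemma lin_mult_eqI_zero:
  assumes \<alpha>: "\<alpha> \<in> disc" and "H1 f \<alpha> = 0"
  shows "\<exists>u. f = lin_mult \<alpha> u"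
proof -
  obtain y where y: "y - scaleC \<alpha> (bshift y) = f"
    using neumann_solution[OF bounded_clinear_bshift, of \<alpha> f] norm_pull_le[of Suc] \<alpha> by auto
  have "shift (bshift y) = y - scaleC (coef y 0) (unit_vec 0)"
  proof (rule ell2_eqI)
    show "coef (shift (bshift y)) k = coef (y - scaleC (coef y 0) (unit_vec 0)) k" for k
      by (cases k) (simp_all add: coef_pull)
  qed
  then have eq: "lin_mult \<alpha> (bshift y) = f - scaleC (coef y 0) (unit_vec 0)"
    by (simp add: lin_mult_def y[symmetric])
  have "H1 (lin_mult \<alpha> (bshift y)) \<alpha> = H1 f \<alpha> - coef y 0 * H1 (unit_vec 0) \<alpha>"
    using \<alpha> unfolding eq by (simp add: H1.hfun_cinner cinner_diff_left)
  then have "coef y 0 = 0"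
    using \<alpha> assms(2) by (simp add: H1_lin_mult H1_unit_vec_0)
  with eq show ?thesis by auto
qed

subsection \<open>Jets\<close>

text \<open>
  \<open>jet \<alpha> j\<close> represents, up to lower order terms, the functional \<open>f \<mapsto> f\<^sup>(\<^sup>j\<^sup>)(\<alpha>) / j!\<close>; it is
  \<open>z\<^sup>j / (1 - cnj \<alpha> z)\<^sup>(\<^sup>j\<^sup>+\<^sup>1\<^sup>)\<close>.
\<close>

primrec jet :: "complex \<Rightarrow> nat \<Rightarrow> nat ell2" where
  "jet \<alpha> 0 = ker1 \<alpha>"
| "jet \<alpha> (Suc j) = shift (SOME w. colin_mult \<alpha> w = jet \<alpha> j)"

lemma bshift_jet_0: "\<alpha> \<in> disc \<Longrightarrow> bshift (jet \<alpha> 0) = scaleC (cnj \<alpha>) (jet \<alpha> 0)"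
  by (simp add: bshift_ker1)

text \<open>The jets at \<alpha> form a Jordan chain of the backward shift for the eigenvalue
  \<open>cnj \<alpha>\<close>: the recursion sets the next jet to \<open>shift w\<close> with w -
  \<open>cnj \<alpha>\<close> \<open>shift w\<close> the previous one.\<close>

lemma bshift_jet_Suc:
  assumes "\<alpha> \<in> disc"
  shows "bshift (jet \<alpha> (Suc j)) = scaleC (cnj \<alpha>) (jet \<alpha> (Suc j)) + jet \<alpha> j"
proof -
  define w where "w = (SOME w. colin_mult \<alpha> w = jet \<alpha> j)"
  have "colin_mult \<alpha> w = jet \<alpha> j"
    unfolding w_def using colin_mult_surj[OF assms] by (rule someI_ex)
  then have "w = scaleC (cnj \<alpha>) (shift w) + jet \<alpha> j"
    by (metis add.commute colin_mult_def diff_add_cancel)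
  moreover have "jet \<alpha> (Suc j) = shift w"
    by (simp add: w_def)
  ultimately show ?thesis
    by (simp only: pull_push[OF inj_Suc])
qed

lemma coef_jet_0: "\<alpha> \<in> disc \<Longrightarrow> coef (jet \<alpha> j) 0 = (if j = 0 then 1 else 0)"
  by (cases j) (simp_all add: coef_ker1)

lemma cinner_lin_mult_jet:
  assumes "\<alpha> \<in> disc"
  shows "cinner (lin_mult \<alpha> u) (jet \<alpha> j) = (case j of 0 \<Rightarrow> 0 | Suc i \<Rightarrow> cinner u (jet \<alpha> i))"
  unfolding lin_mult_def cinner_diff_left cinner_push[OF inj_Suc]
  by (cases j) (simp_all add: bshift_jet_0[OF assms] bshift_jet_Suc[OF assms] cinner_add_right
      del: jet.simps)

text \<open>Multiplication by z - \<alpha> is dual to stepping down the Jordan chain. Orders of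
  zeros are read off from jets in this way.\<close>

lemma cinner_lin_mult_power_jet:
  assumes "\<alpha> \<in> disc"
  shows "cinner ((lin_mult \<alpha> ^^ n) u) (jet \<alpha> j) = (if j < n then 0 else cinner u (jet \<alpha> (j - n)))"
proof (induction n arbitrary: j)
  case (Suc n)
  then show ?case
    by (cases j) (simp_all add: cinner_lin_mult_jet[OF assms] del: jet.simps)
qed simp

lemma cinner_jet_0: "\<alpha> \<in> disc \<Longrightarrow> cinner u (jet \<alpha> 0) = H1 u \<alpha>"
  by (simp add: H1.hfun_cinner)

section \<open>Orders of zeros and division in the Hardy space\<close>

definition ord1 :: "nat ell2 \<Rightarrow> complex \<Rightarrow> nat" where
  "ord1 f \<alpha> = nat (zorder (H1 f) \<alpha>)"

text \<open>The factorisation f = g (z - \<alpha>)^N from complex analysis is local. To obtain a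
  cofactor in the Hardy space, one factor is split off at a time, and comparison with g tells
  whether the rest still vanishes at \<alpha>.\<close>

lemma ord1_factor:
  assumes "f \<noteq> 0" and \<alpha>: "\<alpha> \<in> disc"
  shows "\<exists>u. f = (lin_mult \<alpha> ^^ ord1 f \<alpha>) u \<and> H1 u \<alpha> \<noteq> 0"
proof -
  define N where "N = ord1 f \<alpha>"
  obtain r g where r: "r > 0" "cball \<alpha> r \<subseteq> disc" and g: "g holomorphic_on cball \<alpha> r"
    "\<And>w. w \<in> cball \<alpha> r \<Longrightarrow> H1 f w = g w * (w - \<alpha>) ^ N \<and> g w \<noteq> 0"
    using zorder_exist_zero[OF H1_holomorphic open_ball connected_ball \<alpha> H1_nonzero_point[OF assms(1)]]
    unfolding N_def ord1_def by blast
  \<comment> \<open>The power \<open>0 ^ (N - m)\<close> is 1 exactly when m = N, so the cofactor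
    vanishes at \<alpha> until all N factors are removed.\<close>
  have factor: "H1 u \<alpha> = g \<alpha> * 0 ^ (N - m)" if "m \<le> N" "f = (lin_mult \<alpha> ^^ m) u" for m u
  proof -
    have "H1 u w = g w * (w - \<alpha>) ^ (N - m)" if "w \<in> ball \<alpha> r - {\<alpha>}" for w
    proof -
      have "w \<in> cball \<alpha> r" using that by simp
      then have "w \<in> disc" using r(2) by blast
      then have "(w - \<alpha>) ^ m * H1 u w = g w * (w - \<alpha>) ^ N"
        using g(2)[OF \<open>w \<in> cball \<alpha> r\<close>] \<open>f = _\<close> by (simp add: H1_lin_mult_power)
      also have "\<dots> = (w - \<alpha>) ^ m * (g w * (w - \<alpha>) ^ (N - m))"
        using \<open>m \<le> N\<close> by (simp flip: power_add)
      finally show ?thesis using that by simp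
    qed
    then have "\<forall>\<^sub>F w in at \<alpha>. H1 u w = g w * (w - \<alpha>) ^ (N - m)"
      using r(1) eventually_at_in_open[OF open_ball, of \<alpha> \<alpha> r] by (auto elim: eventually_mono)
    moreover have "isCont g \<alpha>"
      using continuous_on_interior[OF holomorphic_on_imp_continuous_on[OF g(1)], of \<alpha>] r(1) by simp
    then have "((\<lambda>w. g w * (w - \<alpha>) ^ (N - m)) \<longlongrightarrow> g \<alpha> * (\<alpha> - \<alpha>) ^ (N - m)) (at \<alpha>)"
      by (intro tendsto_intros) (auto simp: isCont_def)
    ultimately have "(H1 u \<longlongrightarrow> g \<alpha> * (\<alpha> - \<alpha>) ^ (N - m)) (at \<alpha>)"
      by (simp add: filterlim_cong)
    moreover have "(H1 u \<longlongrightarrow> H1 u \<alpha>) (at \<alpha>)"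
      using H1_analytic[OF \<alpha>, of u] by (simp add: analytic_at_imp_isCont flip: isCont_def)
    ultimately show ?thesis
      using tendsto_unique[OF at_neq_bot] by (metis diff_self)
  qed
  have "\<exists>u. f = (lin_mult \<alpha> ^^ m) u" if "m \<le> N" for m
    using that
  proof (induction m)
    case (Suc m)
    then obtain u where u: "f = (lin_mult \<alpha> ^^ m) u" by auto
    have "H1 u \<alpha> = 0"
      using factor[OF _ u] Suc.prems by simp
    from lin_mult_eqI_zero[OF \<alpha> this] obtain v where "u = lin_mult \<alpha> v" by blast
    with u show ?case by (auto simp: funpow_swap1)
  qed simp
  then obtain u where u: "f = (lin_mult \<alpha> ^^ N) u" by blast
  moreover have "H1 u \<alpha> \<noteq> 0"
    using factor[OF order_refl u] g(2)[of \<alpha>] r(1) by simp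
  ultimately show ?thesis
    unfolding N_def by blast
qed

lemma cinner_jet_below_ord1:
  assumes "f \<noteq> 0" "\<alpha> \<in> disc" "j < ord1 f \<alpha>"
  shows "cinner f (jet \<alpha> j) = 0"
proof -
  obtain u where "f = (lin_mult \<alpha> ^^ ord1 f \<alpha>) u"
    using ord1_factor[OF assms(1,2)] by blast
  then have "cinner f (jet \<alpha> j) = cinner ((lin_mult \<alpha> ^^ ord1 f \<alpha>) u) (jet \<alpha> j)"
    by simp
  then show ?thesis
    using assms by (simp add: cinner_lin_mult_power_jet)
qed

lemma cinner_jet_ord1:
  assumes "f \<noteq> 0" "\<alpha> \<in> disc"
  shows "cinner f (jet \<alpha> (ord1 f \<alpha>)) \<noteq> 0"
proof -
  obtain u where u: "f = (lin_mult \<alpha> ^^ ord1 f \<alpha>) u" "H1 u \<alpha> \<noteq> 0"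
    using ord1_factor[OF assms] by blast
  from u(1) have "cinner f (jet \<alpha> (ord1 f \<alpha>)) = cinner ((lin_mult \<alpha> ^^ ord1 f \<alpha>) u) (jet \<alpha> (ord1 f \<alpha>))"
    by simp
  also have "\<dots> = H1 u \<alpha>"
    using assms(2) by (simp add: cinner_lin_mult_power_jet cinner_jet_0 del: jet.simps)
  finally show ?thesis using u(2) by simp
qed

lemma ord1_ge_if_orthogonal:
  assumes "f \<noteq> 0" "\<alpha> \<in> disc" "\<And>j. j < n \<Longrightarrow> cinner f (jet \<alpha> j) = 0"
  shows "n \<le> ord1 f \<alpha>"
  using cinner_jet_ord1[OF assms(1,2)] assms(3) by (meson not_le)

lemma lin_mult_power_factor:
  assumes "f \<noteq> 0" "\<alpha> \<in> disc" "n \<le> ord1 f \<alpha>"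
  shows "\<exists>u. f = (lin_mult \<alpha> ^^ n) u"
proof -
  obtain u where "f = (lin_mult \<alpha> ^^ ord1 f \<alpha>) u"
    using ord1_factor[OF assms(1,2)] by blast
  also have "ord1 f \<alpha> = n + (ord1 f \<alpha> - n)"
    using assms(3) by simp
  finally show ?thesis
    unfolding funpow_add by auto
qed

lemma zorder_H1_mult:
  assumes "f \<noteq> 0" "\<alpha> \<in> disc" "p analytic_on {\<alpha>}"
    and eq: "\<And>z. z \<in> disc \<Longrightarrow> H1 f z = p z * H1 g z"
  shows "zorder (H1 f) \<alpha> = zorder p \<alpha> + zorder (H1 g) \<alpha>" "g \<noteq> 0" "\<exists>\<^sub>F w in at \<alpha>. p w \<noteq> 0"
proof -
  have ev: "\<forall>\<^sub>F w in at \<alpha>. H1 f w = p w * H1 g w \<and> H1 f w \<noteq> 0"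
    using H1_eventually_nonzero[OF assms(1,2)] eq by (auto elim: eventually_mono)
  then have "\<forall>\<^sub>F w in at \<alpha>. p w * H1 g w \<noteq> 0" "\<forall>\<^sub>F w in at \<alpha>. p w \<noteq> 0"
    by (auto elim!: eventually_mono)
  then have "zorder (\<lambda>z. p z * H1 g z) \<alpha> = zorder p \<alpha> + zorder (H1 g) \<alpha>"
    using assms(2,3) by (intro zorder_times_analytic H1_analytic) auto
  moreover have "zorder (H1 f) \<alpha> = zorder (\<lambda>z. p z * H1 g z) \<alpha>"
    using ev by (intro zorder_cong) (auto elim: eventually_mono)
  ultimately show "zorder (H1 f) \<alpha> = zorder p \<alpha> + zorder (H1 g) \<alpha>" by simp
  show "\<exists>\<^sub>F w in at \<alpha>. p w \<noteq> 0"
    using \<open>\<forall>\<^sub>F w in at \<alpha>. p w \<noteq> 0\<close> by (rule eventually_frequently[rotated]) simp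
  show "g \<noteq> 0"
    using eq H1_nonzero_point[OF assms(1)] by (auto simp: H1.hfun_zero)
qed

lemma ord1_mult_ge:
  assumes "f \<noteq> 0" "\<alpha> \<in> disc" "p analytic_on {\<alpha>}" "\<And>z. z \<in> disc \<Longrightarrow> H1 f z = p z * H1 g z"
  shows "ord1 g \<alpha> \<le> ord1 f \<alpha>"
proof -
  have "zorder p \<alpha> \<ge> 0"
    by (intro zorder_ge_0 assms(3) zorder_H1_mult(3)[OF assms])
  then show ?thesis
    using zorder_H1_mult(1)[OF assms] by (simp add: ord1_def)
qed

lemma ord1_mult_unit:
  assumes "f \<noteq> 0" "\<alpha> \<in> disc" "p analytic_on {\<alpha>}" "\<And>z. z \<in> disc \<Longrightarrow> H1 f z = p z * H1 g z" "p \<alpha> \<noteq> 0"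
  shows "ord1 f \<alpha> = ord1 g \<alpha>"
  using zorder_H1_mult(1)[OF assms(1-4)] zorder_eq_0I[OF assms(3,5)] by (simp add: ord1_def)

section \<open>Blaschke products and their model spaces\<close>

lemma blaschke_denominator_nonzero:
  assumes "\<alpha> \<in> disc" "cmod z \<le> 1"
  shows "1 - cnj \<alpha> * z \<noteq> 0"
proof -
  have "cmod (cnj \<alpha> * z) \<le> cmod \<alpha>"
    using assms mult_left_le[of "cmod z" "cmod \<alpha>"] by (simp add: norm_mult)
  also have "\<dots> < 1" using assms by simp
  finally show ?thesis by force
qed

lemma blaschke_factor_zero_iff:
  assumes "\<alpha> \<in> disc" "z \<in> disc"
  shows "blaschke_factor \<alpha> z = 0 \<longleftrightarrow> z = \<alpha>"
  using blaschke_denominator_nonzero[of \<alpha> z] assms by (auto simp: blaschke_factor_def)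

lemma blaschke_factor_eq_Moebius: "blaschke_factor \<alpha> = Moebius_function 0 \<alpha>"
  by (simp add: fun_eq_iff blaschke_factor_def Moebius_function_simple)

lemma cmod_blaschke_factor_le: "\<alpha> \<in> disc \<Longrightarrow> z \<in> disc \<Longrightarrow> cmod (blaschke_factor \<alpha> z) \<le> 1"
  using Moebius_function_norm_lt_1[of \<alpha> z 0] by (simp add: blaschke_factor_eq_Moebius)

lemma blaschke_factor_holomorphic: "\<alpha> \<in> disc \<Longrightarrow> blaschke_factor \<alpha> holomorphic_on disc"
  using Moebius_function_holomorphic[of \<alpha> 0] by (simp add: blaschke_factor_eq_Moebius)

lemma blaschke_factor_inject:
  assumes "\<alpha> \<in> disc" "\<beta> \<in> disc" "l \<ge> 1" "m \<ge> 1"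
    "\<And>z. blaschke_factor \<alpha> z ^ l = blaschke_factor \<beta> z ^ m"
  shows "\<alpha> = \<beta>"
proof -
  have "blaschke_factor \<beta> \<alpha> ^ m = blaschke_factor \<alpha> \<alpha> ^ l"
    by (rule assms(5)[symmetric])
  also have "\<dots> = 0"
    using assms(3) by (simp add: blaschke_factor_def)
  finally show ?thesis
    using blaschke_factor_zero_iff[OF assms(2,1)] by simp
qed

text \<open>From (1 - |b|^2) |1 - \<open>cnj \<alpha>\<close> z|^2 = (1 - |\<alpha>|^2) (1 - |z|^2)
  with |1 - \<open>cnj \<alpha>\<close> z| \<ge> 1 - |z|; the 2 bounds 1 + |\<alpha>|. For fixed z
  the summability of the zeros thus controls the factors.\<close>

lemma one_minus_cmod_blaschke_factor_le:
  assumes \<alpha>: "\<alpha> \<in> disc" and z: "z \<in> disc"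
  shows "1 - cmod (blaschke_factor \<alpha> z) \<le> 2 / (1 - cmod z)\<^sup>2 * (1 - cmod \<alpha>)"
proof -
  define b where "b = cmod (blaschke_factor \<alpha> z)"
  define d where "d = cmod (1 - cnj \<alpha> * z)"
  have b: "0 \<le> b" "b \<le> 1"
    using cmod_blaschke_factor_le[OF assms] by (auto simp: b_def)
  have "d > 0"
    using blaschke_denominator_nonzero[OF \<alpha>, of z] z by (simp add: d_def)
  have "d \<ge> 1 - cmod z"
  proof -
    have "cmod (cnj \<alpha> * z) \<le> cmod z"
      using \<alpha> mult_left_le_one_le[of "cmod z" "cmod \<alpha>"] by (simp add: norm_mult)
    moreover have "1 - cmod (cnj \<alpha> * z) \<le> d"
      unfolding d_def using norm_triangle_ineq2[of 1 "cnj \<alpha> * z"] by simp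
    ultimately show ?thesis by linarith
  qed
  have "(cmod (z - \<alpha>))\<^sup>2 = (cmod z)\<^sup>2 + (cmod \<alpha>)\<^sup>2 - 2 * Re (cnj \<alpha> * z)"
    "d\<^sup>2 = 1 + (cmod \<alpha>)\<^sup>2 * (cmod z)\<^sup>2 - 2 * Re (cnj \<alpha> * z)"
    unfolding d_def cmod_power2 by (simp_all add: power2_eq_square algebra_simps)
  then have "d\<^sup>2 - (cmod (z - \<alpha>))\<^sup>2 = (1 - (cmod \<alpha>)\<^sup>2) * (1 - (cmod z)\<^sup>2)"
    by (simp add: algebra_simps)
  moreover have "b * d = cmod (z - \<alpha>)"
    using \<open>d > 0\<close> by (simp add: b_def d_def blaschke_factor_def norm_divide)
  ultimately have eq: "(1 - b\<^sup>2) * d\<^sup>2 = (1 - (cmod \<alpha>)\<^sup>2) * (1 - (cmod z)\<^sup>2)"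
    by (simp add: left_diff_distrib power_mult_distrib[symmetric])
  have "(1 - b) * (1 - cmod z)\<^sup>2 \<le> (1 - b\<^sup>2) * d\<^sup>2"
  proof (rule mult_mono)
    show "1 - b \<le> 1 - b\<^sup>2"
      using b by (simp add: power2_eq_square mult_left_le)
    show "(1 - cmod z)\<^sup>2 \<le> d\<^sup>2"
      using \<open>d \<ge> 1 - cmod z\<close> z by (intro power_mono) auto
  qed (use b in \<open>auto simp: power_le_one\<close>)
  also have "\<dots> \<le> (1 - (cmod \<alpha>)\<^sup>2) * 1"
    unfolding eq using \<alpha> z by (intro mult_left_mono) (auto simp: power_le_one)
  also have "\<dots> = (1 - cmod \<alpha>) * (1 + cmod \<alpha>)"
    by (simp add: power2_eq_square algebra_simps)
  also have "\<dots> \<le> (1 - cmod \<alpha>) * 2"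
    using \<alpha> by (intro mult_left_mono) auto
  finally have "(1 - b) * (1 - cmod z)\<^sup>2 \<le> 2 * (1 - cmod \<alpha>)" by simp
  then show ?thesis
    unfolding b_def[symmetric] using z by (simp add: field_simps)
qed

text \<open>Write g as (1 - \<open>cnj \<alpha>\<close> z)^l u and replace that factor by (z -
  \<alpha>)^l; the norm stays the same by \<open>norm_lin_mult_power\<close>.\<close>

lemma exists_mult_blaschke_power:
  assumes "\<alpha> \<in> disc"
  shows "\<exists>f. norm f = norm g \<and> (\<forall>z\<in>disc. H1 f z = blaschke_factor \<alpha> z ^ l * H1 g z)"
proof -
  have "\<exists>u. (colin_mult \<alpha> ^^ l) u = g"
  proof (induction l arbitrary: g)
    case (Suc l)
    obtain v where "colin_mult \<alpha> v = g" using colin_mult_surj[OF assms] by blast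
    moreover obtain u where "(colin_mult \<alpha> ^^ l) u = v" using Suc by blast
    ultimately show ?case by auto
  qed simp
  then obtain u where u: "(colin_mult \<alpha> ^^ l) u = g" by blast
  have "H1 ((lin_mult \<alpha> ^^ l) u) z = blaschke_factor \<alpha> z ^ l * H1 g z" if "z \<in> disc" for z
    using that blaschke_denominator_nonzero[OF assms, of z]
    by (simp add: u[symmetric] H1_lin_mult_power H1_colin_mult_power blaschke_factor_def power_divide)
  moreover have "norm ((lin_mult \<alpha> ^^ l) u) = norm g"
    by (simp add: norm_lin_mult_power u)
  ultimately show ?thesis by blast
qed

lemma exists_div_blaschke_power:
  assumes "\<alpha> \<in> disc" "f \<noteq> 0" "l \<le> ord1 f \<alpha>"
  shows "\<exists>g. norm g = norm f \<and> (\<forall>z\<in>disc. H1 f z = blaschke_factor \<alpha> z ^ l * H1 g z)"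
proof -
  obtain u where u: "f = (lin_mult \<alpha> ^^ l) u"
    using lin_mult_power_factor[OF assms(2,1,3)] by blast
  have "H1 f z = blaschke_factor \<alpha> z ^ l * H1 ((colin_mult \<alpha> ^^ l) u) z" if "z \<in> disc" for z
    using that blaschke_denominator_nonzero[OF assms(1), of z]
    by (simp add: u H1_lin_mult_power H1_colin_mult_power blaschke_factor_def power_divide)
  moreover have "norm ((colin_mult \<alpha> ^^ l) u) = norm f"
    by (simp add: u norm_lin_mult_power)
  ultimately show ?thesis by blast
qed

section \<open>Finite Blaschke products as isometric multipliers\<close>

definition finite_blaschke ::
    "(complex \<Rightarrow> complex) \<Rightarrow> (complex \<Rightarrow> nat) \<Rightarrow> complex set \<Rightarrow> complex \<Rightarrow> complex" where
  "finite_blaschke c l F z = (\<Prod>\<alpha>\<in>F. c \<alpha> * blaschke_factor \<alpha> z ^ l \<alpha>)"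

lemma finite_blaschke_analytic:
  assumes "F \<subseteq> disc" "z \<in> disc"
  shows "finite_blaschke c l F analytic_on {z}"
proof -
  have "finite_blaschke c l F holomorphic_on disc"
    unfolding finite_blaschke_def
    by (intro holomorphic_intros blaschke_factor_holomorphic) (use assms in auto)
  then show ?thesis
    using assms(2) by (meson analytic_at open_ball)
qed

lemma finite_blaschke_nonzero:
  assumes "F \<subseteq> disc" "z \<in> disc" "\<And>\<alpha>. \<alpha> \<in> F \<Longrightarrow> cmod (c \<alpha>) = 1" "z \<notin> F"
  shows "finite_blaschke c l F z \<noteq> 0"
proof (cases "finite F")
  case True
  have "c \<alpha> * blaschke_factor \<alpha> z ^ l \<alpha> \<noteq> 0" if "\<alpha> \<in> F" for \<alpha>
  proof -
    have "blaschke_factor \<alpha> z \<noteq> 0"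
      using that assms blaschke_factor_zero_iff[of \<alpha> z] by blast
    moreover have "c \<alpha> \<noteq> 0"
      using assms(3)[OF that] by force
    ultimately show ?thesis by simp
  qed
  then show ?thesis
    using True by (simp add: finite_blaschke_def)
qed (simp add: finite_blaschke_def)

lemma cmod_finite_blaschke:
  assumes "\<And>\<alpha>. \<alpha> \<in> F \<Longrightarrow> cmod (c \<alpha>) = 1"
  shows "cmod (finite_blaschke c l F z) = (\<Prod>\<alpha>\<in>F. cmod (blaschke_factor \<alpha> z) ^ l \<alpha>)"
  using assms by (simp add: finite_blaschke_def prod_norm[symmetric] norm_mult norm_power)

lemma exists_mult_finite_blaschke:
  assumes "finite F" "F \<subseteq> disc" "\<And>\<alpha>. \<alpha> \<in> F \<Longrightarrow> cmod (c \<alpha>) = 1"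
  shows "\<exists>f. norm f = norm g \<and> (\<forall>z\<in>disc. H1 f z = finite_blaschke c l F z * H1 g z)"
  using assms
proof (induction F rule: finite_induct)
  case empty
  then show ?case by (auto simp: finite_blaschke_def)
next
  case (insert \<beta> F)
  then obtain f where f: "norm f = norm g" "\<And>z. z \<in> disc \<Longrightarrow> H1 f z = finite_blaschke c l F z * H1 g z"
    by auto
  obtain h where h: "norm h = norm (scaleC (c \<beta>) f)"
    "\<And>z. z \<in> disc \<Longrightarrow> H1 h z = blaschke_factor \<beta> z ^ l \<beta> * H1 (scaleC (c \<beta>) f) z"
    using exists_mult_blaschke_power[of \<beta> "scaleC (c \<beta>) f" "l \<beta>"] insert.prems by auto
  have "norm h = norm g"
    using h(1) f(1) insert.prems by simp
  moreover have "\<forall>z\<in>disc. H1 h z = finite_blaschke c l (insert \<beta> F) z * H1 g z"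
    using h(2) f(2) insert.hyps
    by (simp add: H1.hfun_scaleC fscale_def finite_blaschke_def algebra_simps)
  ultimately show ?case by blast
qed

lemma exists_div_finite_blaschke:
  assumes "finite F" "F \<subseteq> disc" "\<And>\<alpha>. \<alpha> \<in> F \<Longrightarrow> cmod (c \<alpha>) = 1" "f \<noteq> 0"
    "\<And>\<alpha>. \<alpha> \<in> F \<Longrightarrow> l \<alpha> \<le> ord1 f \<alpha>"
  shows "\<exists>g. norm g = norm f \<and> (\<forall>z\<in>disc. H1 f z = finite_blaschke c l F z * H1 g z)"
  using assms(1-3,5)
proof (induction F rule: finite_induct)
  case empty
  then show ?case by (auto simp: finite_blaschke_def)
next
  case (insert \<beta> F)
  then obtain g where g: "norm g = norm f" "\<And>z. z \<in> disc \<Longrightarrow> H1 f z = finite_blaschke c l F z * H1 g z"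
    by auto
  have \<beta>: "\<beta> \<in> disc" using insert.prems by blast
  \<comment> \<open>The factors divided out so far have their zeros away from \<beta>, so the order
    at \<beta> is still available.\<close>
  have "ord1 f \<beta> = ord1 g \<beta>"
    by (rule ord1_mult_unit[OF \<open>f \<noteq> 0\<close> \<beta> finite_blaschke_analytic[OF _ \<beta>] g(2)])
      (use insert finite_blaschke_nonzero[of F \<beta> c l] \<beta> in auto)
  moreover have "g \<noteq> 0"
    using g(1) \<open>f \<noteq> 0\<close> by auto
  moreover have "l \<beta> \<le> ord1 f \<beta>"
    using insert.prems by blast
  ultimately obtain h where h: "norm h = norm g"
    "\<And>z. z \<in> disc \<Longrightarrow> H1 g z = blaschke_factor \<beta> z ^ l \<beta> * H1 h z"
    using exists_div_blaschke_power[OF \<beta>, of g "l \<beta>"] by metis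
  have c: "cmod (c \<beta>) = 1" "c \<beta> \<noteq> 0"
    using insert.prems(2)[of \<beta>] by auto
  have "norm (scaleC (1 / c \<beta>) h) = norm f"
    using h(1) g(1) c by (simp add: norm_divide)
  moreover have "\<forall>z\<in>disc. H1 f z = finite_blaschke c l (insert \<beta> F) z * H1 (scaleC (1 / c \<beta>) h) z"
    using h(2) g(2) insert.hyps c(2)
    by (simp add: H1.hfun_scaleC fscale_def finite_blaschke_def algebra_simps)
  ultimately show ?case by blast
qed

section \<open>Infinite Blaschke products as limits of finite ones\<close>

context
  fixes \<phi> :: "complex \<Rightarrow> complex" and A l
  assumes fac: "blaschke_factorization \<phi> A l"
begin

lemma blaschke_zeros_subset: "A \<subseteq> disc"
  using fac by (simp add: blaschke_factorization_def)

lemma blaschke_mult_pos: "\<alpha> \<in> A \<Longrightarrow> 1 \<le> l \<alpha>"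
  using fac by (simp add: blaschke_factorization_def)

lemma blaschke_net:
  obtains c where "\<And>\<alpha>. \<alpha> \<in> A \<Longrightarrow> cmod (c \<alpha>) = 1"
    "\<And>z. z \<in> disc \<Longrightarrow> ((\<lambda>F. finite_blaschke c l F z) \<longlongrightarrow> \<phi> z) (finite_subsets_at_top A)"
  using fac unfolding blaschke_factorization_def finite_blaschke_def by blast

text \<open>Every term of the convergent sum is positive.\<close>

lemma countable_blaschke_zeros: "countable A"
proof -
  have "countable {\<alpha>\<in>A. real (l \<alpha>) * (1 - cmod \<alpha>) \<noteq> 0}"
    using fac unfolding blaschke_factorization_def by (intro summable_countable_real) blast
  moreover have "{\<alpha>\<in>A. real (l \<alpha>) * (1 - cmod \<alpha>) \<noteq> 0} = A"
    using blaschke_zeros_subset blaschke_mult_pos by fastforce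
  ultimately show ?thesis by simp
qed

text \<open>An enumeration of A extracts a cofinal sequence from the net of finite subsets; weak
  limits are available along sequences.\<close>

lemma blaschke_sequence:
  obtains c F where "\<And>\<alpha>. \<alpha> \<in> A \<Longrightarrow> cmod (c \<alpha>) = 1" "\<And>n::nat. finite (F n)" "\<And>n. F n \<subseteq> A"
    "\<And>z. z \<in> disc \<Longrightarrow> (\<lambda>n. finite_blaschke c l (F n) z) \<longlonglongrightarrow> \<phi> z"
proof -
  obtain c where c: "\<And>\<alpha>. \<alpha> \<in> A \<Longrightarrow> cmod (c \<alpha>) = 1"
    "\<And>z. z \<in> disc \<Longrightarrow> ((\<lambda>F. finite_blaschke c l F z) \<longlongrightarrow> \<phi> z) (finite_subsets_at_top A)"
    by (rule blaschke_net) blast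
  define F where "F n = {\<alpha>\<in>A. to_nat_on A \<alpha> < n}" for n
  have fin: "finite (F n)" for n
  proof (rule finite_imageD)
    show "finite (to_nat_on A ` F n)"
      by (rule finite_subset[of _ "{..<n}"]) (auto simp: F_def)
    show "inj_on (to_nat_on A) (F n)"
      using inj_on_to_nat_on[OF countable_blaschke_zeros] by (rule inj_on_subset) (auto simp: F_def)
  qed
  have "filterlim F (finite_subsets_at_top A) sequentially"
    unfolding filterlim_finite_subsets_at_top
  proof safe
    fix X assume X: "finite X" "X \<subseteq> A"
    have "X \<subseteq> F n" if "n > Max (insert 0 (to_nat_on A ` X))" for n
      using X that by (auto simp: F_def)
    then have "\<forall>\<^sub>F n in sequentially. X \<subseteq> F n"
      using eventually_gt_at_top by (rule eventually_mono[rotated])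
    then show "\<forall>\<^sub>F n in sequentially. finite (F n) \<and> X \<subseteq> F n \<and> F n \<subseteq> A"
      by eventually_elim (use fin in \<open>auto simp: F_def\<close>)
  qed
  then have "(\<lambda>n. finite_blaschke c l (F n) z) \<longlonglongrightarrow> \<phi> z" if "z \<in> disc" for z
    using filterlim_compose[OF c(2)[OF that]] by blast
  moreover have "F n \<subseteq> A" for n
    by (auto simp: F_def)
  ultimately show ?thesis
    using that[of c F] c(1) fin by blast
qed

text \<open>The partial products multiply g isometrically and converge pointwise, so a weak limit
  exists; the norm can drop in the limit, hence the inequality.\<close>

lemma exists_mult_blaschke:
  "\<exists>f. norm f \<le> norm g \<and> (\<forall>z\<in>disc. H1 f z = \<phi> z * H1 g z)"
proof -
  obtain c F where c: "\<And>\<alpha>. \<alpha> \<in> A \<Longrightarrow> cmod (c \<alpha>) = 1" and F: "\<And>n::nat. finite (F n)" "\<And>n. F n \<subseteq> A"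
    "\<And>z. z \<in> disc \<Longrightarrow> (\<lambda>n. finite_blaschke c l (F n) z) \<longlonglongrightarrow> \<phi> z"
    by (rule blaschke_sequence) blast
  have "\<exists>f. norm f = norm g \<and> (\<forall>z\<in>disc. H1 f z = finite_blaschke c l (F n) z * H1 g z)" for n
    by (rule exists_mult_finite_blaschke) (use F c blaschke_zeros_subset in blast)+
  then obtain f where f: "\<And>n. norm (f n) = norm g"
    "\<And>n z. z \<in> disc \<Longrightarrow> H1 (f n) z = finite_blaschke c l (F n) z * H1 g z"
    by metis
  show ?thesis
  proof (rule H1.hfun_weak_limit[of f])
    fix z assume z: "z \<in> disc"
    show "(\<lambda>n. H1 (f n) z) \<longlonglongrightarrow> \<phi> z * H1 g z"
      unfolding f(2)[OF z] by (intro tendsto_intros F(3) z)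
  qed (simp add: f(1))
qed

text \<open>All other factors have modulus at most 1, and the bound survives the limit. It stands in
  for an explicit factorisation of the infinite product.\<close>

lemma cmod_blaschke_le:
  assumes \<alpha>: "\<alpha> \<in> A" and z: "z \<in> disc"
  shows "cmod (\<phi> z) \<le> cmod (blaschke_factor \<alpha> z) ^ l \<alpha>"
proof -
  obtain c where c: "\<And>\<alpha>. \<alpha> \<in> A \<Longrightarrow> cmod (c \<alpha>) = 1"
    "\<And>z. z \<in> disc \<Longrightarrow> ((\<lambda>F. finite_blaschke c l F z) \<longlongrightarrow> \<phi> z) (finite_subsets_at_top A)"
    by (rule blaschke_net) blast
  have "cmod (finite_blaschke c l F z) \<le> cmod (blaschke_factor \<alpha> z) ^ l \<alpha>"
    if F: "finite F" "{\<alpha>} \<subseteq> F" "F \<subseteq> A" for F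
  proof -
    have "cmod (finite_blaschke c l F z) = (\<Prod>\<alpha>\<in>F. cmod (blaschke_factor \<alpha> z) ^ l \<alpha>)"
      using F c by (intro cmod_finite_blaschke) auto
    also have "\<dots> = cmod (blaschke_factor \<alpha> z) ^ l \<alpha> * (\<Prod>\<alpha>\<in>F - {\<alpha>}. cmod (blaschke_factor \<alpha> z) ^ l \<alpha>)"
      using F by (intro prod.remove) auto
    also have "(\<Prod>\<alpha>\<in>F - {\<alpha>}. cmod (blaschke_factor \<alpha> z) ^ l \<alpha>) \<le> 1"
      using F blaschke_zeros_subset z
      by (intro prod_le_1) (auto intro!: power_le_one cmod_blaschke_factor_le)
    then have "cmod (blaschke_factor \<alpha> z) ^ l \<alpha> * (\<Prod>\<alpha>\<in>F - {\<alpha>}. cmod (blaschke_factor \<alpha> z) ^ l \<alpha>)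
        \<le> cmod (blaschke_factor \<alpha> z) ^ l \<alpha> * 1"
      by (intro mult_left_mono) auto
    finally show ?thesis by simp
  qed
  then have "\<forall>\<^sub>F F in finite_subsets_at_top A. cmod (finite_blaschke c l F z) \<le> cmod (blaschke_factor \<alpha> z) ^ l \<alpha>"
    unfolding eventually_finite_subsets_at_top using \<alpha> by (intro exI[of _ "{\<alpha>}"]) auto
  then show ?thesis
    by (rule tendsto_upperbound[OF tendsto_norm[OF c(2)[OF z]]]) (rule finite_subsets_at_top_neq_bot)
qed

lemma blaschke_zero: "\<alpha> \<in> A \<Longrightarrow> \<phi> \<alpha> = 0"
  using cmod_blaschke_le[of \<alpha> \<alpha>] blaschke_zeros_subset blaschke_mult_pos[of \<alpha>]
  by (auto simp: blaschke_factor_def power_0_left split: if_splits)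

text \<open>Outside a finite set F0 the sum of l (1 - |b|) is at most 1/2, so by the Weierstrass
  inequality the remaining factors contribute at least 1/2 in modulus. The product over F0 is
  nonzero, which bounds the limit away from 0.\<close>

lemma blaschke_nonzero:
  assumes z: "z \<in> disc" "z \<notin> A"
  shows "\<phi> z \<noteq> 0"
proof -
  obtain c where c: "\<And>\<alpha>. \<alpha> \<in> A \<Longrightarrow> cmod (c \<alpha>) = 1"
    "\<And>z. z \<in> disc \<Longrightarrow> ((\<lambda>F. finite_blaschke c l F z) \<longlongrightarrow> \<phi> z) (finite_subsets_at_top A)"
    by (rule blaschke_net) blast
  define C where "C = 2 / (1 - cmod z)\<^sup>2"
  define s where "s \<alpha> = real (l \<alpha>) * (1 - cmod (blaschke_factor \<alpha> z))" for \<alpha>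
  have s_nonneg: "0 \<le> s \<alpha>" if "\<alpha> \<in> A" for \<alpha>
    using that blaschke_zeros_subset z cmod_blaschke_factor_le[of \<alpha> z] by (auto simp: s_def)
  have "(\<lambda>\<alpha>. C * (real (l \<alpha>) * (1 - cmod \<alpha>))) summable_on A"
    using fac unfolding blaschke_factorization_def by (intro summable_on_cmult_right) blast
  then have "s summable_on A"
  proof (rule summable_on_comparison_test)
    fix \<alpha> assume "\<alpha> \<in> A"
    then have "1 - cmod (blaschke_factor \<alpha> z) \<le> C * (1 - cmod \<alpha>)"
      unfolding C_def using blaschke_zeros_subset z by (intro one_minus_cmod_blaschke_factor_le) auto
    then have "real (l \<alpha>) * (1 - cmod (blaschke_factor \<alpha> z)) \<le> real (l \<alpha>) * (C * (1 - cmod \<alpha>))"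
      by (intro mult_left_mono) auto
    then show "s \<alpha> \<le> C * (real (l \<alpha>) * (1 - cmod \<alpha>))"
      by (simp add: s_def algebra_simps)
  qed (rule s_nonneg)
  then have "(sum s \<longlongrightarrow> infsum s A) (finite_subsets_at_top A)"
    by (rule infsum_tendsto)
  \<comment> \<open>Two partial sums within 1/4 of the total differ by at most 1/2.\<close>
  then have "\<forall>\<^sub>F F in finite_subsets_at_top A. dist (sum s F) (infsum s A) < 1 / 4"
    by (rule tendstoD) simp
  then obtain F0 where F0: "finite F0" "F0 \<subseteq> A"
    "\<And>F. finite F \<Longrightarrow> F0 \<subseteq> F \<Longrightarrow> F \<subseteq> A \<Longrightarrow> dist (sum s F) (infsum s A) < 1 / 4"
    unfolding eventually_finite_subsets_at_top by meson
  define m where "m = cmod (finite_blaschke c l F0 z)"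
  have "m > 0"
    unfolding m_def using finite_blaschke_nonzero[of F0 z c l] F0 blaschke_zeros_subset z c by auto
  have "m / 2 \<le> cmod (finite_blaschke c l F z)" if F: "finite F" "F0 \<subseteq> F" "F \<subseteq> A" for F
  proof -
    have "sum s (F - F0) = sum s F - sum s F0"
      using F by (simp add: sum_diff)
    also have "\<dots> \<le> 1 / 2"
      using F0(3)[OF F] F0(3)[OF F0(1) order_refl F0(2)] unfolding dist_real_def by linarith
    finally have small: "sum s (F - F0) \<le> 1 / 2" .
    have "1 / 2 \<le> 1 - sum (\<lambda>\<alpha>. 1 - cmod (blaschke_factor \<alpha> z) ^ l \<alpha>) (F - F0)"
    proof -
      \<comment> \<open>Bernoulli's inequality in the form 1 - x^l \<le> l (1 - x).\<close>
      have "1 - cmod (blaschke_factor \<alpha> z) ^ l \<alpha> \<le> s \<alpha>" for \<alpha>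
        using Bernoulli_inequality[of "cmod (blaschke_factor \<alpha> z) - 1" "l \<alpha>"]
        by (simp add: s_def algebra_simps)
      then have "sum (\<lambda>\<alpha>. 1 - cmod (blaschke_factor \<alpha> z) ^ l \<alpha>) (F - F0) \<le> sum s (F - F0)"
        by (intro sum_mono)
      with small show ?thesis by linarith
    qed
    also have "\<dots> \<le> (\<Prod>\<alpha>\<in>F - F0. 1 - (1 - cmod (blaschke_factor \<alpha> z) ^ l \<alpha>))"
      using F blaschke_zeros_subset z
      by (intro Weierstrass_prod_ineq) (auto intro!: power_le_one cmod_blaschke_factor_le)
    finally have "1 / 2 \<le> (\<Prod>\<alpha>\<in>F - F0. cmod (blaschke_factor \<alpha> z) ^ l \<alpha>)" by simp
    then have "m * (1 / 2) \<le> m * (\<Prod>\<alpha>\<in>F - F0. cmod (blaschke_factor \<alpha> z) ^ l \<alpha>)"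
      using \<open>m > 0\<close> by (intro mult_left_mono) auto
    also have "\<dots> = (\<Prod>\<alpha>\<in>F. cmod (blaschke_factor \<alpha> z) ^ l \<alpha>)"
    proof -
      have "m = (\<Prod>\<alpha>\<in>F0. cmod (blaschke_factor \<alpha> z) ^ l \<alpha>)"
        unfolding m_def using c F0 by (intro cmod_finite_blaschke) auto
      then show ?thesis
        using prod.subset_diff[OF F(2,1), of "\<lambda>\<alpha>. cmod (blaschke_factor \<alpha> z) ^ l \<alpha>"]
        by (simp only: mult.commute)
    qed
    also have "\<dots> = cmod (finite_blaschke c l F z)"
      using c F by (intro cmod_finite_blaschke[symmetric]) auto
    finally show ?thesis by simp
  qed
  then have "\<forall>\<^sub>F F in finite_subsets_at_top A. m / 2 \<le> cmod (finite_blaschke c l F z)"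
    unfolding eventually_finite_subsets_at_top using F0(1,2) by blast
  then have "m / 2 \<le> cmod (\<phi> z)"
    by (rule tendsto_lowerbound[OF tendsto_norm[OF c(2)[OF z(1)]]]) (rule finite_subsets_at_top_neq_bot)
  then show ?thesis using \<open>m > 0\<close> by auto
qed

lemma blaschke_zero_iff: "z \<in> disc \<Longrightarrow> \<phi> z = 0 \<longleftrightarrow> z \<in> A"
  using blaschke_zero blaschke_nonzero by blast

text \<open>Multiply the constant 1 by \<phi>. The result is not 0 because the zeros are countable
  and the disc is not.\<close>

lemma blaschke_hardy:
  obtains p where "p \<noteq> 0" "\<And>z. z \<in> disc \<Longrightarrow> H1 p z = \<phi> z"
proof -
  obtain p where "\<forall>z\<in>disc. H1 p z = \<phi> z * H1 (unit_vec 0) z"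
    using exists_mult_blaschke[of "unit_vec 0"] by blast
  then have p: "H1 p z = \<phi> z" if "z \<in> disc" for z
    using that by (simp add: H1_unit_vec_0)
  have "\<not> disc \<subseteq> A"
    using countable_blaschke_zeros countable_subset uncountable_ball[of 1 "0::complex"] by force
  then obtain z where "z \<in> disc" "z \<notin> A" by blast
  then have "H1 p z \<noteq> 0"
    using p blaschke_nonzero by simp
  then have "p \<noteq> 0"
    using H1.hfun_zero by auto
  with p that show ?thesis by blast
qed

text \<open>If the order n were smaller, the cofactor of (z - \<alpha>)^n would be bounded near
  \<alpha> by a multiple of |z - \<alpha>|^(l \<alpha> - n) through \<open>cmod_blaschke_le\<close>,
  and so vanish at \<alpha>.\<close>

lemma blaschke_mult_le_ord1:
  assumes p: "p \<noteq> 0" "\<And>z. z \<in> disc \<Longrightarrow> H1 p z = \<phi> z" and \<alpha>: "\<alpha> \<in> A"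
  shows "l \<alpha> \<le> ord1 p \<alpha>"
proof (rule ccontr)
  assume less: "\<not> l \<alpha> \<le> ord1 p \<alpha>"
  define n where "n = ord1 p \<alpha>"
  have \<alpha>': "\<alpha> \<in> disc" using \<alpha> blaschke_zeros_subset by blast
  obtain u where u: "p = (lin_mult \<alpha> ^^ n) u" "H1 u \<alpha> \<noteq> 0"
    unfolding n_def using ord1_factor[OF p(1) \<alpha>'] by blast
  have bound: "cmod (H1 u z) \<le> cmod (z - \<alpha>) ^ (l \<alpha> - n) / cmod (1 - cnj \<alpha> * z) ^ l \<alpha>"
    if z: "z \<in> disc" "z \<noteq> \<alpha>" for z
  proof -
    have "(z - \<alpha>) ^ n * H1 u z = \<phi> z"
      using p(2)[OF z(1)] z(1) by (simp add: u(1) H1_lin_mult_power)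
    then have "cmod (z - \<alpha>) ^ n * cmod (H1 u z) = cmod (\<phi> z)"
      by (metis norm_mult norm_power)
    also have "\<dots> \<le> cmod (blaschke_factor \<alpha> z) ^ l \<alpha>"
      by (rule cmod_blaschke_le) fact+
    also have "\<dots> = cmod (z - \<alpha>) ^ (n + (l \<alpha> - n)) / cmod (1 - cnj \<alpha> * z) ^ l \<alpha>"
      using less by (simp add: blaschke_factor_def norm_divide power_divide n_def)
    also have "\<dots> = cmod (z - \<alpha>) ^ n * (cmod (z - \<alpha>) ^ (l \<alpha> - n) / cmod (1 - cnj \<alpha> * z) ^ l \<alpha>)"
      by (simp add: power_add)
    finally show ?thesis
      by (rule mult_left_le_imp_le) (use z(2) in simp)
  qed
  have "\<forall>\<^sub>F z in at \<alpha>. z \<in> disc - {\<alpha>}"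
    using eventually_at_in_open[OF open_ball \<alpha>'] .
  then have ev: "\<forall>\<^sub>F z in at \<alpha>. cmod (H1 u z) \<le> cmod (z - \<alpha>) ^ (l \<alpha> - n) / cmod (1 - cnj \<alpha> * z) ^ l \<alpha>"
    by eventually_elim (use bound in blast)
  have "1 - cnj \<alpha> * \<alpha> \<noteq> 0"
    using blaschke_denominator_nonzero[OF \<alpha>'] \<alpha>' by simp
  then have "((\<lambda>z. cmod (z - \<alpha>) ^ (l \<alpha> - n) / cmod (1 - cnj \<alpha> * z) ^ l \<alpha>) \<longlongrightarrow>
      cmod (\<alpha> - \<alpha>) ^ (l \<alpha> - n) / cmod (1 - cnj \<alpha> * \<alpha>) ^ l \<alpha>) (at \<alpha>)"
    by (intro tendsto_intros) auto
  then have lim: "((\<lambda>z. cmod (z - \<alpha>) ^ (l \<alpha> - n) / cmod (1 - cnj \<alpha> * z) ^ l \<alpha>) \<longlongrightarrow> 0) (at \<alpha>)"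
    using less by (simp add: n_def power_0_left)
  have "(H1 u \<longlongrightarrow> H1 u \<alpha>) (at \<alpha>)"
    using H1_analytic[OF \<alpha>', of u] by (simp add: analytic_at_imp_isCont flip: isCont_def)
  then have "((\<lambda>z. cmod (H1 u z)) \<longlongrightarrow> cmod (H1 u \<alpha>)) (at \<alpha>)"
    by (rule tendsto_norm)
  from tendsto_le[OF at_neq_bot lim this ev] u(2) show False by simp
qed

end

section \<open>The model space of a Blaschke product as a closed span of jets\<close>

definition jets_below :: "nat ell2 \<Rightarrow> nat ell2 set" where
  "jets_below p = {jet \<alpha> j | \<alpha> j. \<alpha> \<in> disc \<and> j < ord1 p \<alpha>}"

text \<open>A vector orthogonal to these kernels vanishes wherever p does not, but two nonzero
  functions have a common point near 0 where neither vanishes. Division by partial products is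
  compared with \<phi> only off its zeros.\<close>

lemma ker1_total_off_zeros:
  assumes "p \<noteq> 0"
  shows "clspan (ker1 ` {z\<in>disc. H1 p z \<noteq> 0}) = UNIV"
proof (rule clspan_eq_if_total[OF closed_cspace_UNIV])
  fix y assume y: "\<And>b. b \<in> ker1 ` {z\<in>disc. H1 p z \<noteq> 0} \<Longrightarrow> cinner y b = 0"
  show "y = 0"
  proof (rule ccontr)
    assume "y \<noteq> 0"
    have 0: "(0::complex) \<in> disc" by simp
    have "\<forall>\<^sub>F w in at (0::complex). H1 p w \<noteq> 0 \<and> H1 y w \<noteq> 0 \<and> w \<in> disc"
      using H1_eventually_nonzero[OF assms 0] H1_eventually_nonzero[OF \<open>y \<noteq> 0\<close> 0]
      by eventually_elim auto
    from eventually_happens'[OF at_neq_bot this]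
    obtain w where w: "H1 p w \<noteq> 0" "H1 y w \<noteq> 0" "w \<in> disc"
      by blast
    then have "cinner y (ker1 w) = 0" by (intro y) blast
    with w show False by (simp add: H1.hfun_cinner)
  qed
qed simp

text \<open>Multiples of \<phi> vanish to the orders of \<phi>, so the jets lie in the model space.
  Conversely, an x in it orthogonal to the jets vanishes to these orders, so each partial product
  B_n divides it with a quotient g_n of the same norm. Then \<phi> g_n = (\<phi> / B_n) x tends
  weakly to x while being orthogonal to x, so x = 0.\<close>

lemma model_space_blaschke:
  assumes fac: "blaschke_factorization \<phi> A l"
    and p: "p \<noteq> 0" "\<And>z. z \<in> disc \<Longrightarrow> H1 p z = \<phi> z"
  shows "model_space \<phi> = H1 ` clspan (jets_below p)"
proof -
  define Y where "Y = {f. \<exists>g. \<forall>z\<in>disc. H1 f z = \<phi> z * H1 g z}"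
  define U where "U = {x. \<forall>y\<in>Y. cinner x y = 0}"
  have mult: "\<exists>f\<in>Y. (\<lambda>z. \<phi> z * H1 g z) = H1 f \<and> norm f \<le> norm g" for g
  proof -
    obtain f where f: "norm f \<le> norm g" "\<forall>z\<in>disc. H1 f z = \<phi> z * H1 g z"
      using exists_mult_blaschke[OF fac] by blast
    then have "(\<lambda>z. \<phi> z * H1 g z) = H1 f"
      by (metis (no_types, lifting) H1.hfun_outside ext mult_zero_right)
    with f show ?thesis by (auto simp: Y_def)
  qed
  have "H1 x \<in> model_space \<phi> \<longleftrightarrow> x \<in> U" for x
  proof -
    have "H1 x \<in> model_space \<phi> \<longleftrightarrow> (\<forall>g. inner_disc (H1 x) (\<lambda>z. \<phi> z * H1 g z) = 0)"
      by (auto simp: model_space_def H2_disc_def H1.hardy_eq_range)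
    also have "\<dots> \<longleftrightarrow> (\<forall>f\<in>Y. cinner x f = 0)"
    proof safe
      fix f assume *: "\<forall>g. inner_disc (H1 x) (\<lambda>z. \<phi> z * H1 g z) = 0" "f \<in> Y"
      then obtain g where g: "\<forall>z\<in>disc. H1 f z = \<phi> z * H1 g z" by (auto simp: Y_def)
      then have "(\<lambda>z. \<phi> z * H1 g z) = H1 f"
        by (metis (no_types, lifting) H1.hfun_outside ext mult_zero_right)
      then show "cinner x f = 0"
        using *(1) by (metis H1.hardy_inner_hfun inner_disc_def)
    next
      fix g assume *: "\<forall>f\<in>Y. cinner x f = 0"
      obtain f where "f \<in> Y" "(\<lambda>z. \<phi> z * H1 g z) = H1 f" using mult by blast
      with * show "inner_disc (H1 x) (\<lambda>z. \<phi> z * H1 g z) = 0"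
        by (simp add: inner_disc_def H1.hardy_inner_hfun)
    qed
    finally show ?thesis by (simp add: U_def)
  qed
  moreover have "model_space \<phi> \<subseteq> range H1"
    by (auto simp: model_space_def H2_disc_def H1.hardy_eq_range)
  ultimately have model: "model_space \<phi> = H1 ` U" by blast
  have "clspan (jets_below p) = U"
  proof (rule clspan_eq_if_total)
    show "closed_cspace U"
      unfolding U_def by (rule closed_cspace_orthogonal)
    show "jets_below p \<subseteq> U"
    proof (clarsimp simp: jets_below_def U_def Y_def simp del: mem_ball_0 mem_ball)
      fix \<alpha> j f g
      assume \<alpha>: "\<alpha> \<in> disc" "j < ord1 p \<alpha>" and f: "\<forall>z\<in>disc. H1 f z = \<phi> z * H1 g z"
      have "cinner f (jet \<alpha> j) = 0"
      proof (cases "f = 0")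
        case False
        have "H1 f z = H1 g z * H1 p z" if "z \<in> disc" for z
          using f p(2)[OF that] that by (simp add: mult.commute)
        then have "ord1 p \<alpha> \<le> ord1 f \<alpha>"
          by (rule ord1_mult_ge[OF False \<alpha>(1) H1_analytic[OF \<alpha>(1)]])
        then show ?thesis
          using \<alpha> False by (intro cinner_jet_below_ord1) auto
      qed simp
      then show "cinner (jet \<alpha> j) f = 0"
        by (subst cinner_commute) simp
    qed
  next
    fix x assume x: "x \<in> U" "\<And>b. b \<in> jets_below p \<Longrightarrow> cinner x b = 0"
    show "x = 0"
    proof (rule ccontr)
      assume "x \<noteq> 0"
      obtain c F where c: "\<And>\<alpha>. \<alpha> \<in> A \<Longrightarrow> cmod (c \<alpha>) = 1"
        and F: "\<And>n::nat. finite (F n)" "\<And>n. F n \<subseteq> A"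
        "\<And>z. z \<in> disc \<Longrightarrow> (\<lambda>n. finite_blaschke c l (F n) z) \<longlonglongrightarrow> \<phi> z"
        by (rule blaschke_sequence[OF fac]) blast
      note A = blaschke_zeros_subset[OF fac]
      have ord: "l \<alpha> \<le> ord1 x \<alpha>" if "\<alpha> \<in> A" for \<alpha>
      proof -
        have "\<alpha> \<in> disc" using that A by blast
        then have "ord1 p \<alpha> \<le> ord1 x \<alpha>"
          using \<open>x \<noteq> 0\<close> x(2) by (intro ord1_ge_if_orthogonal) (auto simp: jets_below_def)
        then show ?thesis
          using blaschke_mult_le_ord1[OF fac p that] by linarith
      qed
      have "\<exists>g. norm g = norm x \<and> (\<forall>z\<in>disc. H1 x z = finite_blaschke c l (F n) z * H1 g z)" for n
        by (rule exists_div_finite_blaschke) (use F c A ord \<open>x \<noteq> 0\<close> in blast)+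
      then obtain g where g: "\<And>n. norm (g n) = norm x"
        "\<And>n z. z \<in> disc \<Longrightarrow> H1 x z = finite_blaschke c l (F n) z * H1 (g n) z"
        by metis
      have "\<forall>n. \<exists>f\<in>Y. (\<lambda>z. \<phi> z * H1 (g n) z) = H1 f \<and> norm f \<le> norm (g n)"
        using mult by blast
      from bchoice[of UNIV, simplified, OF this[unfolded Bex_def]]
      obtain f where f: "\<And>n. f n \<in> Y" "\<And>n. (\<lambda>z. \<phi> z * H1 (g n) z) = H1 (f n)"
        "\<And>n. norm (f n) \<le> norm (g n)"
        by blast
      have "(\<lambda>n. cinner (f n - x) x) \<longlonglongrightarrow> 0"
      proof (rule weak_null_if_total[OF _ ker1_total_off_zeros[OF p(1)]])
        show "norm (f n - x) \<le> norm x + norm x" for n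
          using f(3)[of n] g(1)[of n] norm_triangle_ineq4[of "f n" x] by linarith
        fix t assume "t \<in> ker1 ` {z\<in>disc. H1 p z \<noteq> 0}"
        then obtain z where z: "z \<in> disc" "\<phi> z \<noteq> 0" "t = ker1 z" using p(2) by auto
        have "(\<lambda>n. \<phi> z / finite_blaschke c l (F n) z * H1 x z - H1 x z) \<longlonglongrightarrow> \<phi> z / \<phi> z * H1 x z - H1 x z"
          by (intro tendsto_intros F z)
        moreover have "\<phi> z / finite_blaschke c l (F n) z * H1 x z - H1 x z = cinner (f n - x) t" for n
        proof -
          have "z \<notin> F n" using F(2)[of n] blaschke_zero[OF fac, of z] z(2) by blast
          then have "finite_blaschke c l (F n) z \<noteq> 0"
            using F(2)[of n] A z(1) c by (intro finite_blaschke_nonzero) auto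
          then have "\<phi> z / finite_blaschke c l (F n) z * H1 x z = \<phi> z * H1 (g n) z"
            using g(2)[OF z(1), of n] by simp
          also have "\<dots> = H1 (f n) z"
            using f(2)[of n] by (rule fun_cong)
          finally show ?thesis
            using z(1) by (simp add: z(3) H1.hfun_cinner cinner_diff_left)
        qed
        ultimately show "(\<lambda>n. cinner (f n - x) t) \<longlonglongrightarrow> 0"
          using z(2) by simp
      qed
      moreover have "cinner (f n - x) x = - cinner x x" for n
      proof -
        have "cinner x (f n) = 0"
          using x(1) f(1)[of n] by (auto simp: U_def)
        then have "cinner (f n) x = 0"
          by (subst cinner_commute) simp
        then show ?thesis by (simp add: cinner_diff_left)
      qed
      ultimately have "cinner x x = 0"
        by (simp add: LIMSEQ_const_iff)
      with \<open>x \<noteq> 0\<close> show False by (simp add: cinner_norm)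
    qed
  qed
  with model show ?thesis by simp
qed

section \<open>Tensor products and the Hardy space of the polydisc\<close>

definition tens :: "('n::finite \<Rightarrow> nat ell2) \<Rightarrow> ('n \<Rightarrow> nat) ell2" where
  "tens x = Abs_ell2 (\<lambda>k. \<Prod>i\<in>UNIV. coef (x i) (k i))"

lemma infsum_prod_finite:
  fixes f :: "'n::finite \<Rightarrow> 'm \<Rightarrow> 'c :: {banach, real_normed_div_algebra, comm_semiring_1}"
  assumes "\<And>i. (\<lambda>m. norm (f i m)) summable_on UNIV"
  shows "(\<Sum>\<^sub>\<infinity>k. \<Prod>i\<in>UNIV. f i (k i)) = (\<Prod>i\<in>UNIV. \<Sum>\<^sub>\<infinity>m. f i m)"
  using infsum_prod_PiE_abs[of UNIV f "\<lambda>_. UNIV"] assms by (simp add: PiE_UNIV_domain)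

lemma coef_tens: "coef (tens x) k = (\<Prod>i\<in>UNIV. coef (x i) (k i))"
proof -
  have "sq_summable (\<lambda>k. \<Prod>i\<in>UNIV. coef (x i) (k i))"
  proof (cases "\<exists>i. x i = 0")
    case True
    then obtain i where "x i = 0" ..
    then have "(\<lambda>k. \<Prod>i\<in>UNIV. coef (x i) (k i)) = (\<lambda>k. 0)"
      by (intro ext prod_zero bexI[of _ i]) auto
    then show ?thesis by (simp add: sq_summable_zero)
  next
    case False
    have eq: "(cmod (\<Prod>i\<in>UNIV. coef (x i) (k i)))\<^sup>2 = (\<Prod>i\<in>UNIV. (cmod (coef (x i) (k i)))\<^sup>2)" for k
      by (simp add: prod_norm[symmetric] prod_power_distrib)
    have "(\<Sum>\<^sub>\<infinity>k. \<Prod>i\<in>UNIV. (cmod (coef (x i) (k i)))\<^sup>2) = (\<Prod>i\<in>UNIV. \<Sum>\<^sub>\<infinity>m. (cmod (coef (x i) m))\<^sup>2)"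
      by (rule infsum_prod_finite) (simp add: norm_sq_summable)
    also have "\<dots> = (\<Prod>i\<in>UNIV. (norm (x i))\<^sup>2)"
      by (intro prod.cong refl infsumI norm_sq_ell2)
    \<comment> \<open>\<open>infsum\<close> is 0 on families that are not summable, so a nonzero
      value proves summability. This is why a zero factor is treated apart.\<close>
    also have "\<dots> \<noteq> 0"
      using False by simp
    finally show ?thesis
      unfolding sq_summable_def eq using infsum_not_exists by blast
  qed
  then show ?thesis by (simp add: tens_def)
qed

lemma cinner_tens: "cinner (tens x) (tens y) = (\<Prod>i\<in>UNIV. cinner (x i) (y i))"
proof -
  have "cinner (tens x) (tens y) = (\<Sum>\<^sub>\<infinity>k. \<Prod>i\<in>UNIV. coef (x i) (k i) * cnj (coef (y i) (k i)))"
    by (simp add: cinner_def coef_tens prod.distrib)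
  also have "\<dots> = (\<Prod>i\<in>UNIV. \<Sum>\<^sub>\<infinity>m. coef (x i) m * cnj (coef (y i) m))"
  proof (rule infsum_prod_finite)
    fix i
    have "sq_summable (\<lambda>m. cnj (coef (y i) m))"
      by (rule sq_summable_comparison[of "coef (y i)"]) auto
    then show "(\<lambda>m. cmod (coef (x i) m * cnj (coef (y i) m))) summable_on UNIV"
      by (intro sq_summable_mult) auto
  qed
  finally show ?thesis by (simp add: cinner_def)
qed

lemma norm_tens: "norm (tens x) = (\<Prod>i\<in>UNIV. norm (x i))"
proof -
  have "(of_real ((norm (tens x))\<^sup>2) :: complex) = of_real ((\<Prod>i\<in>UNIV. norm (x i))\<^sup>2)"
    unfolding cinner_norm[symmetric] cinner_tens by (simp add: cinner_norm prod_power_distrib)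
  then have "(norm (tens x))\<^sup>2 = (\<Prod>i\<in>UNIV. norm (x i))\<^sup>2"
    by (simp only: of_real_eq_iff)
  then show ?thesis
    by (rule power2_eq_imp_eq) (auto intro: prod_nonneg)
qed

lemma coef_tens_upd: "coef (tens (x(j := y))) k = coef y (k j) * (\<Prod>i\<in>UNIV - {j}. coef (x i) (k i))"
proof -
  have "coef (tens (x(j := y))) k = coef y (k j) * (\<Prod>i\<in>UNIV - {j}. coef ((x(j := y)) i) (k i))"
    unfolding coef_tens by (subst prod.remove[of UNIV j]) auto
  also have "(\<Prod>i\<in>UNIV - {j}. coef ((x(j := y)) i) (k i)) = (\<Prod>i\<in>UNIV - {j}. coef (x i) (k i))"
    by (rule prod.cong) auto
  finally show ?thesis .
qed

lemma bounded_clinear_tens_upd: "bounded_clinear (\<lambda>y. tens (x(j := y)))"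
proof (rule bounded_clinearI)
  fix y
  have "norm (tens (x(j := y))) = norm y * (\<Prod>i\<in>UNIV - {j}. norm ((x(j := y)) i))"
    unfolding norm_tens by (subst prod.remove[of UNIV j]) auto
  also have "(\<Prod>i\<in>UNIV - {j}. norm ((x(j := y)) i)) = (\<Prod>i\<in>UNIV - {j}. norm (x i))"
    by (rule prod.cong) auto
  finally show "norm (tens (x(j := y))) \<le> norm y * (\<Prod>i\<in>UNIV - {j}. norm (x i))"
    by (rule eq_refl)
qed (auto intro!: ell2_eqI simp: coef_tens_upd algebra_simps)

text \<open>The tensor is bounded linear in each slot, so the slots pass from B to its closed span
  one at a time; I collects those already passed.\<close>

lemma tens_mem_clspan:
  assumes "\<And>i. x i \<in> clspan (B i)"
  shows "tens x \<in> clspan {tens b | b. \<forall>i. b i \<in> B i}"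
proof -
  define W where "W = clspan {tens b | b. \<forall>i. b i \<in> B i}"
  have "tens x \<in> W" if "finite I" "\<forall>i\<in>I. x i \<in> clspan (B i)" "\<forall>i\<in>-I. x i \<in> B i" for I x
    using that
  proof (induction I arbitrary: x rule: finite_induct)
    case empty
    then show ?case unfolding W_def by (intro clspan_base) auto
  next
    case (insert j I)
    have "(\<lambda>y. tens (x(j := y))) ` clspan (B j) \<subseteq> W"
    proof (rule clspan_image_subset[OF bounded_clinear_tens_upd])
      show "closed_cspace W"
        unfolding W_def by (rule closed_cspace_clspan)
      show "(\<lambda>y. tens (x(j := y))) ` B j \<subseteq> W"
      proof safe
        fix b assume "b \<in> B j"
        with insert show "tens (x(j := b)) \<in> W"
          by (intro insert.IH) auto
      qed
    qed
    moreover have "x j \<in> clspan (B j)"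
      using insert.prems by blast
    ultimately have "tens (x(j := x j)) \<in> W" by blast
    then show ?case by simp
  qed
  from this[of UNIV x] assms show ?thesis
    unfolding W_def by simp
qed

lemma clspan_tens_clspan:
  "clspan {tens x | x. \<forall>i. x i \<in> clspan (B i)} = clspan {tens b | b. \<forall>i. b i \<in> B i}"
proof (rule clspan_eqI)
  show "{tens x | x. \<forall>i. x i \<in> clspan (B i)} \<subseteq> clspan {tens b | b. \<forall>i. b i \<in> B i}"
    using tens_mem_clspan by blast
  have "{tens b | b. \<forall>i. b i \<in> B i} \<subseteq> {tens x | x. \<forall>i. x i \<in> clspan (B i)}"
    using clspan_base by blast
  then show "{tens b | b. \<forall>i. b i \<in> B i} \<subseteq> clspan {tens x | x. \<forall>i. x i \<in> clspan (B i)}"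
    using clspan_superset by blast
qed

section \<open>Functions on the polydisc and their coefficients\<close>

abbreviation HN :: "('n::finite \<Rightarrow> nat) ell2 \<Rightarrow> complex ^ 'n \<Rightarrow> complex" where
  "HN \<equiv> hfun monomial polydisc"

lemma coef_tens_ker1:
  assumes "z \<in> polydisc"
  shows "coef (tens (\<lambda>i. ker1 (z $ i))) k = cnj (monomial k z)"
  using assms by (simp add: coef_tens monomial_def polydisc_def coef_ker1)

lemma kern_monomial: "z \<in> polydisc \<Longrightarrow> kern monomial z = tens (\<lambda>i. ker1 (z $ i))"
  unfolding kern_def[of monomial] coef_tens_ker1[symmetric] coef_inverse ..

interpretation HN: hardy_family "monomial :: ('n::finite \<Rightarrow> nat) \<Rightarrow> complex ^ 'n \<Rightarrow> complex" polydisc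
proof
  fix z :: "complex ^ 'n"
  assume z: "z \<in> polydisc"
  have "sq_summable (\<lambda>k. cnj (monomial k z))"
    unfolding coef_tens_ker1[OF z, symmetric] by simp
  then show "sq_summable (\<lambda>k. monomial k z)"
    by (rule sq_summable_comparison) simp
next
  \<comment> \<open>Both sides are elementary tensors: unit vectors of unit vectors, polydisc
    kernels of disc kernels. Totality thus reduces to one variable.\<close>
  have "range unit_vec \<subseteq> clspan (kern monomial ` (polydisc :: (complex ^ 'n) set))"
  proof safe
    fix k :: "'n \<Rightarrow> nat"
    have "unit_vec k = tens (\<lambda>i. unit_vec (k i))"
    proof (rule ell2_eqI)
      fix j show "coef (unit_vec k) j = coef (tens (\<lambda>i. unit_vec (k i))) j"
        by (auto simp: coef_tens fun_eq_iff)
    qed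
    also have "\<dots> \<in> clspan {tens b | b. \<forall>i. b i \<in> ker1 ` disc}"
      by (rule tens_mem_clspan) (simp add: H1.kern_total del: mem_ball)
    also have "{tens b | b. \<forall>i. b i \<in> ker1 ` disc} \<subseteq> kern monomial ` (polydisc :: (complex ^ 'n) set)"
    proof safe
      fix b :: "'n \<Rightarrow> nat ell2" assume "\<forall>i. b i \<in> ker1 ` disc"
      then obtain w where w: "\<And>i. w i \<in> disc" "\<And>i. b i = ker1 (w i)"
        unfolding image_iff by metis
      then have "b = (\<lambda>i. ker1 ((\<chi> i. w i) $ i))" by auto
      with w(1) have "(\<chi> i. w i) \<in> polydisc" "tens b = tens (\<lambda>i. ker1 ((\<chi> i. w i) $ i))"
        by (simp_all add: polydisc_def)
      then show "tens b \<in> kern monomial ` (polydisc :: (complex ^ 'n) set)"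
        using kern_monomial by (metis imageI)
    qed
    then have "clspan {tens b | b. \<forall>i. b i \<in> ker1 ` disc} \<subseteq> clspan (kern monomial ` (polydisc :: (complex ^ 'n) set))"
      by (rule clspan_mono)
    finally show "unit_vec k \<in> clspan (kern monomial ` (polydisc :: (complex ^ 'n) set))" .
  qed
  then have "clspan (range unit_vec) \<subseteq> clspan (kern monomial ` (polydisc :: (complex ^ 'n) set))"
    by (rule clspan_subset)
  then show "clspan (kern monomial ` (polydisc :: (complex ^ 'n) set)) = UNIV"
    unfolding clspan_unit_vec by blast
qed

lemma HN_tens:
  fixes x :: "'n::finite \<Rightarrow> nat ell2"
  shows "HN (tens x) = (\<lambda>z. \<Prod>i\<in>UNIV. H1 (x i) (z $ i))"
proof
  fix z :: "complex ^ 'n"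
  show "HN (tens x) z = (\<Prod>i\<in>UNIV. H1 (x i) (z $ i))"
  proof (cases "z \<in> polydisc")
    case True
    then have "z $ i \<in> disc" for i by (simp add: polydisc_def)
    then show ?thesis
      using True by (simp add: HN.hfun_cinner kern_monomial cinner_tens H1.hfun_cinner del: mem_ball)
  next
    case False
    then obtain i where "z $ i \<notin> disc" by (auto simp: polydisc_def)
    then have "(\<Prod>i\<in>UNIV. H1 (x i) (z $ i)) = 0"
      by (intro prod_zero bexI[of _ i]) (auto simp: H1.hfun_outside simp del: mem_ball)
    then show ?thesis
      using False by (simp add: HN.hfun_outside)
  qed
qed

lemma H2_eq_range: "H2 = range HN"
  by (simp add: H2_def HN.hardy_eq_range)

lemma inner_H2_HN: "inner_H2 (HN a) (HN b) = cinner a b"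
  by (simp add: inner_H2_def HN.hardy_inner_hfun)

lemma norm_H2_HN: "norm_H2 (HN a) = norm a"
  by (simp add: norm_H2_def inner_H2_HN cinner_norm)

lemma span_HN: "cfun.span (HN ` B) = HN ` cvec.span B"
proof -
  interpret module_hom scaleC fscale HN
    by unfold_locales (simp_all add: HN.hfun_add HN.hfun_scaleC)
  show ?thesis by (rule span_image)
qed

text \<open>\<open>HN\<close> is an isometry of the coefficient space onto \<open>H2\<close>, so
  closed spans are computed on coefficients from here on.\<close>

lemma closed_span_HN: "closed_span (HN ` B) = HN ` clspan B"
proof -
  have "HN a \<in> closed_span (HN ` B) \<longleftrightarrow> a \<in> clspan B" for a
    unfolding closed_span_def clspan_def closure_approachable span_HN H2_eq_range
    by (simp add: HN.hfun_diff[symmetric] norm_H2_HN dist_norm norm_minus_commute)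
  moreover have "closed_span (HN ` B) \<subseteq> range HN"
    by (auto simp: closed_span_def H2_eq_range)
  ultimately show ?thesis by blast
qed

lemma tensor_HN:
  assumes "\<And>i. V i = H1 ` clspan (B i)"
  shows "tensor V = HN ` clspan {tens b | b. \<forall>i. b i \<in> B i}"
proof -
  have "{\<lambda>z. \<Prod>i\<in>UNIV. f i (z $ i) | f. \<forall>i. f i \<in> V i} = HN ` {tens x | x. \<forall>i. x i \<in> clspan (B i)}"
  proof safe
    fix f assume "\<forall>i. f i \<in> V i"
    then obtain x where x: "\<And>i. x i \<in> clspan (B i)" "\<And>i. f i = H1 (x i)"
      unfolding assms image_iff by metis
    then have "(\<lambda>z. \<Prod>i\<in>UNIV. f i (z $ i)) = HN (tens x)"
      by (simp add: HN_tens)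
    then show "(\<lambda>z. \<Prod>i\<in>UNIV. f i (z $ i)) \<in> HN ` {tens x | x. \<forall>i. x i \<in> clspan (B i)}"
      using x(1) by blast
  next
    fix x assume x: "\<forall>i. x i \<in> clspan (B i)"
    then show "\<exists>f. HN (tens x) = (\<lambda>z. \<Prod>i\<in>UNIV. f i (z $ i)) \<and> (\<forall>i. f i \<in> V i)"
      by (intro exI[of _ "\<lambda>i. H1 (x i)"]) (simp add: HN_tens assms)
  qed
  then show ?thesis
    by (simp add: tensor_def closed_span_HN clspan_tens_clspan)
qed

section \<open>The adjoint shifts on the polydisc\<close>

text \<open>The adjoint of multiplication by the monomial with exponent k.\<close>

definition adj_pow :: "('n \<Rightarrow> nat) \<Rightarrow> ('n::finite \<Rightarrow> nat) ell2 \<Rightarrow> ('n \<Rightarrow> nat) ell2" where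
  "adj_pow k = pull (\<lambda>m i. m i + k i)"

definition adj :: "'n \<Rightarrow> ('n::finite \<Rightarrow> nat) ell2 \<Rightarrow> ('n \<Rightarrow> nat) ell2" where
  "adj i = pull (\<lambda>m. m(i := Suc (m i)))"

lemma inj_upd_Suc: "inj (\<lambda>m :: 'n \<Rightarrow> nat. m(i := Suc (m i)))"
proof (rule injI, rule ext)
  fix m m' :: "'n \<Rightarrow> nat" and j
  assume "m(i := Suc (m i)) = m'(i := Suc (m' i))"
  then have "(m(i := Suc (m i))) j = (m'(i := Suc (m' i))) j" by simp
  then show "m j = m' j" by (simp split: if_splits)
qed

lemma coef_adj_pow: "coef (adj_pow k a) m = coef a (\<lambda>i. m i + k i)"
  unfolding adj_pow_def by (subst coef_pull) (auto simp: inj_def fun_eq_iff)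

lemma coef_adj: "coef (adj i a) m = coef a (m(i := Suc (m i)))"
  unfolding adj_def by (rule coef_pull[OF inj_upd_Suc])

lemma bounded_clinear_adj: "bounded_clinear (adj i)"
  unfolding adj_def by (rule bounded_clinear_pull[OF inj_upd_Suc])

lemma coef_adj_funpow: "coef ((adj i ^^ n) a) m = coef a (m(i := m i + n))"
  by (induction n arbitrary: m) (simp_all add: coef_adj)

lemma adj_tens: "adj i (tens x) = tens (x(i := bshift (x i)))"
proof (rule ell2_eqI)
  fix m
  have "coef (adj i (tens x)) m = (\<Prod>j\<in>UNIV. coef (x j) ((m(i := Suc (m i))) j))"
    by (simp add: coef_adj coef_tens)
  also have "\<dots> = coef (x i) (Suc (m i)) * (\<Prod>j\<in>UNIV - {i}. coef (x j) ((m(i := Suc (m i))) j))"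
    by (subst prod.remove[of UNIV i]) auto
  also have "(\<Prod>j\<in>UNIV - {i}. coef (x j) ((m(i := Suc (m i))) j)) = (\<Prod>j\<in>UNIV - {i}. coef (x j) (m j))"
    by (rule prod.cong) auto
  finally show "coef (adj i (tens x)) m = coef (tens (x(i := bshift (x i)))) m"
    by (simp add: coef_tens_upd coef_pull)
qed

lemma M_z_HN:
  fixes a :: "('n::finite \<Rightarrow> nat) ell2"
  shows "M_z i (HN a) = HN (push (\<lambda>m. m(i := Suc (m i))) a)"
proof
  fix z :: "complex ^ 'n"
  show "M_z i (HN a) z = HN (push (\<lambda>m. m(i := Suc (m i))) a) z"
  proof (cases "z \<in> polydisc")
    case True
    have "pull (\<lambda>m. m(i := Suc (m i))) (kern monomial z) = scaleC (cnj (z $ i)) (kern monomial z)"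
    proof (rule ell2_eqI)
      fix m :: "'n \<Rightarrow> nat"
      have "monomial (m(i := Suc (m i))) z = (z $ i) ^ Suc (m i) * (\<Prod>j\<in>UNIV - {i}. (z $ j) ^ (m(i := Suc (m i))) j)"
        unfolding monomial_def by (subst prod.remove[of UNIV i]) auto
      also have "(\<Prod>j\<in>UNIV - {i}. (z $ j) ^ (m(i := Suc (m i))) j) = (\<Prod>j\<in>UNIV - {i}. (z $ j) ^ m j)"
        by (rule prod.cong) auto
      also have "(z $ i) ^ Suc (m i) * \<dots> = z $ i * monomial m z"
        unfolding monomial_def prod.remove[OF finite UNIV_I[of i], of "\<lambda>j. (z $ j) ^ m j"]
        by simp
      finally show "coef (pull (\<lambda>m. m(i := Suc (m i))) (kern monomial z)) m =
          coef (scaleC (cnj (z $ i)) (kern monomial z)) m"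
        unfolding coef_pull[OF inj_upd_Suc] HN.coef_kern[OF True] coef_scaleC by (simp only: complex_cnj_mult)
    qed
    then show ?thesis
      using True by (simp add: M_z_def HN.hfun_cinner cinner_push[OF inj_upd_Suc])
  next
    case False
    then show ?thesis by (simp add: M_z_def HN.hfun_outside)
  qed
qed

lemma M_z_adj_HN:
  fixes a :: "('n::finite \<Rightarrow> nat) ell2"
  shows "M_z_adj i (HN a) = HN (adj i a)"
proof -
  have "(THE g. g \<in> H2 \<and> (\<forall>h\<in>H2. inner_H2 (M_z i h) (HN a) = inner_H2 h g)) = HN (adj i a)"
  proof (rule the_equality)
    show "HN (adj i a) \<in> H2 \<and> (\<forall>h\<in>H2. inner_H2 (M_z i h) (HN a) = inner_H2 h (HN (adj i a)))"
      by (auto simp: H2_eq_range M_z_HN inner_H2_HN cinner_push[OF inj_upd_Suc] adj_def)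
  next
    fix g :: "complex ^ 'n \<Rightarrow> complex"
    assume g: "g \<in> H2 \<and> (\<forall>h\<in>H2. inner_H2 (M_z i h) (HN a) = inner_H2 h g)"
    then obtain b where b: "g = HN b" by (auto simp: H2_eq_range)
    have "cinner h (adj i a) = cinner h b" for h
      using g unfolding b H2_eq_range
      by (auto simp: M_z_HN inner_H2_HN cinner_push[OF inj_upd_Suc] adj_def)
    then have "cinner (adj i a - b) (adj i a - b) = 0"
      by (simp add: cinner_diff_right)
    then show "g = HN (adj i a)"
      by (simp add: b cinner_norm)
  qed
  then show ?thesis
    by (simp add: M_z_adj_def H2_eq_range)
qed

lemma M_z_adj_zero: "M_z_adj i 0 = 0"
  using M_z_adj_HN[of i 0] by (simp add: HN.hfun_zero bounded_clinear_zero[OF bounded_clinear_adj])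

lemma M_z_adj_funpow_HN: "(M_z_adj i ^^ n) (HN a) = HN ((adj i ^^ n) a)"
  by (induction n) (simp_all add: M_z_adj_HN)

lemma M_z_adj_funpow_not_H2:
  assumes "f \<notin> H2" "n > 0"
  shows "(M_z_adj i ^^ n) f = 0"
proof -
  have "(M_z_adj i ^^ m) 0 = 0" for m
    by (induction m) (simp_all add: M_z_adj_zero[unfolded zero_fun_def])
  moreover obtain m where "n = Suc m" using assms(2) gr0_implies_Suc by blast
  moreover have "M_z_adj i f = 0" using assms(1) by (simp add: M_z_adj_def)
  ultimately show ?thesis by (simp add: funpow_swap1)
qed

text \<open>\<open>Finite_Set.fold\<close> asks for commutation on all functions; outside
  \<open>H2\<close> it holds because the adjoint is 0 there by convention.\<close>

lemma M_z_adj_funpow_commute: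
  fixes i j :: "'n::finite"
  shows "(M_z_adj i ^^ m) ((M_z_adj j ^^ n) f) = (M_z_adj j ^^ n) ((M_z_adj i ^^ m) f)"
proof (cases "f \<in> H2")
  case True
  then obtain a where "f = HN a" by (auto simp: H2_eq_range)
  moreover have "(adj i ^^ m) ((adj j ^^ n) a) = (adj j ^^ n) ((adj i ^^ m) a)"
    by (rule ell2_eqI, cases "i = j") (simp_all add: coef_adj_funpow add_ac fun_upd_twist)
  ultimately show ?thesis by (simp add: M_z_adj_funpow_HN)
next
  case False
  have 0: "(M_z_adj i ^^ m) 0 = 0" for i :: 'n and m
    by (induction m) (simp_all add: M_z_adj_zero[unfolded zero_fun_def])
  show ?thesis
    by (cases "m = 0"; cases "n = 0") (use False in \<open>simp_all add: M_z_adj_funpow_not_H2 0\<close>)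
qed

lemma op_power_HN:
  fixes a :: "('n::finite \<Rightarrow> nat) ell2"
  shows "op_power M_z_adj k (HN a) = HN (adj_pow k a)"
proof -
  interpret comp_fun_commute "\<lambda>i. M_z_adj i ^^ k i"
    by unfold_locales (auto simp: fun_eq_iff M_z_adj_funpow_commute)
  \<comment> \<open>Generalised to a set I of variables for the induction, with exponents cut off
    outside I.\<close>
  have "Finite_Set.fold (\<lambda>i. M_z_adj i ^^ k i) (HN a) I =
      HN (adj_pow (\<lambda>i. if i \<in> I then k i else 0) a)" if "finite I" for I
    using that
  proof (induction I rule: finite_induct)
    case empty
    have "adj_pow (\<lambda>i. 0) a = a"
      by (rule ell2_eqI) (simp add: coef_adj_pow)
    then show ?case by simp
  next
    case (insert j I)
    have "(adj j ^^ k j) (adj_pow (\<lambda>i. if i \<in> I then k i else 0) a) =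
        adj_pow (\<lambda>i. if i \<in> insert j I then k i else 0) a"
    proof (rule ell2_eqI)
      fix m :: "'n \<Rightarrow> nat"
      have "(\<lambda>i. (m(j := m j + k j)) i + (if i \<in> I then k i else 0)) =
          (\<lambda>i. m i + (if i \<in> insert j I then k i else 0))"
        using insert.hyps by (auto simp: fun_eq_iff)
      then show "coef ((adj j ^^ k j) (adj_pow (\<lambda>i. if i \<in> I then k i else 0) a)) m =
          coef (adj_pow (\<lambda>i. if i \<in> insert j I then k i else 0) a) m"
        by (simp only: coef_adj_funpow coef_adj_pow)
    qed
    then show ?case
      using insert by (simp add: M_z_adj_funpow_HN)
  qed
  from this[of UNIV] show ?thesis
    by (simp add: op_power_def)
qed

text \<open>Monomials can replace polynomials because a closed span is taken.\<close>

definition gen :: "('n::finite \<Rightarrow> nat) ell2 set \<Rightarrow> ('n \<Rightarrow> nat) ell2 set" where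
  "gen S = clspan {adj_pow k h | k h. h \<in> S}"

lemma generated_HN: "generated M_z_adj (HN ` S) = HN ` gen S"
proof -
  define P where "P = {poly_op M_z_adj p h | p h. h \<in> HN ` S}"
  define P' where "P' = HN ` {adj_pow k h | k h. h \<in> S}"
  have "cfun.span P = cfun.span P'"
  proof (rule cfun.span_eq[THEN iffD2], intro conjI)
    show "P \<subseteq> cfun.span P'"
    proof (clarsimp simp: P_def)
      fix p h assume "h \<in> S"
      show "poly_op M_z_adj p (HN h) \<in> cfun.span P'"
        unfolding poly_op_def op_power_HN
        by (intro cfun.span_sum cfun.span_scale cfun.span_base) (use \<open>h \<in> S\<close> in \<open>auto simp: P'_def\<close>)
    qed
    have "P' \<subseteq> P"
    proof (clarsimp simp: P'_def)
      fix k h assume "h \<in> S"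
      have "HN (adj_pow k h) = poly_op M_z_adj (Poly_Mapping.single k 1) (HN h)"
        by (simp add: poly_op_def op_power_HN fscale_def)
      then show "HN (adj_pow k h) \<in> P"
        using \<open>h \<in> S\<close> unfolding P_def by blast
    qed
    then show "P' \<subseteq> cfun.span P"
      using cfun.span_superset by blast
  qed
  then have "closed_span P = closed_span P'"
    by (simp add: closed_span_def)
  then show ?thesis
    by (simp add: generated_def gen_def P_def P'_def closed_span_HN)
qed

lemma ecard_image: "inj_on f S \<Longrightarrow> ecard (f ` S) = ecard S"
  by (simp add: ecard_def finite_image_iff card_image)

lemma co_rank_HN:
  fixes V :: "('n::finite \<Rightarrow> nat) ell2 set"
  shows "co_rank (HN ` V) = Inf {ecard S | S. S \<subseteq> V \<and> gen S = V}"
proof -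
  have inj: "inj_on HN S" for S :: "('n \<Rightarrow> nat) ell2 set"
    using HN.inj_hfun by (rule inj_on_subset) simp
  have "{ecard S | S. S \<subseteq> HN ` V \<and> generated M_z_adj S = HN ` V} = {ecard S | S. S \<subseteq> V \<and> gen S = V}"
  proof (intro equalityI subsetI)
    fix e assume "e \<in> {ecard S | S. S \<subseteq> HN ` V \<and> generated M_z_adj S = HN ` V}"
    then obtain S where S: "e = ecard S" "S \<subseteq> HN ` V" "generated M_z_adj S = HN ` V" by blast
    then obtain S' where S': "S' \<subseteq> V" "S = HN ` S'"
      by (auto simp: subset_image_iff)
    have "gen S' = V"
      using S(3) unfolding S' generated_HN inj_image_eq_iff[OF HN.inj_hfun] .
    with S(1) S' show "e \<in> {ecard S | S. S \<subseteq> V \<and> gen S = V}"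
      using ecard_image[OF inj] by blast
  next
    fix e assume "e \<in> {ecard S | S. S \<subseteq> V \<and> gen S = V}"
    then obtain S where S: "e = ecard S" "S \<subseteq> V" "gen S = V" by blast
    then have "generated M_z_adj (HN ` S) = HN ` V" "HN ` S \<subseteq> HN ` V" "e = ecard (HN ` S)"
      by (auto simp: generated_HN ecard_image[OF inj])
    then show "e \<in> {ecard S | S. S \<subseteq> HN ` V \<and> generated M_z_adj S = HN ` V}"
      by blast
  qed
  then show ?thesis
    by (simp add: co_rank_def rank_on_def)
qed

section \<open>Subspaces invariant under the adjoint shifts\<close>

definition invariant :: "('n::finite \<Rightarrow> nat) ell2 set \<Rightarrow> bool" where
  "invariant V \<longleftrightarrow> cvec.subspace V \<and> (\<forall>i. \<forall>x\<in>V. adj i x \<in> V)"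

lemmas adj_add = bounded_clinear_add[OF bounded_clinear_adj]
  and adj_diff = bounded_clinear_diff[OF bounded_clinear_adj]
  and adj_scaleC = bounded_clinear_scaleC[OF bounded_clinear_adj]
  and adj_zero = bounded_clinear_zero[OF bounded_clinear_adj]

lemma adj_commute: "adj i (adj j x) = adj j (adj i x)"
  by (rule ell2_eqI, cases "i = j") (simp_all add: coef_adj fun_upd_twist)

lemma adj_pow_0: "adj_pow (\<lambda>i. 0) x = x"
  by (rule ell2_eqI) (simp add: coef_adj_pow)

lemma adj_adj_pow: "adj i (adj_pow k x) = adj_pow (k(i := Suc (k i))) x"
proof (rule ell2_eqI)
  fix m
  have "(\<lambda>j. (m(i := Suc (m i))) j + k j) = (\<lambda>j. m j + (k(i := Suc (k i))) j)"
    by auto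
  then show "coef (adj i (adj_pow k x)) m = coef (adj_pow (k(i := Suc (k i))) x) m"
    by (simp only: coef_adj coef_adj_pow)
qed

lemma adj_pow_mem:
  assumes V: "invariant V" and x: "x \<in> V"
  shows "adj_pow k x \<in> V"
proof (induction "sum k UNIV" arbitrary: k)
  case 0
  then have "k = (\<lambda>i. 0)" by auto
  then show ?case using x by (simp add: adj_pow_0)
next
  case (Suc n)
  have "\<exists>i. k i \<noteq> 0"
  proof (rule ccontr)
    assume "\<nexists>i. k i \<noteq> 0"
    with Suc.hyps(2) show False by simp
  qed
  then obtain i where i: "k i > 0" by auto
  define k' where "k' = k(i := k i - 1)"
  have "sum k UNIV = k i + sum k (UNIV - {i})" "sum k' UNIV = k' i + sum k' (UNIV - {i})"
    by (simp_all add: sum.remove)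
  moreover have "sum k' (UNIV - {i}) = sum k (UNIV - {i})"
    by (rule sum.cong) (auto simp: k'_def)
  ultimately have "n = sum k' UNIV"
    using Suc.hyps(2) i by (simp add: k'_def)
  then have "adj i (adj_pow k' x) \<in> V"
    using Suc.hyps(1) V by (auto simp: invariant_def)
  moreover have "k'(i := Suc (k' i)) = k"
    using i by (simp add: k'_def)
  ultimately show ?case
    by (simp only: adj_adj_pow)
qed

lemma invariant_gen: "invariant (gen S)"
  unfolding invariant_def
proof (intro conjI allI ballI)
  show "cvec.subspace (gen S)"
    using closed_cspace_clspan by (auto simp: gen_def closed_cspace_def)
  fix i :: 'a and x assume "x \<in> gen S"
  have "adj i ` gen S \<subseteq> gen S"
    unfolding gen_def
  proof (rule clspan_image_subset[OF bounded_clinear_adj closed_cspace_clspan])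
    show "adj i ` {adj_pow k h |k h. h \<in> S} \<subseteq> clspan {adj_pow k h |k h. h \<in> S}"
    proof safe
      fix k h assume "h \<in> S"
      then show "adj i (adj_pow k h) \<in> clspan {adj_pow k h |k h. h \<in> S}"
        unfolding adj_adj_pow by (intro clspan_base) blast
    qed
  qed
  with \<open>x \<in> gen S\<close> show "adj i x \<in> gen S" by blast
qed

lemma gen_superset: "S \<subseteq> gen S"
proof
  fix x assume "x \<in> S"
  then have "adj_pow (\<lambda>i. 0) x \<in> gen S"
    unfolding gen_def by (intro clspan_base) blast
  then show "x \<in> gen S" by (simp add: adj_pow_0)
qed

lemma gen_minimal:
  assumes "S \<subseteq> V" "invariant V" "closed V"
  shows "gen S \<subseteq> V"
  unfolding gen_def
  by (rule clspan_minimal) (use assms adj_pow_mem in \<open>auto simp: closed_cspace_def invariant_def\<close>)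

text \<open>The operators playing the role of polynomials in the adjoint shifts.\<close>

definition adj_poly :: "(('n::finite \<Rightarrow> nat) ell2 \<Rightarrow> ('n \<Rightarrow> nat) ell2) \<Rightarrow> bool" where
  "adj_poly A \<longleftrightarrow> bounded_clinear A \<and> (\<forall>V. invariant V \<longrightarrow> A ` V \<subseteq> V)"

lemma adj_polyD:
  assumes "adj_poly A"
  shows "bounded_clinear A" "invariant V \<Longrightarrow> x \<in> V \<Longrightarrow> A x \<in> V"
  using assms by (auto simp: adj_poly_def)

lemma bounded_clinear_id: "bounded_clinear (\<lambda>x. x)"
  by (rule bounded_clinearI[where K = 1]) auto

lemma bounded_clinear_compose:
  assumes "bounded_clinear A" "bounded_clinear B"
  shows "bounded_clinear (\<lambda>x. A (B x))"
  using assms bounded_linear_compose[of A B] by (auto simp: bounded_clinear_def)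

lemma bounded_clinear_minus:
  assumes "bounded_clinear A" "bounded_clinear B"
  shows "bounded_clinear (\<lambda>x. A x - B x)"
  using assms bounded_linear_sub[of A B]
  by (auto simp: bounded_clinear_def cvec.scale_right_diff_distrib)

lemma bounded_clinear_scale: "bounded_clinear (scaleC c)"
  unfolding bounded_clinear_def using bounded_linear_scaleC[of c] by (auto simp: mult.commute)

lemma adj_poly_id: "adj_poly (\<lambda>x. x)"
  by (simp add: adj_poly_def bounded_clinear_id)

lemma adj_poly_zero: "adj_poly (\<lambda>x. 0)"
  unfolding adj_poly_def
  by (auto intro!: bounded_clinearI[where K = 0] simp: invariant_def cvec.subspace_0)

lemma adj_poly_adj: "adj_poly (adj i)"
  by (auto simp: adj_poly_def bounded_clinear_adj invariant_def)

lemma adj_poly_scale: "adj_poly (scaleC c)"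
  by (auto simp: adj_poly_def bounded_clinear_scale invariant_def cvec.subspace_scale)

lemma adj_poly_compose: "adj_poly A \<Longrightarrow> adj_poly B \<Longrightarrow> adj_poly (\<lambda>x. A (B x))"
  unfolding adj_poly_def by (blast intro: bounded_clinear_compose)

lemma adj_poly_diff: "adj_poly A \<Longrightarrow> adj_poly B \<Longrightarrow> adj_poly (\<lambda>x. A x - B x)"
  unfolding adj_poly_def by (auto intro!: bounded_clinear_minus simp: invariant_def cvec.subspace_diff image_subset_iff)

lemma adj_poly_funpow: "adj_poly A \<Longrightarrow> adj_poly (A ^^ n)"
proof (induction n)
  case 0
  then show ?case using adj_poly_id by (simp add: id_def)
next
  case (Suc n)
  then show ?case using adj_poly_compose[of A "A ^^ n"] by (simp add: o_def)
qed

definition adj_minus :: "'n \<Rightarrow> complex \<Rightarrow> ('n::finite \<Rightarrow> nat) ell2 \<Rightarrow> ('n \<Rightarrow> nat) ell2" where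
  "adj_minus i c x = adj i x - scaleC c x"

lemma adj_poly_adj_minus: "adj_poly (adj_minus i c)"
  unfolding adj_minus_def by (intro adj_poly_diff adj_poly_adj adj_poly_scale)

lemma invariant_adj_minus: "invariant V \<Longrightarrow> x \<in> V \<Longrightarrow> adj_minus i c x \<in> V"
  by (rule adj_polyD(2)[OF adj_poly_adj_minus])

lemma adj_adj_minus_commute: "adj j (adj_minus i c x) = adj_minus i c (adj j x)"
  by (simp add: adj_minus_def adj_diff adj_scaleC adj_commute[of j i])

text \<open>Generalised eigenspaces: for c = \<open>cnj (\<alpha> i)\<close> they contain the jets
  at \<alpha> whose order in the variable i is below k.\<close>

definition adj_root_space :: "'n \<Rightarrow> complex \<Rightarrow> nat \<Rightarrow> ('n::finite \<Rightarrow> nat) ell2 set" where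
  "adj_root_space i c k = {x. (adj_minus i c ^^ k) x = 0}"

lemma adj_root_space_0: "adj_root_space i c 0 = {0}"
  by (simp add: adj_root_space_def)

lemma adj_minus_root_space: "x \<in> adj_root_space i c (Suc k) \<Longrightarrow> adj_minus i c x \<in> adj_root_space i c k"
  by (simp add: adj_root_space_def funpow_swap1)

lemma invariant_adj_root_space: "invariant (adj_root_space i c k)"
proof -
  have clin: "bounded_clinear (adj_minus i c ^^ k)"
    by (rule adj_polyD(1)) (intro adj_poly_funpow adj_poly_adj_minus)
  have "adj j ((adj_minus i c ^^ k) x) = (adj_minus i c ^^ k) (adj j x)" for j x
    by (induction k) (simp_all add: adj_adj_minus_commute)
  then show ?thesis
    unfolding invariant_def adj_root_space_def
    by (auto intro!: cvec.subspaceI simp: bounded_clinear_zero[OF clin] bounded_clinear_add[OF clin]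
        bounded_clinear_scaleC[OF clin] adj_zero) (metis adj_zero)
qed

text \<open>
  With \<open>w = (z - b) / (a - b)\<close>, the polynomial \<open>1 - (1 - w\<^sup>k)\<^sup>k\<close> vanishes to order \<open>k\<close> at \<open>b\<close> and
  is \<open>1\<close> up to order \<open>k\<close> at \<open>a\<close>.
\<close>

lemma exists_separating_adj_poly:
  fixes a b :: complex and i :: "'n::finite"
  assumes "a \<noteq> b"
  shows "\<exists>U. adj_poly U \<and> (\<forall>x\<in>adj_root_space i a k. U x = x) \<and> (\<forall>x\<in>adj_root_space i b k. U x = 0)"
proof -
  define W :: "('n \<Rightarrow> nat) ell2 \<Rightarrow> ('n \<Rightarrow> nat) ell2" where
    "W x = scaleC (1 / (a - b)) (adj_minus i b x)" for x
  define E where "E x = x - (W ^^ k) x" for x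
  define U where "U x = x - (E ^^ k) x" for x
  have W: "adj_poly W"
    unfolding W_def by (intro adj_poly_compose[OF adj_poly_scale] adj_poly_adj_minus)
  have E: "adj_poly E"
    unfolding E_def by (intro adj_poly_diff adj_poly_id adj_poly_funpow W)
  have U: "adj_poly U"
    unfolding U_def by (intro adj_poly_diff adj_poly_id adj_poly_funpow E)
  have sub: "cvec.subspace (adj_root_space i c d)" for c d
    using invariant_adj_root_space by (auto simp: invariant_def)
  have W_minus: "W x - x \<in> adj_root_space i a d" if "x \<in> adj_root_space i a (Suc d)" for x d
  proof -
    have "W x - x = scaleC (1 / (a - b)) (adj_minus i a x)"
    proof (rule ell2_eqI)
      fix m
      have "(coef (adj i x) m - b * coef x m) / (a - b) - coef x m = (coef (adj i x) m - a * coef x m) / (a - b)"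
        using assms by (simp add: field_simps)
      then show "coef (W x - x) m = coef (scaleC (1 / (a - b)) (adj_minus i a x)) m"
        by (simp add: W_def adj_minus_def)
    qed
    then show ?thesis
      using adj_minus_root_space[OF that] sub by (simp add: cvec.subspace_scale)
  qed
  have Wn_minus: "(W ^^ n) x - x \<in> adj_root_space i a d" if "x \<in> adj_root_space i a (Suc d)" for x d n
  proof (induction n)
    case (Suc n)
    have "(W ^^ Suc n) x - x = W ((W ^^ n) x - x) + (W x - x)"
      using bounded_clinear_diff[OF adj_polyD(1)[OF W], of "(W ^^ n) x" x] by simp
    also have "\<dots> \<in> adj_root_space i a d"
      using adj_polyD(2)[OF W invariant_adj_root_space Suc] W_minus[OF that] sub
      by (simp add: cvec.subspace_add)
    finally show ?case .
  qed (use sub in \<open>simp add: cvec.subspace_0\<close>)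
  \<comment> \<open>On the root spaces at a, W is the identity modulo lower ones, so E = 1 - W^k is
    nilpotent there; at b it is W^k that vanishes.\<close>
  have E_a: "E x \<in> adj_root_space i a d" if "x \<in> adj_root_space i a (Suc d)" for x d
    using cvec.subspace_neg[OF sub Wn_minus[OF that, of k]] by (simp add: E_def)
  have "(E ^^ d) x = 0" if "x \<in> adj_root_space i a d" for x d
    using that
  proof (induction d arbitrary: x)
    case (Suc d)
    then show ?case
      using E_a by (simp add: funpow_swap1)
  qed (simp add: adj_root_space_0)
  then have fix_a: "U x = x" if "x \<in> adj_root_space i a k" for x
    using that by (simp add: U_def)
  have W_b: "(W ^^ d) x = 0" if "x \<in> adj_root_space i b d" for x d
    using that
  proof (induction d arbitrary: x)
    case (Suc d)
    have "W x \<in> adj_root_space i b d"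
      unfolding W_def using adj_minus_root_space[OF Suc.prems] sub by (simp add: cvec.subspace_scale)
    then show ?case
      using Suc.IH by (simp add: funpow_swap1)
  qed (simp add: adj_root_space_0)
  then have "E x = x" if "x \<in> adj_root_space i b k" for x
    using that by (simp add: E_def)
  then have "(E ^^ n) x = x" if "x \<in> adj_root_space i b k" for n x
    using that by (induction n) simp_all
  then have "U x = 0" if "x \<in> adj_root_space i b k" for x
    using that by (simp add: U_def)
  with U fix_a show ?thesis by blast
qed

section \<open>Jets on the polydisc\<close>

definition jetn :: "('n::finite \<Rightarrow> complex) \<Rightarrow> ('n \<Rightarrow> nat) \<Rightarrow> ('n \<Rightarrow> nat) ell2" where
  "jetn \<alpha> j = tens (\<lambda>i. jet (\<alpha> i) (j i))"

context
  fixes \<alpha> :: "'n::finite \<Rightarrow> complex"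
  assumes \<alpha>: "\<And>i. \<alpha> i \<in> disc"
begin

lemma adj_minus_jetn:
  "adj_minus i (cnj (\<alpha> i)) (jetn \<alpha> j) = (if j i = 0 then 0 else jetn \<alpha> (j(i := j i - 1)))"
proof -
  define x where "x = (\<lambda>i. jet (\<alpha> i) (j i))"
  define T where "T y = tens (x(i := y))" for y
  have T: "bounded_clinear T"
    unfolding T_def by (rule bounded_clinear_tens_upd)
  have "adj_minus i (cnj (\<alpha> i)) (jetn \<alpha> j) = T (bshift (x i) - scaleC (cnj (\<alpha> i)) (x i))"
    unfolding bounded_clinear_diff[OF T] bounded_clinear_scaleC[OF T]
    by (simp add: adj_minus_def jetn_def adj_tens T_def x_def[symmetric])
  also have "bshift (x i) - scaleC (cnj (\<alpha> i)) (x i) = (if j i = 0 then 0 else jet (\<alpha> i) (j i - 1))"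
    using bshift_jet_0[OF \<alpha>[of i]] bshift_jet_Suc[OF \<alpha>[of i]]
    by (cases "j i") (simp_all add: x_def del: jet.simps)
  also have "T \<dots> = (if j i = 0 then 0 else jetn \<alpha> (j(i := j i - 1)))"
  proof -
    have "x(i := jet (\<alpha> i) (j i - 1)) = (\<lambda>l. jet (\<alpha> l) ((j(i := j i - 1)) l))"
      by (auto simp: x_def)
    then show ?thesis
      using bounded_clinear_zero[OF T] by (cases "j i = 0") (simp_all add: T_def jetn_def)
  qed
  finally show ?thesis .
qed

lemma jetn_root_space: "j i < k \<Longrightarrow> jetn \<alpha> j \<in> adj_root_space i (cnj (\<alpha> i)) k"
proof (induction k arbitrary: j)
  case (Suc k)
  have "adj_minus i (cnj (\<alpha> i)) (jetn \<alpha> j) \<in> adj_root_space i (cnj (\<alpha> i)) k"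
    unfolding adj_minus_jetn
    using Suc invariant_adj_root_space[of i "cnj (\<alpha> i)" k]
    by (auto simp: invariant_def cvec.subspace_0)
  then show ?case
    by (simp add: adj_root_space_def funpow_swap1)
qed simp

text \<open>Lowering one coordinate at a time with \<open>adj_minus\<close> leads from m to every j
  below it, so the maximal orders generate the rest.\<close>

lemma jetn_mem_mono:
  assumes V: "invariant V" and m: "jetn \<alpha> m \<in> V" and "j \<le> m"
  shows "jetn \<alpha> j \<in> V"
  using m \<open>j \<le> m\<close>
proof (induction "sum m UNIV" arbitrary: m rule: less_induct)
  case less
  show ?case
  proof (cases "j = m")
    case False
    then obtain i where i: "j i < m i"
      using less.prems(2) by (metis le_fun_def le_neq_implies_less ext)
    define m' where "m' = m(i := m i - 1)"
    have "sum m' UNIV < sum m UNIV"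
      by (rule sum_strict_mono_ex1) (use i in \<open>auto simp: m'_def intro: bexI[of _ i]\<close>)
    moreover have "jetn \<alpha> m' \<in> V"
      using invariant_adj_minus[OF V less.prems(1), of i "cnj (\<alpha> i)"] i
      by (simp add: adj_minus_jetn m'_def)
    moreover have "j \<le> m'"
      using less.prems(2) i by (auto simp: le_fun_def m'_def)
    ultimately show ?thesis
      by (rule less.hyps)
  qed (use less.prems in simp)
qed

end

text \<open>Each \<beta> in X differs from \<alpha> in some coordinate, and a separating polynomial
  in that variable removes it. The composition works because polynomials preserve all root
  spaces.\<close>

lemma exists_isolating_adj_poly:
  fixes \<alpha> :: "'n::finite \<Rightarrow> complex"
  assumes "finite X" "\<alpha> \<notin> X" "\<And>i. \<alpha> i \<in> disc" "\<And>\<beta> i. \<beta> \<in> X \<Longrightarrow> \<beta> i \<in> disc"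
  shows "\<exists>p. adj_poly p \<and> (\<forall>j. (\<forall>i. j i < k) \<longrightarrow> p (jetn \<alpha> j) = jetn \<alpha> j \<and> (\<forall>\<beta>\<in>X. p (jetn \<beta> j) = 0))"
  using assms(1,2,4)
proof (induction X rule: finite_induct)
  case empty
  then show ?case using adj_poly_id by auto
next
  case (insert \<beta> X)
  have "\<exists>p. adj_poly p \<and> (\<forall>j. (\<forall>i. j i < k) \<longrightarrow> p (jetn \<alpha> j) = jetn \<alpha> j \<and> (\<forall>\<gamma>\<in>X. p (jetn \<gamma> j) = 0))"
    by (rule insert.IH) (use insert.prems in auto)
  then obtain p where p0: "adj_poly p"
    "\<forall>j. (\<forall>i. j i < k) \<longrightarrow> p (jetn \<alpha> j) = jetn \<alpha> j \<and> (\<forall>\<gamma>\<in>X. p (jetn \<gamma> j) = 0)"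
    by (elim exE conjE)
  then have p: "adj_poly p" "\<And>j. \<forall>i. j i < k \<Longrightarrow> p (jetn \<alpha> j) = jetn \<alpha> j"
    "\<And>j \<gamma>. \<forall>i. j i < k \<Longrightarrow> \<gamma> \<in> X \<Longrightarrow> p (jetn \<gamma> j) = 0"
    by simp_all
  obtain i where i: "\<alpha> i \<noteq> \<beta> i"
    using insert.prems(1) by blast
  then have "cnj (\<alpha> i) \<noteq> cnj (\<beta> i)" by simp
  from exists_separating_adj_poly[OF this, of i k]
  obtain U where U: "adj_poly U" "\<And>x. x \<in> adj_root_space i (cnj (\<alpha> i)) k \<Longrightarrow> U x = x"
    "\<And>x. x \<in> adj_root_space i (cnj (\<beta> i)) k \<Longrightarrow> U x = 0"
    by blast
  have "U (p (jetn \<alpha> j)) = jetn \<alpha> j" if "\<forall>i. j i < k" for j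
    using p(2)[OF that] U(2)[OF jetn_root_space[of \<alpha> j i k]] that assms(3) by simp
  moreover have "U (p (jetn \<beta> j)) = 0" if "\<forall>i. j i < k" for j
  proof -
    have "jetn \<beta> j \<in> adj_root_space i (cnj (\<beta> i)) k"
      using that insert.prems(2)[of \<beta>] by (intro jetn_root_space) auto
    then show ?thesis
      by (intro U(3) adj_polyD(2)[OF p(1) invariant_adj_root_space])
  qed
  moreover have "U (p (jetn \<gamma> j)) = 0" if "\<forall>i. j i < k" "\<gamma> \<in> X" for j \<gamma>
    using p(3)[OF that] bounded_clinear_zero[OF adj_polyD(1)[OF U(1)]] by simp
  ultimately show ?case
    by (intro exI[of _ "\<lambda>x. U (p x)"]) (auto intro: adj_poly_compose U(1) p(1))
qed

section \<open>A single vector generating countably many isolated vectors\<close>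

text \<open>
  The weights \<open>c u\<close> decay so fast that \<open>p N t\<close>, which isolates \<open>v t\<close> among \<open>v 0, \<dots>, v N\<close>, maps
  the tail of \<open>h = \<Sum>u. c u v u\<close> beyond \<open>N\<close> to a vector of norm at most \<open>2\<^sup>-\<^sup>N\<close>; hence
  \<open>p N t h\<close> tends to \<open>c t v t\<close>.
\<close>

lemma exists_common_generator:
  fixes v :: "nat \<Rightarrow> 'k ell2" and p :: "nat \<Rightarrow> nat \<Rightarrow> 'k ell2 \<Rightarrow> 'k ell2"
  assumes p: "\<And>N t. bounded_clinear (p N t)"
    and fixes_t: "\<And>N t. t \<le> N \<Longrightarrow> p N t (v t) = v t"
    and kills: "\<And>N t u. t \<le> N \<Longrightarrow> u \<le> N \<Longrightarrow> u \<noteq> t \<Longrightarrow> p N t (v u) = 0"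
  shows "\<exists>h\<in>clspan (range v). \<forall>V. closed_cspace V \<longrightarrow> (\<forall>N t. p N t h \<in> V) \<longrightarrow> range v \<subseteq> V"
proof -
  \<comment> \<open>For each u only the finitely many operators \<open>p N t\<close> with t \<le> N
    < u need a bound; the summand 1 keeps the divisor positive.\<close>
  define d where "d u = 1 + norm (v u) + (\<Sum>N<u. \<Sum>t\<le>N. norm (p N t (v u)))" for u
  define c where "c u = (1/2) ^ u / d u" for u
  have d_pos: "d u > 0" for u
    unfolding d_def by (intro add_pos_nonneg add_nonneg_nonneg sum_nonneg) auto
  have c_pos: "c u > 0" for u
    using d_pos[of u] by (simp add: c_def)
  have bound: "norm (c u *\<^sub>R x) \<le> (1/2) ^ u" if "norm x \<le> d u" for u and x :: "'k ell2"
  proof -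
    have "norm (c u *\<^sub>R x) = (1/2) ^ u * (norm x / d u)"
      using d_pos[of u] by (simp add: c_def)
    also have "\<dots> \<le> (1/2) ^ u * 1"
      using that d_pos[of u] by (intro mult_left_mono) auto
    finally show ?thesis by simp
  qed
  have "norm (v u) \<le> d u" for u
    unfolding d_def by (simp add: sum_nonneg)
  then have bound_v: "norm (c u *\<^sub>R v u) \<le> (1/2) ^ u" for u
    by (rule bound)
  have bound_p: "norm (c u *\<^sub>R p N t (v u)) \<le> (1/2) ^ u" if "N < u" "t \<le> N" for u N t
  proof (rule bound)
    have "norm (p N t (v u)) \<le> (\<Sum>t\<le>N. norm (p N t (v u)))"
      by (rule member_le_sum) (use that in auto)
    also have "\<dots> \<le> (\<Sum>N<u. \<Sum>t\<le>N. norm (p N t (v u)))"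
      by (rule member_le_sum[of N "{..<u}" "\<lambda>N. \<Sum>t\<le>N. norm (p N t (v u))"])
        (use that in \<open>auto intro: sum_nonneg\<close>)
    finally show "norm (p N t (v u)) \<le> d u"
      unfolding d_def using norm_ge_zero[of "v u"] by linarith
  qed
  have geo: "summable (\<lambda>u. (1/2 :: real) ^ u)"
    by (rule summable_geometric) simp
  have summable: "summable (\<lambda>u. c u *\<^sub>R v u)"
    by (rule summable_comparison_test'[OF geo, of 0]) (rule bound_v)
  define h where "h = suminf (\<lambda>u. c u *\<^sub>R v u)"
  have sums_h: "(\<lambda>u. c u *\<^sub>R v u) sums h"
    unfolding h_def using summable by (rule summable_sums)
  have "h \<in> clspan (range v)"
  proof (rule closed_sequentially)
    show "closed (clspan (range v))"
      using closed_cspace_clspan by (rule closed_cspaceD)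
    show "(\<lambda>n. \<Sum>u<n. c u *\<^sub>R v u) \<longlonglongrightarrow> h"
      using sums_h by (simp add: sums_def)
    show "(\<Sum>u<n. c u *\<^sub>R v u) \<in> clspan (range v)" for n
      unfolding scaleR_scaleC
      by (intro closed_cspaceD[OF closed_cspace_clspan] clspan_base) auto
  qed
  moreover have "v t \<in> V" if V: "closed_cspace V" "\<And>N t. p N t h \<in> V" for V t
  proof -
    have est: "norm (p N t h - c t *\<^sub>R v t) \<le> (1/2) ^ N" if "t \<le> N" for N
    proof -
      have "(\<lambda>u. c u *\<^sub>R p N t (v u)) sums p N t h"
        using bounded_linear.sums[OF bounded_clinear_linear[OF p[of N t]] sums_h]
        by (simp add: linear_cmul[OF bounded_linear.linear[OF bounded_clinear_linear[OF p[of N t]]]])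
      then have "(\<lambda>u. c (u + Suc N) *\<^sub>R p N t (v (u + Suc N))) sums
          (p N t h - (\<Sum>u<Suc N. c u *\<^sub>R p N t (v u)))"
        by (rule sums_split_initial_segment)
      also have "(\<Sum>u<Suc N. c u *\<^sub>R p N t (v u)) = (\<Sum>u<Suc N. if u = t then c t *\<^sub>R v t else 0)"
        using that by (intro sum.cong) (auto simp: fixes_t kills)
      also have "\<dots> = c t *\<^sub>R v t"
        using that by simp
      finally have "p N t h - c t *\<^sub>R v t = suminf (\<lambda>u. c (u + Suc N) *\<^sub>R p N t (v (u + Suc N)))"
        by (simp add: sums_iff)
      also have "norm \<dots> \<le> suminf (\<lambda>u. (1/2) ^ (u + Suc N))"
      proof (rule norm_suminf_le)
        show "norm (c (u + Suc N) *\<^sub>R p N t (v (u + Suc N))) \<le> (1/2) ^ (u + Suc N)" for u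
          by (rule bound_p) (use that in auto)
        show "summable (\<lambda>u. (1/2 :: real) ^ (u + Suc N))"
          using geo by (rule summable_ignore_initial_segment)
      qed
      also have "\<dots> = suminf (\<lambda>u. (1/2) ^ u * (1/2) ^ Suc N)"
        by (simp add: power_add)
      also have "\<dots> = suminf (\<lambda>u. (1/2) ^ u) * (1/2) ^ Suc N"
        using geo by (rule suminf_mult2[symmetric])
      also have "\<dots> = (1/2) ^ N"
        by (simp add: suminf_geometric)
      finally show ?thesis .
    qed
    \<comment> \<open>The index N + t meets the condition t \<le> N of the estimate.\<close>
    have "(\<lambda>N. p (N + t) t h - c t *\<^sub>R v t) \<longlonglongrightarrow> 0"
    proof (rule Lim_null_comparison)
      show "\<forall>\<^sub>F N in sequentially. norm (p (N + t) t h - c t *\<^sub>R v t) \<le> (1/2) ^ (N + t)"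
        using est by simp
      show "(\<lambda>N. (1/2 :: real) ^ (N + t)) \<longlonglongrightarrow> 0"
        by (rule LIMSEQ_ignore_initial_segment) (simp add: LIMSEQ_power_zero)
    qed
    then have "(\<lambda>N. p (N + t) t h) \<longlonglongrightarrow> c t *\<^sub>R v t"
      by (simp add: LIM_zero_iff)
    with closed_cspaceD(1)[OF V(1)] V(2) have "c t *\<^sub>R v t \<in> V"
      by (rule closed_sequentially)
    then have "scaleC (of_real (1 / c t)) (c t *\<^sub>R v t) \<in> V"
      by (rule closed_cspaceD(4)[OF V(1)])
    moreover have "scaleC (of_real (1 / c t)) (c t *\<^sub>R v t) = v t"
      unfolding scaleR_scaleC using c_pos[of t] by simp
    ultimately show ?thesis by simp
  qed
  ultimately show ?thesis by blast
qed

section \<open>The rank of a space spanned by jets\<close>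

text \<open>Gaussian elimination: with a pivot m0 in equation s, subtracting multiples of s leaves
  the system L' without the unknown m0, whose value is finally chosen to satisfy s.\<close>

lemma homogeneous_system_nontrivial:
  fixes L :: "'s \<Rightarrow> 'm \<Rightarrow> complex"
  assumes "finite S" "finite M" "card S < card M"
  shows "\<exists>c. (\<exists>m\<in>M. c m \<noteq> 0) \<and> (\<forall>s\<in>S. (\<Sum>m\<in>M. c m * L s m) = 0)"
  using assms
proof (induction S arbitrary: M L rule: finite_induct)
  case empty
  then obtain m where "m \<in> M" by fastforce
  then show ?case by (intro exI[of _ "\<lambda>_. 1"]) auto
next
  case (insert s S)
  show ?case
  proof (cases "\<forall>m\<in>M. L s m = 0")
    case True
    have "card S < card M" using insert by simp
    from insert.IH[OF insert.prems(1) this, of L] show ?thesis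
      using True by auto
  next
    case False
    then obtain m0 where m0: "m0 \<in> M" "L s m0 \<noteq> 0" by blast
    define L' where "L' t m = L t m - L t m0 * L s m / L s m0" for t m
    have "card S < card (M - {m0})"
      using insert m0 by simp
    from insert.IH[OF _ this, of L'] insert.prems(1)
    obtain c where c: "\<exists>m\<in>M - {m0}. c m \<noteq> 0" "\<And>t. t \<in> S \<Longrightarrow> (\<Sum>m\<in>M - {m0}. c m * L' t m) = 0"
      by auto
    define r where "r = (\<Sum>m\<in>M - {m0}. c m * L s m) / L s m0"
    define c' where "c' = c(m0 := - r)"
    have sum: "(\<Sum>m\<in>M. c' m * L t m) = (\<Sum>m\<in>M - {m0}. c m * L t m) - r * L t m0" for t
    proof -
      have "(\<Sum>m\<in>M. c' m * L t m) = - r * L t m0 + (\<Sum>m\<in>M - {m0}. c' m * L t m)"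
        using insert.prems(1) m0 by (simp add: sum.remove[of M m0] c'_def)
      also have "(\<Sum>m\<in>M - {m0}. c' m * L t m) = (\<Sum>m\<in>M - {m0}. c m * L t m)"
        by (rule sum.cong) (auto simp: c'_def)
      finally show ?thesis by simp
    qed
    have "(\<Sum>m\<in>M. c' m * L t m) = 0" if "t \<in> insert s S" for t
    proof (cases "t = s")
      case True
      then show ?thesis unfolding sum using m0 by (simp add: r_def)
    next
      case False
      have "0 = (\<Sum>m\<in>M - {m0}. c m * L t m - L t m0 / L s m0 * (c m * L s m))"
        using c(2)[of t] that False by (simp add: L'_def algebra_simps)
      also have "\<dots> = (\<Sum>m\<in>M - {m0}. c m * L t m) - r * L t m0"
        unfolding sum_subtractf sum_distrib_left[symmetric] r_def by simp
      finally show ?thesis unfolding sum by simp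
    qed
    moreover have "\<exists>m\<in>M. c' m \<noteq> 0"
      using c(1) by (auto simp: c'_def)
    ultimately show ?thesis by blast
  qed
qed

text \<open>The division leaves a zero of order exactly m at \<alpha> and touches no other zero; the
  three claims read these orders off the jets.\<close>

lemma lin_mult_quotient_jet:
  assumes f: "f \<noteq> 0" "\<alpha> \<in> disc" "m \<le> ord1 f \<alpha>" and w: "f = (lin_mult \<alpha> ^^ (ord1 f \<alpha> - m)) w"
  shows "j < m \<Longrightarrow> cinner w (jet \<alpha> j) = 0"
    and "cinner w (jet \<alpha> m) \<noteq> 0"
    and "\<beta> \<in> disc \<Longrightarrow> \<beta> \<noteq> \<alpha> \<Longrightarrow> j < ord1 f \<beta> \<Longrightarrow> cinner w (jet \<beta> j) = 0"
proof -
  define n where "n = ord1 f \<alpha> - m"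
  have w': "f = (lin_mult \<alpha> ^^ n) w"
    using w by (simp add: n_def)
  have eq: "cinner w (jet \<alpha> j) = cinner f (jet \<alpha> (j + n))" for j
    unfolding w' cinner_lin_mult_power_jet[OF f(2)] by simp
  show "cinner w (jet \<alpha> j) = 0" if "j < m"
    unfolding eq using f that by (intro cinner_jet_below_ord1) (auto simp: n_def)
  show "cinner w (jet \<alpha> m) \<noteq> 0"
    using cinner_jet_ord1[OF f(1,2)] f(3) unfolding eq by (simp add: n_def)
  show "cinner w (jet \<beta> j) = 0" if "\<beta> \<in> disc" "\<beta> \<noteq> \<alpha>" "j < ord1 f \<beta>"
  proof -
    have "w \<noteq> 0" using f(1) w' by auto
    have "ord1 f \<beta> = ord1 w \<beta>"
    proof (rule ord1_mult_unit[OF f(1) \<open>\<beta> \<in> disc\<close>, of "\<lambda>z. (z - \<alpha>) ^ n"])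
      show "H1 f z = (z - \<alpha>) ^ n * H1 w z" if "z \<in> disc" for z
        unfolding w' using that by (rule H1_lin_mult_power)
    qed (use that in \<open>auto intro!: analytic_intros\<close>)
    then show ?thesis
      using that \<open>w \<noteq> 0\<close> by (intro cinner_jet_below_ord1) auto
  qed
qed

lemma cinner_bshift: "cinner (bshift x) y = cinner x (shift y)"
  by (subst (1 2) cinner_commute) (simp add: cinner_push)

lemma cinner_tens_upd:
  "cinner (tens (x(i := a))) (tens (y(i := b))) = cinner a b * (\<Prod>l\<in>UNIV - {i}. cinner (x l) (y l))"
proof -
  have "cinner (tens (x(i := a))) (tens (y(i := b))) =
      cinner a b * (\<Prod>l\<in>UNIV - {i}. cinner ((x(i := a)) l) ((y(i := b)) l))"
    unfolding cinner_tens by (subst prod.remove[of UNIV i]) auto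
  also have "(\<Prod>l\<in>UNIV - {i}. cinner ((x(i := a)) l) ((y(i := b)) l)) = (\<Prod>l\<in>UNIV - {i}. cinner (x l) (y l))"
    by (rule prod.cong) auto
  finally show ?thesis .
qed

lemma cinner_adj_minus_tens:
  "cinner (adj_minus i (cnj a) (tens x)) (tens y) = cinner (tens x) (tens (y(i := lin_mult a (y i))))"
proof -
  have "cinner (adj i (tens x)) (tens y) = cinner (tens (x(i := bshift (x i)))) (tens (y(i := y i)))"
    by (simp add: adj_tens)
  moreover have "cinner (tens x) (tens y) = cinner (tens (x(i := x i))) (tens (y(i := y i)))"
    by simp
  moreover have "cinner (tens x) (tens (y(i := lin_mult a (y i)))) =
      cinner (tens (x(i := x i))) (tens (y(i := lin_mult a (y i))))"
    by simp
  ultimately show ?thesis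
    unfolding adj_minus_def cinner_diff_left cinner_scaleC_left cinner_tens_upd
    by (simp only: cinner_bshift lin_mult_def cinner_diff_right cinner_scaleC_right)
      (simp add: algebra_simps)
qed

text \<open>
  In the application \<open>f i\<close> is the least common multiple in the variable \<open>i\<close>; it makes every
  \<open>N \<alpha>\<close> finite and provides the functionals for the lower bound.
\<close>

locale jet_family =
  fixes N :: "('n::finite \<Rightarrow> complex) \<Rightarrow> ('n \<Rightarrow> nat) set" and f :: "'n \<Rightarrow> nat ell2"
  assumes in_disc: "j \<in> N \<alpha> \<Longrightarrow> \<alpha> i \<in> disc"
    and down_closed: "j \<in> N \<alpha> \<Longrightarrow> j' \<le> j \<Longrightarrow> j' \<in> N \<alpha>"
    and countable_points: "countable {\<alpha>. N \<alpha> \<noteq> {}}"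
    and f_nonzero: "f i \<noteq> 0"
    and less_ord1: "j \<in> N \<alpha> \<Longrightarrow> j i < ord1 (f i) (\<alpha> i)"
begin

definition jet_space :: "('n \<Rightarrow> nat) ell2 set" where
  "jet_space = clspan {jetn \<alpha> j | \<alpha> j. j \<in> N \<alpha>}"

definition maximal_orders :: "('n \<Rightarrow> complex) \<Rightarrow> ('n \<Rightarrow> nat) set" where
  "maximal_orders \<alpha> = {m \<in> N \<alpha>. \<forall>j\<in>N \<alpha>. m \<le> j \<longrightarrow> j = m}"

lemma finite_N: "finite (N \<alpha>)"
proof (rule finite_subset)
  show "N \<alpha> \<subseteq> Pi\<^sub>E UNIV (\<lambda>i. {..<ord1 (f i) (\<alpha> i)})"
    using less_ord1 by (auto simp: PiE_UNIV_domain)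
qed (auto intro: finite_PiE)

lemma finite_maximal_orders: "finite (maximal_orders \<alpha>)"
  by (rule finite_subset[OF _ finite_N]) (auto simp: maximal_orders_def)

lemma le_maximal_order: "j \<in> N \<alpha> \<Longrightarrow> \<exists>m\<in>maximal_orders \<alpha>. j \<le> m"
  using finite_has_maximal2[OF finite_N] unfolding maximal_orders_def by blast

lemma jetn_mem: "j \<in> N \<alpha> \<Longrightarrow> jetn \<alpha> j \<in> jet_space"
  unfolding jet_space_def by (intro clspan_base) blast

lemma closed_cspace_jet_space: "closed_cspace jet_space"
  unfolding jet_space_def by (rule closed_cspace_clspan)

lemma invariant_jet_space: "invariant jet_space"
proof -
  have "adj i ` jet_space \<subseteq> jet_space" for i
    unfolding jet_space_def
  proof (rule clspan_image_subset[OF bounded_clinear_adj closed_cspace_clspan], fold jet_space_def, safe)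
    fix \<alpha> j assume j: "j \<in> N \<alpha>"
    have "adj i (jetn \<alpha> j) = adj_minus i (cnj (\<alpha> i)) (jetn \<alpha> j) + scaleC (cnj (\<alpha> i)) (jetn \<alpha> j)"
      by (simp add: adj_minus_def)
    also have "\<dots> \<in> jet_space"
    proof (intro closed_cspaceD[OF closed_cspace_jet_space] jetn_mem j)
      have "j(i := j i - 1) \<in> N \<alpha>"
        by (rule down_closed[OF j]) (auto simp: le_fun_def)
      then show "adj_minus i (cnj (\<alpha> i)) (jetn \<alpha> j) \<in> jet_space"
        using in_disc[OF j] closed_cspaceD(2)[OF closed_cspace_jet_space]
        by (subst adj_minus_jetn) (auto intro: jetn_mem simp del: mem_ball)
    qed
    finally show "adj i (jetn \<alpha> j) \<in> jet_space" .
  qed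
  then show ?thesis
    using closed_cspace_jet_space by (auto simp: invariant_def closed_cspace_def)
qed

text \<open>One vanishing slot suffices. If \<beta> \<noteq> \<alpha>, a coordinate differs and
  there the quotient keeps the order of \<open>f i\<close> at \<beta>, which exceeds
  \<open>j i\<close>; if \<beta> = \<alpha>, some \<open>j i\<close> lies below the order
  \<open>e i\<close> left at \<alpha>.\<close>

lemma tens_quotient_orthogonal:
  assumes \<alpha>: "\<And>i. \<alpha> i \<in> disc" and e: "\<And>i. e i \<le> ord1 (f i) (\<alpha> i)"
    and w: "\<And>i. f i = (lin_mult (\<alpha> i) ^^ (ord1 (f i) (\<alpha> i) - e i)) (w i)"
    and j: "j \<in> N \<beta>" "\<not> (\<beta> = \<alpha> \<and> e \<le> j)"
  shows "cinner (tens w) (jetn \<beta> j) = 0"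
proof -
  note q = lin_mult_quotient_jet[OF f_nonzero \<alpha> e w]
  have "\<exists>i. cinner (w i) (jet (\<beta> i) (j i)) = 0"
  proof (cases "\<beta> = \<alpha>")
    case True
    with j obtain i where "j i < e i" by (auto simp: le_fun_def not_le)
    then show ?thesis using q(1) True by blast
  next
    case False
    then obtain i where "\<beta> i \<noteq> \<alpha> i" by blast
    then show ?thesis using q(3) in_disc[OF j(1)] less_ord1[OF j(1)] by blast
  qed
  then show ?thesis
    unfolding jetn_def cinner_tens by auto
qed

text \<open>
  The vectors \<open>g m\<close>, \<open>m\<close> a maximal order at \<open>\<alpha>\<close>, are joint eigenvectors modulo the complement of
  the jet space, so they separate fewer than \<open>card (maximal_orders \<alpha>)\<close> generators from the rest.
\<close>

lemma ecard_maximal_orders_le: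
  assumes S: "S \<subseteq> jet_space" "gen S = jet_space" and ne: "N \<alpha> \<noteq> {}"
  shows "ecard (maximal_orders \<alpha>) \<le> ecard S"
proof (rule ccontr)
  assume less: "\<not> ecard (maximal_orders \<alpha>) \<le> ecard S"
  then have fin: "finite S" and card: "card S < card (maximal_orders \<alpha>)"
    using finite_maximal_orders by (auto simp: ecard_def split: if_splits)
  have \<alpha>: "\<alpha> i \<in> disc" for i using ne in_disc by blast
  define L where "L i = ord1 (f i) (\<alpha> i)" for i
  have "\<forall>i m. \<exists>u. m \<le> L i \<longrightarrow> f i = (lin_mult (\<alpha> i) ^^ (L i - m)) u"
    using lin_mult_power_factor[OF f_nonzero \<alpha>] by (metis L_def diff_le_self)
  then obtain u where u: "\<And>i m. m \<le> L i \<Longrightarrow> f i = (lin_mult (\<alpha> i) ^^ (L i - m)) (u i m)"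
    by metis
  define g where "g m = tens (\<lambda>i. u i (m i))" for m
  have max_le: "m i < L i" if "m \<in> maximal_orders \<alpha>" for m i
    using that less_ord1 by (auto simp: maximal_orders_def L_def)
  have g_orth: "cinner (g m) (jetn \<alpha> m') = 0" if "m \<in> maximal_orders \<alpha>" "m' \<in> maximal_orders \<alpha>" "m \<noteq> m'" for m m'
    unfolding g_def
  proof (rule tens_quotient_orthogonal[OF \<alpha>, of m])
    show "m i \<le> ord1 (f i) (\<alpha> i)" for i
      using max_le[OF that(1), of i] by (simp add: L_def)
    show "f i = (lin_mult (\<alpha> i) ^^ (ord1 (f i) (\<alpha> i) - m i)) (u i (m i))" for i
      using u[of "m i" i] max_le[OF that(1), of i] by (simp add: L_def)
    show "m' \<in> N \<alpha>" "\<not> (\<alpha> = \<alpha> \<and> m \<le> m')"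
      using that by (auto simp: maximal_orders_def)
  qed
  have g_diag: "cinner (g m) (jetn \<alpha> m) \<noteq> 0" if "m \<in> maximal_orders \<alpha>" for m
  proof -
    have "cinner (u i (m i)) (jet (\<alpha> i) (m i)) \<noteq> 0" for i
      by (rule lin_mult_quotient_jet(2)[OF f_nonzero \<alpha>, of "m i" i])
        (use u[of "m i" i] max_le[OF that, of i] in \<open>auto simp: L_def\<close>)
    then show ?thesis by (simp add: g_def jetn_def cinner_tens)
  qed
  have g_eigen: "cinner (adj_minus i (cnj (\<alpha> i)) x) (g m) = 0"
    if m: "m \<in> maximal_orders \<alpha>" and x: "x \<in> jet_space" for m i x
  proof -
    have "adj_minus i (cnj (\<alpha> i)) ` jet_space \<subseteq> {y. \<forall>z\<in>{g m}. cinner y z = 0}"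
      unfolding jet_space_def
    proof (rule clspan_image_subset[OF adj_polyD(1)[OF adj_poly_adj_minus] closed_cspace_orthogonal], safe)
      fix \<beta> j assume j: "j \<in> N \<beta>"
      \<comment> \<open>Moving \<open>adj_minus\<close> to the other side multiplies slot i by z -
        \<alpha>, which raises its order by one; since m is maximal, no order at \<alpha> dominates
        e.\<close>
      define e where "e = m(i := Suc (m i))"
      define w where "w = (\<lambda>l. u l (m l))(i := lin_mult (\<alpha> i) (u i (m i)))"
      have "cinner (tens w) (jetn \<beta> j) = 0"
      proof (rule tens_quotient_orthogonal[OF \<alpha>, of e])
        show "e l \<le> ord1 (f l) (\<alpha> l)" for l
          using max_le[OF m, of l] max_le[OF m, of i] by (auto simp: L_def e_def)
        show "f l = (lin_mult (\<alpha> l) ^^ (ord1 (f l) (\<alpha> l) - e l)) (w l)" for l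
        proof (cases "l = i")
          case True
          have "L i - m i = Suc (L i - Suc (m i))"
            using max_le[OF m, of i] by simp
          then have "f i = (lin_mult (\<alpha> i) ^^ Suc (L i - Suc (m i))) (u i (m i))"
            using u[of "m i" i] max_le[OF m, of i] by simp
          then show ?thesis
            using True by (simp add: e_def w_def L_def funpow_swap1)
        next
          case False
          then show ?thesis
            using u[of "m l" l] max_le[OF m, of l] by (simp add: e_def w_def L_def)
        qed
        have "\<not> e \<le> j" if "\<beta> = \<alpha>"
        proof
          assume "e \<le> j"
          then have "e \<in> N \<alpha>" using down_closed j that by blast
          moreover have "m \<le> e" "e \<noteq> m" by (auto simp: e_def le_fun_def fun_eq_iff)
          ultimately show False using m by (auto simp: maximal_orders_def)
        qed
        then show "\<not> (\<beta> = \<alpha> \<and> e \<le> j)" by blast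
      qed (rule j)
      then have "cinner (jetn \<beta> j) (tens w) = 0"
        by (subst cinner_commute) simp
      then show "cinner (adj_minus i (cnj (\<alpha> i)) (jetn \<beta> j)) (g m) = 0"
        unfolding g_def jetn_def cinner_adj_minus_tens w_def .
    qed
    with x show ?thesis by blast
  qed
  obtain c where c: "\<exists>m\<in>maximal_orders \<alpha>. c m \<noteq> 0"
    "\<And>h. h \<in> S \<Longrightarrow> (\<Sum>m\<in>maximal_orders \<alpha>. c m * cinner h (g m)) = 0"
    using homogeneous_system_nontrivial[OF fin finite_maximal_orders card, of "\<lambda>h m. cinner h (g m)"]
    by auto
  \<comment> \<open>The conjugates compensate for conjugate linearity in the second argument; G
    becomes orthogonal to S.\<close>
  define G where "G = (\<Sum>m\<in>maximal_orders \<alpha>. scaleC (cnj (c m)) (g m))"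
  have G: "cinner x G = (\<Sum>m\<in>maximal_orders \<alpha>. c m * cinner x (g m))" for x
    by (simp add: G_def cinner_sum_right)
  \<comment> \<open>On the jet space each adjoint shift scales the pairing with G by
    \<open>cnj (\<alpha> i)\<close>, so V is invariant. It contains S, hence the whole jet space,
    yet the pairing with some jet is nonzero.\<close>
  define V where "V = jet_space \<inter> {x. \<forall>y\<in>{G}. cinner x y = 0}"
  have V: "closed_cspace V"
    using closed_cspace_jet_space closed_cspace_orthogonal[of "{G}"]
    unfolding V_def closed_cspace_def by (auto intro: cvec.subspace_inter)
  have "invariant V"
    unfolding invariant_def
  proof (intro conjI allI ballI)
    fix i x assume x: "x \<in> V"
    then have xQ: "x \<in> jet_space" by (simp add: V_def)
    have "cinner (adj i x) G = cinner (adj_minus i (cnj (\<alpha> i)) x) G + cnj (\<alpha> i) * cinner x G"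
      by (simp add: adj_minus_def cinner_diff_left)
    also have "\<dots> = 0"
      using x g_eigen[OF _ xQ] by (simp add: V_def G)
    finally show "adj i x \<in> V"
      using invariant_jet_space xQ by (simp add: V_def invariant_def)
  qed (use V in \<open>simp add: closed_cspace_def\<close>)
  then have "gen S \<subseteq> V"
    using S c(2) closed_cspaceD(1)[OF V] by (intro gen_minimal) (auto simp: V_def G)
  then have orth: "cinner x G = 0" if "x \<in> jet_space" for x
    using S(2) that by (auto simp: V_def)
  obtain m0 where m0: "m0 \<in> maximal_orders \<alpha>" "c m0 \<noteq> 0"
    using c(1) by blast
  have "cinner (jetn \<alpha> m0) G = (\<Sum>m\<in>maximal_orders \<alpha>. if m = m0 then c m0 * cinner (jetn \<alpha> m0) (g m0) else 0)"
    unfolding G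
  proof (rule sum.cong[OF refl])
    fix m assume "m \<in> maximal_orders \<alpha>"
    then show "c m * cinner (jetn \<alpha> m0) (g m) = (if m = m0 then c m0 * cinner (jetn \<alpha> m0) (g m0) else 0)"
      using g_orth[of m m0] m0 cinner_commute[of "jetn \<alpha> m0" "g m"] by auto
  qed
  also have "\<dots> = c m0 * cinner (jetn \<alpha> m0) (g m0)"
    using m0 finite_maximal_orders by simp
  also have "\<dots> \<noteq> 0"
    using m0 g_diag[OF m0(1)] cinner_commute[of "jetn \<alpha> m0" "g m0"] by simp
  finally show False
    using orth m0 jetn_mem by (auto simp: maximal_orders_def)
qed

text \<open>The chosen jets are listed along an enumeration of the countably many points, and the
  isolating polynomials feed \<open>exists_common_generator\<close>. A single h thus serves one
  order at every point.\<close>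

lemma exists_joint_generator:
  fixes m :: "('n \<Rightarrow> complex) \<Rightarrow> 'n \<Rightarrow> nat"
  assumes m: "\<And>\<alpha>. N \<alpha> \<noteq> {} \<Longrightarrow> m \<alpha> \<in> N \<alpha>"
  shows "\<exists>h\<in>jet_space. \<forall>V. closed_cspace V \<longrightarrow> invariant V \<longrightarrow> h \<in> V \<longrightarrow>
    (\<forall>\<alpha>. N \<alpha> \<noteq> {} \<longrightarrow> jetn \<alpha> (m \<alpha>) \<in> V)"
proof -
  define P where "P = {\<alpha>. N \<alpha> \<noteq> {}}"
  define I where "I = to_nat_on P ` P"
  define pt where "pt = from_nat_into P"
  have pt: "pt u \<in> P" "to_nat_on P (pt u) = u" if "u \<in> I" for u
  proof -
    have P: "countable P" using countable_points by (simp add: P_def)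
    obtain \<alpha> where "\<alpha> \<in> P" "u = to_nat_on P \<alpha>" using \<open>u \<in> I\<close> by (auto simp: I_def)
    with P show "pt u \<in> P" "to_nat_on P (pt u) = u" by (simp_all add: pt_def)
  qed
  define v where "v u = (if u \<in> I then jetn (pt u) (m (pt u)) else 0)" for u
  have ex: "\<exists>p. adj_poly p \<and> (t \<le> n \<longrightarrow> p (v t) = v t \<and> (\<forall>u\<le>n. u \<noteq> t \<longrightarrow> p (v u) = 0))" for n t
  proof (cases "t \<in> I")
    case False
    then show ?thesis
      using adj_poly_zero by (intro exI[of _ "\<lambda>x. 0"]) (auto simp: v_def)
  next
    case True
    \<comment> \<open>Larger than every coordinate of the finitely many orders involved, so one k
      serves all root spaces; the maximum covers t > n as well.\<close>
    define k where "k = Suc (\<Sum>u\<le>max n t. \<Sum>i\<in>UNIV. m (pt u) i)"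
    have k: "m (pt u) i < k" if "u \<le> max n t" for u i
    proof -
      have "m (pt u) i \<le> (\<Sum>i\<in>UNIV. m (pt u) i)"
        by (rule member_le_sum) auto
      also have "\<dots> \<le> (\<Sum>u\<le>max n t. \<Sum>i\<in>UNIV. m (pt u) i)"
        using that by (intro member_le_sum[of u "{..max n t}" "\<lambda>u. \<Sum>i\<in>UNIV. m (pt u) i"]) auto
      finally show ?thesis by (simp add: k_def)
    qed
    define X where "X = pt ` ({u\<in>I. u \<le> n} - {t})"
    have disc: "\<beta> i \<in> disc" if "\<beta> \<in> P" for \<beta> i
      using that in_disc by (auto simp: P_def simp del: mem_ball)
    have "finite X" by (simp add: X_def)
    moreover have "pt t \<notin> X"
      using pt(2) True by (auto simp: X_def) metis
    moreover have "\<beta> i \<in> disc" if "\<beta> \<in> X" for \<beta> i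
      using that pt(1) disc by (auto simp: X_def simp del: mem_ball)
    ultimately obtain p where p: "adj_poly p"
      "\<forall>j. (\<forall>i. j i < k) \<longrightarrow> p (jetn (pt t) j) = jetn (pt t) j \<and> (\<forall>\<beta>\<in>X. p (jetn \<beta> j) = 0)"
      using exists_isolating_adj_poly[of X "pt t" k] disc[OF pt(1)[OF True]] by blast
    have "p (v t) = v t"
      using p(2) k[of t] True by (simp add: v_def)
    moreover have "p (v u) = 0" if "u \<le> n" "u \<noteq> t" for u
    proof (cases "u \<in> I")
      case True
      then have "pt u \<in> X" using that by (auto simp: X_def)
      then show ?thesis
        using p(2) k[of u] that True by (simp add: v_def)
    next
      case False
      then show ?thesis
        using bounded_clinear_zero[OF adj_polyD(1)[OF p(1)]] by (simp add: v_def)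
    qed
    ultimately show ?thesis using p(1) by blast
  qed
  define p where
    "p n t = (SOME p. adj_poly p \<and> (t \<le> n \<longrightarrow> p (v t) = v t \<and> (\<forall>u\<le>n. u \<noteq> t \<longrightarrow> p (v u) = 0)))" for n t
  have p: "adj_poly (p n t) \<and> (t \<le> n \<longrightarrow> p n t (v t) = v t \<and> (\<forall>u\<le>n. u \<noteq> t \<longrightarrow> p n t (v u) = 0))" for n t
    unfolding p_def by (rule someI_ex[OF ex[of t n]])
  obtain h where h: "h \<in> clspan (range v)"
    "\<And>V. closed_cspace V \<Longrightarrow> \<forall>n t. p n t h \<in> V \<Longrightarrow> range v \<subseteq> V"
    using exists_common_generator[of p v] adj_polyD(1) p by metis
  have "range v \<subseteq> jet_space"
    using pt(1) m closed_cspaceD(2)[OF closed_cspace_jet_space] by (auto simp: v_def P_def intro!: jetn_mem)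
  then have "h \<in> jet_space"
    using h(1) clspan_minimal closed_cspace_jet_space by blast
  moreover have "jetn \<alpha> (m \<alpha>) \<in> V" if "closed_cspace V" "invariant V" "h \<in> V" "N \<alpha> \<noteq> {}" for V \<alpha>
  proof -
    have "range v \<subseteq> V"
      using h(2)[OF that(1)] adj_polyD(2)[OF conjunct1[OF p] that(2,3)] by blast
    moreover have "v (to_nat_on P \<alpha>) = jetn \<alpha> (m \<alpha>)"
      using that(4) countable_points by (simp add: v_def I_def pt_def P_def)
    ultimately show ?thesis by (metis rangeI subsetD)
  qed
  ultimately show ?thesis by blast
qed

text \<open>Each point alone forces as many generators as it has maximal orders. Conversely, joint
  generators serve all points at once, so the largest of these numbers is enough.\<close>

theorem rank_jet_space:
  "Inf {ecard S | S. S \<subseteq> jet_space \<and> gen S = jet_space} =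
   (SUP \<alpha>\<in>{\<alpha>. N \<alpha> \<noteq> {}}. ecard (maximal_orders \<alpha>))" (is "?rank = ?R")
proof (rule antisym)
  show "?R \<le> ?rank"
    by (intro SUP_least Inf_greatest) (use ecard_maximal_orders_le in blast)
  have gen_eqI: "gen S = jet_space"
    if S: "S \<subseteq> jet_space" and max: "\<And>\<alpha> m. m \<in> maximal_orders \<alpha> \<Longrightarrow> jetn \<alpha> m \<in> gen S" for S
  proof
    show "gen S \<subseteq> jet_space"
      using S invariant_jet_space closed_cspaceD(1)[OF closed_cspace_jet_space] by (rule gen_minimal)
    show "jet_space \<subseteq> gen S"
      unfolding jet_space_def
    proof (rule clspan_minimal, safe)
      fix \<alpha> j assume j: "j \<in> N \<alpha>"
      then obtain m where "m \<in> maximal_orders \<alpha>" "j \<le> m"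
        using le_maximal_order by blast
      then show "jetn \<alpha> j \<in> gen S"
        using jetn_mem_mono[where \<alpha> = \<alpha>, OF in_disc[OF j] invariant_gen max] by blast
    qed (simp add: gen_def closed_cspace_clspan)
  qed
  show "?rank \<le> ?R"
  proof (cases ?R)
    case (enat r)
    have card_le: "card (maximal_orders \<alpha>) \<le> r" if "N \<alpha> \<noteq> {}" for \<alpha>
    proof -
      have "ecard (maximal_orders \<alpha>) \<le> enat r"
        unfolding enat[symmetric] by (rule SUP_upper) (use that in simp)
      then show ?thesis
        using finite_maximal_orders by (simp add: ecard_def)
    qed
    \<comment> \<open>The list of maximal orders is padded to length r by an arbitrary order, so
      that every generator has something to carry at every point.\<close>
    have "\<exists>e. maximal_orders \<alpha> \<subseteq> e ` {..<r} \<and> e ` {..<r} \<subseteq> N \<alpha>" if "N \<alpha> \<noteq> {}" for \<alpha>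
    proof -
      obtain e where e: "bij_betw e {0..<card (maximal_orders \<alpha>)} (maximal_orders \<alpha>)"
        using ex_bij_betw_nat_finite[OF finite_maximal_orders] by blast
      obtain j where "j \<in> N \<alpha>" using \<open>N \<alpha> \<noteq> {}\<close> by blast
      define e' where "e' s = (if s < card (maximal_orders \<alpha>) then e s else j)" for s
      have "maximal_orders \<alpha> \<subseteq> e' ` {..<r}"
      proof
        fix m assume "m \<in> maximal_orders \<alpha>"
        then have "m \<in> e ` {0..<card (maximal_orders \<alpha>)}"
          using e by (simp add: bij_betw_def)
        then obtain s where "s < card (maximal_orders \<alpha>)" "m = e s" by auto
        then show "m \<in> e' ` {..<r}"
          using card_le[OF \<open>N \<alpha> \<noteq> {}\<close>] by (intro image_eqI[of _ _ s]) (auto simp: e'_def)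
      qed
      moreover have "e' ` {..<r} \<subseteq> N \<alpha>"
        using e \<open>j \<in> N \<alpha>\<close> by (auto simp: e'_def bij_betw_def maximal_orders_def)
      ultimately show ?thesis by blast
    qed
    then obtain e where e: "\<And>\<alpha>. N \<alpha> \<noteq> {} \<Longrightarrow> maximal_orders \<alpha> \<subseteq> e \<alpha> ` {..<r}"
      "\<And>\<alpha>. N \<alpha> \<noteq> {} \<Longrightarrow> e \<alpha> ` {..<r} \<subseteq> N \<alpha>"
      by metis
    have "\<exists>h\<in>jet_space. \<forall>V. closed_cspace V \<longrightarrow> invariant V \<longrightarrow> h \<in> V \<longrightarrow>
        (\<forall>\<alpha>. N \<alpha> \<noteq> {} \<longrightarrow> jetn \<alpha> (e \<alpha> s) \<in> V)" if "s < r" for s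
      by (rule exists_joint_generator) (use e(2) that in blast)
    then obtain h where h: "\<And>s. s < r \<Longrightarrow> h s \<in> jet_space"
      "\<And>s V \<alpha>. s < r \<Longrightarrow> closed_cspace V \<Longrightarrow> invariant V \<Longrightarrow> h s \<in> V \<Longrightarrow> N \<alpha> \<noteq> {} \<Longrightarrow> jetn \<alpha> (e \<alpha> s) \<in> V"
      by metis
    define S where "S = h ` {..<r}"
    have S: "S \<subseteq> jet_space"
      using h(1) by (auto simp: S_def)
    have "gen S = jet_space"
    proof (rule gen_eqI[OF S])
      fix \<alpha> m assume m: "m \<in> maximal_orders \<alpha>"
      then have ne: "N \<alpha> \<noteq> {}" by (auto simp: maximal_orders_def)
      with m e(1) obtain s where s: "s < r" "m = e \<alpha> s" by blast
      have "h s \<in> gen S"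
        using gen_superset[of S] s by (auto simp: S_def)
      then show "jetn \<alpha> m \<in> gen S"
        unfolding s(2) using h(2)[OF s(1) _ invariant_gen] ne
        by (simp add: gen_def closed_cspace_clspan)
    qed
    with S have "?rank \<le> ecard S"
      by (intro Inf_lower) blast
    also have "ecard S \<le> enat r"
      using card_image_le[of "{..<r}" h] by (simp add: ecard_def S_def)
    finally show ?thesis using enat by simp
  qed simp
qed

end

section \<open>Blaschke factors as divisors\<close>

lemma ord1_pos_iff:
  assumes "p \<noteq> 0" "\<alpha> \<in> disc"
  shows "0 < ord1 p \<alpha> \<longleftrightarrow> H1 p \<alpha> = 0"
  using cinner_jet_ord1[OF assms] cinner_jet_below_ord1[OF assms] cinner_jet_0[OF assms(2), of p]
  by (metis gr0I)

lemma cmod_blaschke_factor_cis: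
  assumes "\<alpha> \<in> disc"
  shows "cmod (blaschke_factor \<alpha> (cis t)) = 1"
proof -
  have "cis t * cnj (cis t - \<alpha>) = 1 - cnj \<alpha> * cis t"
    by (simp add: algebra_simps complex_norm_square[symmetric] flip: power2_eq_square)
  then have "cmod (1 - cnj \<alpha> * cis t) = cmod (cis t - \<alpha>)"
    by (metis complex_mod_cnj mult_1 norm_cis norm_mult)
  then show ?thesis
    using blaschke_denominator_nonzero[OF assms, of "cis t"]
    unfolding blaschke_factor_def norm_divide by (metis divide_self_if norm_cis norm_eq_zero order_refl)
qed

text \<open>The cofactor h is inner: away from \<alpha> it is bounded by 1 through
  \<open>cmod_blaschke_le\<close>, and its radial limits are those of \<phi> divided by values of
  the Blaschke factor on the circle, which have modulus 1.\<close>

lemma inner_dvd_blaschke_factor_iff: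
  assumes fac: "blaschke_factorization \<phi> A l" and inner: "inner_function \<phi>" and \<alpha>: "\<alpha> \<in> disc"
  shows "inner_dvd (blaschke_factor \<alpha>) \<phi> \<longleftrightarrow> \<phi> \<alpha> = 0"
proof
  assume "inner_dvd (blaschke_factor \<alpha>) \<phi>"
  then show "\<phi> \<alpha> = 0"
    using \<alpha> by (auto simp: inner_dvd_def blaschke_factor_def)
next
  assume zero: "\<phi> \<alpha> = 0"
  then have "\<alpha> \<in> A" using blaschke_zero_iff[OF fac \<alpha>] by simp
  obtain p where p: "p \<noteq> 0" "\<And>z. z \<in> disc \<Longrightarrow> H1 p z = \<phi> z"
    by (rule blaschke_hardy[OF fac]) blast
  obtain u where u: "p = lin_mult \<alpha> u"
    using lin_mult_eqI_zero[OF \<alpha>, of p] p(2)[OF \<alpha>] zero by auto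
  define h where "h z = (1 - cnj \<alpha> * z) * H1 u z" for z
  have eq: "\<phi> z = blaschke_factor \<alpha> z * h z" if "z \<in> disc" for z
    using p(2)[OF that] that blaschke_denominator_nonzero[OF \<alpha>, of z]
    by (simp add: u H1_lin_mult h_def blaschke_factor_def)
  have "inner_function h"
    unfolding inner_function_def
  proof (intro conjI)
    show "h holomorphic_on disc"
      unfolding h_def by (intro holomorphic_intros H1_holomorphic)
    have "cmod (h z) \<le> 1" if z: "z \<in> disc" "z \<noteq> \<alpha>" for z
    proof -
      have b: "blaschke_factor \<alpha> z \<noteq> 0"
        using blaschke_factor_zero_iff[OF \<alpha> z(1)] z(2) by simp
      have "cmod (blaschke_factor \<alpha> z) * cmod (h z) = cmod (\<phi> z)"
        using eq[OF z(1)] by (simp add: norm_mult)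
      also have "\<dots> \<le> cmod (blaschke_factor \<alpha> z) ^ l \<alpha>"
        by (rule cmod_blaschke_le[OF fac \<open>\<alpha> \<in> A\<close> z(1)])
      also have "\<dots> \<le> cmod (blaschke_factor \<alpha> z) ^ 1"
        using blaschke_mult_pos[OF fac \<open>\<alpha> \<in> A\<close>] cmod_blaschke_factor_le[OF \<alpha> z(1)]
        by (intro power_decreasing) auto
      finally show ?thesis using b by simp
    qed
    \<comment> \<open>The estimate divides by the Blaschke factor, so the value at its zero \<alpha>
      is adjoined separately.\<close>
    then have "h z \<in> insert (h \<alpha>) (cball 0 1)" if "z \<in> disc" for z
      using that by (cases "z = \<alpha>") auto
    then have "h ` disc \<subseteq> insert (h \<alpha>) (cball 0 1)" by blast
    then show "bounded (h ` disc)"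
      by (rule bounded_subset[rotated]) simp
    have "AE t in lborel. \<exists>w. cmod w = 1 \<and> ((\<lambda>r. \<phi> (of_real r * cis t)) \<longlongrightarrow> w) (at_left 1)"
      using inner by (simp add: inner_function_def)
    then show "AE t in lborel. \<exists>w. cmod w = 1 \<and> ((\<lambda>r. h (of_real r * cis t)) \<longlongrightarrow> w) (at_left 1)"
    proof (rule eventually_mono)
      fix t
      assume "\<exists>w. cmod w = 1 \<and> ((\<lambda>r. \<phi> (of_real r * cis t)) \<longlongrightarrow> w) (at_left 1)"
      then obtain w where w: "cmod w = 1" "((\<lambda>r. \<phi> (of_real r * cis t)) \<longlongrightarrow> w) (at_left 1)" by blast
      have "((\<lambda>r. (of_real r * cis t - \<alpha>) / (1 - cnj \<alpha> * (of_real r * cis t))) \<longlongrightarrow>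
          (of_real 1 * cis t - \<alpha>) / (1 - cnj \<alpha> * (of_real 1 * cis t))) (at_left 1)"
        using blaschke_denominator_nonzero[OF \<alpha>, of "cis t"] by (intro tendsto_intros) auto
      then have b: "((\<lambda>r. blaschke_factor \<alpha> (of_real r * cis t)) \<longlongrightarrow> blaschke_factor \<alpha> (cis t)) (at_left 1)"
        by (simp add: blaschke_factor_def)
      have b_nz: "blaschke_factor \<alpha> (cis t) \<noteq> 0"
        using cmod_blaschke_factor_cis[OF \<alpha>, of t] by auto
      have "((\<lambda>r. \<phi> (of_real r * cis t) / blaschke_factor \<alpha> (of_real r * cis t)) \<longlongrightarrow>
          w / blaschke_factor \<alpha> (cis t)) (at_left 1)"
        by (intro tendsto_divide w b b_nz)
      \<comment> \<open>Radii above \<open>cmod \<alpha>\<close> avoid the zero of the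
        denominator.\<close>
      moreover have "\<forall>\<^sub>F r in at_left (1::real). r \<in> {cmod \<alpha><..<1}"
        by (rule eventually_at_leftI[of "cmod \<alpha>"]) (use \<alpha> in auto)
      then have "\<forall>\<^sub>F r in at_left 1.
          \<phi> (of_real r * cis t) / blaschke_factor \<alpha> (of_real r * cis t) = h (of_real r * cis t)"
      proof eventually_elim
        case (elim r)
        have r: "cmod (of_real r * cis t) = r"
          using elim norm_ge_zero[of \<alpha>] by (simp add: norm_mult del: norm_ge_zero)
        then have z: "of_real r * cis t \<in> disc" "of_real r * cis t \<noteq> \<alpha>"
          using elim by auto
        then show ?case
          using eq[OF z(1)] blaschke_factor_zero_iff[OF \<alpha> z(1)] by simp
      qed
      ultimately have "((\<lambda>r. h (of_real r * cis t)) \<longlongrightarrow> w / blaschke_factor \<alpha> (cis t)) (at_left 1)"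
        by (rule Lim_transform_eventually)
      moreover have "cmod (w / blaschke_factor \<alpha> (cis t)) = 1"
        by (simp add: norm_divide w(1) cmod_blaschke_factor_cis[OF \<alpha>])
      ultimately show "\<exists>w. cmod w = 1 \<and> ((\<lambda>r. h (of_real r * cis t)) \<longlongrightarrow> w) (at_left 1)" by blast
    qed
  qed
  then show "inner_dvd (blaschke_factor \<alpha>) \<phi>"
    unfolding inner_dvd_def using eq by blast
qed

lemma inner_dvd_ord1_le:
  assumes "inner_dvd \<phi> \<psi>" and p: "\<And>z. z \<in> disc \<Longrightarrow> H1 p z = \<phi> z"
    and f: "f \<noteq> 0" "\<And>z. z \<in> disc \<Longrightarrow> H1 f z = \<psi> z" and \<alpha>: "\<alpha> \<in> disc"
  shows "ord1 p \<alpha> \<le> ord1 f \<alpha>"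
proof -
  obtain h where h: "inner_function h" "\<And>z. z \<in> disc \<Longrightarrow> \<psi> z = \<phi> z * h z"
    using assms(1) by (auto simp: inner_dvd_def simp del: mem_ball)
  have "h analytic_on {\<alpha>}"
    using h(1) \<alpha> unfolding inner_function_def by (meson analytic_at open_ball)
  then show ?thesis
    by (rule ord1_mult_ge[OF f(1) \<alpha>]) (use h(2) p f(2) in \<open>simp add: mult.commute del: mem_ball\<close>)
qed

lemma prime_part_power:
  assumes "\<alpha> \<in> disc" "l \<ge> 1"
  shows "prime_part (\<lambda>z. blaschke_factor \<alpha> z ^ l) = blaschke_factor \<alpha>"
  unfolding prime_part_def
proof (rule the_equality)
  show "\<exists>\<beta>\<in>disc. \<exists>m\<ge>1. blaschke_factor \<alpha> = blaschke_factor \<beta> \<and>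
      (\<lambda>z. blaschke_factor \<alpha> z ^ l) = (\<lambda>z. blaschke_factor \<beta> z ^ m)"
    using assms by blast
next
  fix b
  assume "\<exists>\<beta>\<in>disc. \<exists>m\<ge>1. b = blaschke_factor \<beta> \<and>
      (\<lambda>z. blaschke_factor \<alpha> z ^ l) = (\<lambda>z. blaschke_factor \<beta> z ^ m)"
  then obtain \<beta> m where *: "\<beta> \<in> disc" "m \<ge> 1" "b = blaschke_factor \<beta>"
    "(\<lambda>z. blaschke_factor \<alpha> z ^ l) = (\<lambda>z. blaschke_factor \<beta> z ^ m)" by blast
  then have "\<alpha> = \<beta>"
    using blaschke_factor_inject[OF assms(1) *(1) assms(2) *(2)] by (simp add: fun_eq_iff)
  with * show "b = blaschke_factor \<alpha>" by simp
qed

lemma blaschke_ord_eq_ord1: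
  assumes \<alpha>: "\<alpha> \<in> disc" and p: "\<And>z. z \<in> disc \<Longrightarrow> H1 p z = \<phi> z"
  shows "blaschke_ord \<phi> (blaschke_factor \<alpha>) = ord1 p \<alpha>"
proof -
  have "(THE \<beta>. \<beta> \<in> disc \<and> blaschke_factor \<alpha> = blaschke_factor \<beta>) = \<alpha>"
  proof (rule the_equality)
    fix \<beta> assume \<beta>: "\<beta> \<in> disc \<and> blaschke_factor \<alpha> = blaschke_factor \<beta>"
    then have "\<alpha> = \<beta>"
      by (intro blaschke_factor_inject[OF \<alpha>, of \<beta> 1 1]) auto
    then show "\<beta> = \<alpha>" ..
  qed (use \<alpha> in simp)
  moreover have "zorder \<phi> \<alpha> = zorder (H1 p) \<alpha>"
  proof (rule zorder_cong)
    show "\<forall>\<^sub>F z in at \<alpha>. \<phi> z = H1 p z"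
      using eventually_at_in_open[OF open_ball \<alpha>] by eventually_elim (use p in auto)
  qed simp
  ultimately show ?thesis
    by (simp add: blaschke_ord_def ord1_def)
qed

lemma blaschke_factorization_power:
  assumes "\<alpha> \<in> disc" "n \<ge> 1"
  shows "blaschke_factorization (\<lambda>z. blaschke_factor \<alpha> z ^ n) {\<alpha>} (\<lambda>_. n)"
  unfolding blaschke_factorization_def
proof (intro conjI exI[of _ "\<lambda>_. 1"] ballI)
  fix z
  have "\<forall>\<^sub>F F in finite_subsets_at_top {\<alpha>}. F = {\<alpha>}"
    by (simp add: finite_subsets_at_top_finite eventually_principal)
  then have "\<forall>\<^sub>F F in finite_subsets_at_top {\<alpha>}.
      blaschke_factor \<alpha> z ^ n = (\<Prod>\<alpha>\<in>F. 1 * blaschke_factor \<alpha> z ^ n)"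
    by eventually_elim simp
  then show "((\<lambda>F. \<Prod>\<alpha>\<in>F. 1 * blaschke_factor \<alpha> z ^ n) \<longlongrightarrow> blaschke_factor \<alpha> z ^ n)
      (finite_subsets_at_top {\<alpha>})"
    by (rule tendsto_eventually[OF eventually_mono]) simp
qed (use assms in auto)

lemma model_space_blaschke_power:
  assumes \<alpha>: "\<alpha> \<in> disc" and n: "n \<ge> 1"
  shows "model_space (\<lambda>z. blaschke_factor \<alpha> z ^ n) = H1 ` clspan {jet \<alpha> j | j. j < n}"
proof -
  note fac = blaschke_factorization_power[OF assms]
  obtain p where p: "p \<noteq> 0" "\<And>z. z \<in> disc \<Longrightarrow> H1 p z = blaschke_factor \<alpha> z ^ n"
    by (rule blaschke_hardy[OF fac]) blast
  have "jets_below p = {jet \<alpha> j | j. j < n}"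
  proof -
    have off: "ord1 p \<beta> = 0" if "\<beta> \<in> disc" "\<beta> \<noteq> \<alpha>" for \<beta>
      using ord1_pos_iff[OF p(1) that(1)] p(2)[OF that(1)] blaschke_factor_zero_iff[OF \<alpha> that(1)] that(2)
      by simp
    have "ord1 p \<alpha> = n"
    proof -
      have "zorder (H1 p) \<alpha> = int n"
      proof (rule zorder_eqI[OF open_ball \<alpha>])
        show "(\<lambda>z. 1 / (1 - cnj \<alpha> * z) ^ n) holomorphic_on disc"
          using blaschke_denominator_nonzero[OF \<alpha>] by (intro holomorphic_intros) auto
        show "1 / (1 - cnj \<alpha> * \<alpha>) ^ n \<noteq> 0"
          using blaschke_denominator_nonzero[OF \<alpha>, of \<alpha>] \<alpha> by simp
        show "H1 p w = 1 / (1 - cnj \<alpha> * w) ^ n * (w - \<alpha>) powi int n" if "w \<in> disc" for w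
          using p(2)[OF that] by (simp add: blaschke_factor_def power_divide)
      qed
      then show ?thesis by (simp add: ord1_def)
    qed
    with off \<alpha> show ?thesis
      unfolding jets_below_def by (auto simp del: mem_ball) (metis less_nat_zero_code)
  qed
  then show ?thesis
    using model_space_blaschke[OF fac p] by simp
qed

text \<open>The polynomial g, the product of the (z_i - \<alpha>_i)^(j i), pairs nontrivially with a
  jet at \<alpha> only if its order is j: smaller orders see the zero, larger ones a jet of positive
  order against the constant 1. Closed spans of jets at a point therefore determine their sets of
  orders.\<close>

lemma jetn_mem_clspan_iff:
  assumes \<alpha>: "\<And>i. \<alpha> i \<in> disc"
  shows "jetn \<alpha> j \<in> clspan {jetn \<alpha> m | m. m \<in> J} \<longleftrightarrow> j \<in> J"
proof
  assume "j \<in> J"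
  then show "jetn \<alpha> j \<in> clspan {jetn \<alpha> m | m. m \<in> J}"
    by (intro clspan_base) blast
next
  assume mem: "jetn \<alpha> j \<in> clspan {jetn \<alpha> m | m. m \<in> J}"
  define g where "g = tens (\<lambda>i. (lin_mult (\<alpha> i) ^^ j i) (unit_vec 0))"
  have dual: "cinner (jetn \<alpha> m) g = 0 \<longleftrightarrow> m \<noteq> j" for m
  proof -
    have "cinner g (jetn \<alpha> m) = 0 \<longleftrightarrow> (\<exists>i. m i \<noteq> j i)"
    proof -
      have "cinner ((lin_mult (\<alpha> i) ^^ j i) (unit_vec 0)) (jet (\<alpha> i) (m i)) = 0 \<longleftrightarrow> m i \<noteq> j i" for i
        unfolding cinner_lin_mult_power_jet[OF \<alpha>]
        using cinner_commute[of "unit_vec 0" "jet (\<alpha> i) (m i - j i)"] coef_jet_0[OF \<alpha>, of i]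
        by (auto simp del: jet.simps)
      then show ?thesis
        by (simp add: g_def jetn_def cinner_tens)
    qed
    then show ?thesis
      by (subst cinner_commute) (auto simp: fun_eq_iff)
  qed
  show "j \<in> J"
  proof (rule ccontr)
    assume "j \<notin> J"
    then have "cinner (jetn \<alpha> j) g = 0"
      using mem by (intro cinner_eq_0_clspan[OF _ mem]) (auto simp: dual)
    then show False by (simp add: dual)
  qed
qed

section \<open>Joins of tensor products of model spaces\<close>

lemma closed_span_UN_tensor:
  assumes "\<And>k i. k \<in> W \<Longrightarrow> V k i = H1 ` clspan (B k i)"
  shows "closed_span (\<Union>k\<in>W. tensor (V k)) = HN ` clspan (\<Union>k\<in>W. {tens b | b. \<forall>i. b i \<in> B k i})"
proof -
  have "(\<Union>k\<in>W. tensor (V k)) = HN ` (\<Union>k\<in>W. clspan {tens b | b. \<forall>i. b i \<in> B k i})"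
    unfolding image_UN
  proof (rule SUP_cong[OF refl])
    fix k assume "k \<in> W"
    then show "tensor (V k) = HN ` clspan {tens b | b. \<forall>i. b i \<in> B k i}"
      by (intro tensor_HN assms)
  qed
  then show ?thesis
    by (simp add: closed_span_HN clspan_Union_clspan)
qed

text \<open>The Hardy space elements p and f represent the products and their least common
  multiples, so that orders of zeros can be expressed by \<open>ord1\<close>.\<close>

locale blaschke_families =
  fixes \<phi> :: "'n::finite \<Rightarrow> int \<Rightarrow> complex \<Rightarrow> complex" and \<phi>_lcm :: "'n \<Rightarrow> complex \<Rightarrow> complex"
    and p :: "'n \<Rightarrow> int \<Rightarrow> nat ell2" and f :: "'n \<Rightarrow> nat ell2"
  assumes \<phi>: "\<And>i k. blaschke_product (\<phi> i k)" and lcm: "\<And>i. blaschke_lcm (\<phi> i) (\<phi>_lcm i)"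
    and p: "\<And>i k. p i k \<noteq> 0" "\<And>i k z. z \<in> disc \<Longrightarrow> H1 (p i k) z = \<phi> i k z"
    and f: "\<And>i. f i \<noteq> 0" "\<And>i z. z \<in> disc \<Longrightarrow> H1 (f i) z = \<phi>_lcm i z"
begin

text \<open>The disc condition makes the box empty off the polydisc, where orders carry no
  meaning.\<close>

definition box :: "('n \<Rightarrow> complex) \<Rightarrow> int \<Rightarrow> ('n \<Rightarrow> nat) set" where
  "box \<alpha> k = {j. \<forall>i. \<alpha> i \<in> disc \<and> j i < ord1 (p i k) (\<alpha> i)}"

definition orders :: "('n \<Rightarrow> complex) \<Rightarrow> ('n \<Rightarrow> nat) set" where
  "orders \<alpha> = (\<Union>k. box \<alpha> k)"

definition common_zero :: "('n \<Rightarrow> complex) \<Rightarrow> int \<Rightarrow> bool" where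
  "common_zero \<alpha> k \<longleftrightarrow> (\<forall>i. \<alpha> i \<in> disc \<and> \<phi> i k (\<alpha> i) = 0)"

lemma ord1_p_pos_iff: "a \<in> disc \<Longrightarrow> 0 < ord1 (p i k) a \<longleftrightarrow> \<phi> i k a = 0"
  using ord1_pos_iff[OF p(1)] p(2) by metis

lemma box_nonempty_iff: "box \<alpha> k \<noteq> {} \<longleftrightarrow> common_zero \<alpha> k"
proof -
  have "box \<alpha> k \<noteq> {} \<longleftrightarrow> (\<lambda>i. 0) \<in> box \<alpha> k"
    by (auto simp: box_def dest: gr_implies_not0)
  also have "\<dots> \<longleftrightarrow> common_zero \<alpha> k"
    unfolding box_def common_zero_def using ord1_p_pos_iff by blast
  finally show ?thesis .
qed

lemma orders_nonempty_iff: "orders \<alpha> \<noteq> {} \<longleftrightarrow> (\<exists>k. common_zero \<alpha> k)"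
  using box_nonempty_iff by (auto simp: orders_def)

lemma countable_orders: "countable {\<alpha>. orders \<alpha> \<noteq> {}}"
proof -
  have "countable {z\<in>disc. \<phi> i k z = 0}" for i k
  proof -
    obtain A l where fac: "blaschke_factorization (\<phi> i k) A l"
      using \<phi>[of i k] by (auto simp: blaschke_product_def)
    have "{z\<in>disc. \<phi> i k z = 0} = A"
      using blaschke_zero_iff[OF fac] blaschke_zeros_subset[OF fac] by blast
    then show ?thesis using countable_blaschke_zeros[OF fac] by simp
  qed
  then have "countable (\<Union>k. Pi\<^sub>E UNIV (\<lambda>i. {z\<in>disc. \<phi> i k z = 0}))"
    by (intro countable_UN countable_PiE) auto
  moreover have "{\<alpha>. orders \<alpha> \<noteq> {}} \<subseteq> (\<Union>k. Pi\<^sub>E UNIV (\<lambda>i. {z\<in>disc. \<phi> i k z = 0}))"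
    unfolding orders_nonempty_iff common_zero_def by (auto simp: PiE_UNIV_domain simp del: mem_ball)
  ultimately show ?thesis by (rule countable_subset[rotated])
qed

lemma orders_less_ord1: "j \<in> orders \<alpha> \<Longrightarrow> j i < ord1 (f i) (\<alpha> i)"
proof -
  assume "j \<in> orders \<alpha>"
  then obtain k where k: "\<alpha> i \<in> disc" "j i < ord1 (p i k) (\<alpha> i)"
    by (auto simp: orders_def box_def simp del: mem_ball)
  moreover have "inner_dvd (\<phi> i k) (\<phi>_lcm i)"
    using lcm by (simp add: blaschke_lcm_def)
  then have "ord1 (p i k) (\<alpha> i) \<le> ord1 (f i) (\<alpha> i)"
    by (rule inner_dvd_ord1_le[OF _ p(2) f k(1)])
  ultimately show ?thesis by linarith
qed

lemma jet_family_orders: "jet_family orders f"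
proof
  show "j' \<in> orders \<alpha>" if "j \<in> orders \<alpha>" "j' \<le> j" for j j' \<alpha>
  proof -
    obtain k where k: "\<And>i. \<alpha> i \<in> disc" "\<And>i. j i < ord1 (p i k) (\<alpha> i)"
      using \<open>j \<in> orders \<alpha>\<close> unfolding orders_def box_def by blast
    have "j' i < ord1 (p i k) (\<alpha> i)" for i
      using le_funD[OF that(2)] k(2) by (rule le_less_trans)
    with k(1) show ?thesis
      unfolding orders_def box_def by blast
  qed
qed (use countable_orders orders_less_ord1 f(1) in \<open>auto simp: orders_def box_def\<close>)

text \<open>The orders at \<alpha> alone, still a family over all points, so that
  \<open>rank_jet_space\<close> also yields the co-rank of \<open>Q_xi\<close>.\<close>

definition point_orders :: "('n \<Rightarrow> complex) \<Rightarrow> ('n \<Rightarrow> complex) \<Rightarrow> ('n \<Rightarrow> nat) set" where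
  "point_orders \<alpha> \<beta> = (if \<beta> = \<alpha> then orders \<alpha> else {})"

lemma jet_family_point_orders: "jet_family (point_orders \<alpha>) f"
proof -
  interpret jet_family orders f by (rule jet_family_orders)
  have sub: "j \<in> orders \<beta>" if "j \<in> point_orders \<alpha> \<beta>" for j \<beta>
    using that by (simp add: point_orders_def split: if_splits)
  show ?thesis
  proof
    show "\<beta> i \<in> disc" if "j \<in> point_orders \<alpha> \<beta>" for j \<beta> i
      using sub[OF that] by (rule in_disc)
    show "j' \<in> point_orders \<alpha> \<beta>" if "j \<in> point_orders \<alpha> \<beta>" "j' \<le> j" for j j' \<beta>
      using that down_closed[of j \<alpha> j'] by (simp add: point_orders_def split: if_splits)
    show "countable {\<beta>. point_orders \<alpha> \<beta> \<noteq> {}}"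
      by (rule countable_subset[of _ "{\<alpha>}"]) (auto simp: point_orders_def)
    show "f i \<noteq> 0" for i
      by (rule f(1))
    show "j i < ord1 (f i) (\<beta> i)" if "j \<in> point_orders \<alpha> \<beta>" for j \<beta> i
      using sub[OF that] by (rule less_ord1)
  qed
qed

lemma Q_Phi_eq: "Q_Phi \<phi> = HN ` jet_family.jet_space orders"
proof -
  have model: "model_space (\<phi> i k) = H1 ` clspan (jets_below (p i k))" for i k
  proof -
    obtain A l where "blaschke_factorization (\<phi> i k) A l"
      using \<phi>[of i k] by (auto simp: blaschke_product_def)
    then show ?thesis by (rule model_space_blaschke[OF _ p])
  qed
  have sets: "{tens b | b. \<forall>i. b i \<in> jets_below (p i k)} = {jetn \<alpha> j | \<alpha> j. j \<in> box \<alpha> k}" for k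
  proof safe
    fix b assume "\<forall>i. b i \<in> jets_below (p i k)"
    then have "\<forall>i. \<exists>a j. b i = jet a j \<and> a \<in> disc \<and> j < ord1 (p i k) a"
      by (simp add: jets_below_def)
    then obtain \<alpha> j where *: "\<And>i. b i = jet (\<alpha> i) (j i)" "\<And>i. \<alpha> i \<in> disc \<and> j i < ord1 (p i k) (\<alpha> i)"
      by metis
    then have "b = (\<lambda>i. jet (\<alpha> i) (j i))" "j \<in> box \<alpha> k"
      by (auto simp: box_def)
    then have "tens b = jetn \<alpha> j" "j \<in> box \<alpha> k"
      by (simp_all add: jetn_def)
    then show "\<exists>\<alpha> j. tens b = jetn \<alpha> j \<and> j \<in> box \<alpha> k" by blast
  next
    fix \<alpha> j assume "j \<in> box \<alpha> k"
    then show "\<exists>b. jetn \<alpha> j = tens b \<and> (\<forall>i. b i \<in> jets_below (p i k))"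
      by (intro exI[of _ "\<lambda>i. jet (\<alpha> i) (j i)"]) (auto simp: jetn_def box_def jets_below_def)
  qed
  have "Q_Phi \<phi> = HN ` clspan (\<Union>k. {jetn \<alpha> j | \<alpha> j. j \<in> box \<alpha> k})"
    unfolding Q_Phi_def sets[symmetric]
    by (rule closed_span_UN_tensor[where V = "\<lambda>k i. model_space (\<phi> i k)"]) (rule model)
  also have "(\<Union>k. {jetn \<alpha> j | \<alpha> j. j \<in> box \<alpha> k}) = {jetn \<alpha> j | \<alpha> j. j \<in> orders \<alpha>}"
    by (auto simp: orders_def)
  finally show ?thesis
    by (simp add: jet_family.jet_space_def[OF jet_family_orders])
qed

section \<open>The correspondence between elements of \<Lambda> and points of the polydisc\<close>

definition point_of :: "('n \<Rightarrow> complex \<Rightarrow> complex) \<Rightarrow> ('n \<Rightarrow> complex) \<Rightarrow> bool" where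
  "point_of \<xi> \<alpha> \<longleftrightarrow> (\<forall>i. \<alpha> i \<in> disc \<and> prime_part (\<xi> i) = blaschke_factor (\<alpha> i))"

lemma Lambda_point:
  assumes "\<xi> \<in> Lambda \<phi>"
  shows "\<exists>\<alpha>. point_of \<xi> \<alpha> \<and> orders \<alpha> \<noteq> {}"
proof -
  obtain k where "\<And>i. \<xi> i \<in> blaschke_parts (\<phi> i k)"
    using assms by (auto simp: Lambda_def)
  then have "\<forall>i. \<exists>a A l. \<xi> i = (\<lambda>z. blaschke_factor a z ^ l a) \<and> blaschke_factorization (\<phi> i k) A l \<and> a \<in> A"
    unfolding blaschke_parts_def by blast
  then obtain \<alpha> A l where *: "\<And>i. \<xi> i = (\<lambda>z. blaschke_factor (\<alpha> i) z ^ l i (\<alpha> i))"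
    "\<And>i. blaschke_factorization (\<phi> i k) (A i) (l i)" "\<And>i. \<alpha> i \<in> A i"
    by metis
  have "\<alpha> i \<in> disc" for i
    using blaschke_zeros_subset[OF *(2)] *(3) by blast
  moreover note blaschke_zero[OF *(2,3)] blaschke_mult_pos[OF *(2,3)]
  ultimately have "point_of \<xi> \<alpha>" "common_zero \<alpha> k"
    by (simp_all add: point_of_def common_zero_def *(1) prime_part_power del: mem_ball)
  then show ?thesis
    using orders_nonempty_iff by blast
qed

lemma point_Lambda:
  assumes "orders \<alpha> \<noteq> {}"
  shows "\<exists>\<xi>\<in>Lambda \<phi>. point_of \<xi> \<alpha>"
proof -
  obtain k where k: "\<And>i. \<alpha> i \<in> disc" "\<And>i. \<phi> i k (\<alpha> i) = 0"
    using assms unfolding orders_nonempty_iff common_zero_def by blast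
  have "\<forall>i. \<exists>A l. blaschke_factorization (\<phi> i k) A l"
    using \<phi> by (simp add: blaschke_product_def)
  then obtain A l where fac: "\<And>i. blaschke_factorization (\<phi> i k) (A i) (l i)"
    by metis
  have A: "\<alpha> i \<in> A i" for i
    using blaschke_zero_iff[OF fac k(1)] k(2) by blast
  define \<xi> where "\<xi> = (\<lambda>i z. blaschke_factor (\<alpha> i) z ^ l i (\<alpha> i))"
  have "\<xi> i \<in> blaschke_parts (\<phi> i k)" for i
    unfolding blaschke_parts_def \<xi>_def using fac A by blast
  then have "\<xi> \<in> Lambda \<phi>" by (auto simp: Lambda_def)
  moreover have "point_of \<xi> \<alpha>"
    using k(1) blaschke_mult_pos[OF fac A] by (simp add: point_of_def \<xi>_def prime_part_power del: mem_ball)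
  ultimately show ?thesis by blast
qed

section \<open>The spaces \<open>Q_xi\<close> and their coverings at a fixed point\<close>

context
  fixes \<xi> :: "'n \<Rightarrow> complex \<Rightarrow> complex" and \<alpha> :: "'n \<Rightarrow> complex"
  assumes \<xi>: "point_of \<xi> \<alpha>"
begin

lemma point_disc: "\<alpha> i \<in> disc"
  using \<xi> by (simp add: point_of_def)

lemma prime_part_point: "prime_part (\<xi> i) = blaschke_factor (\<alpha> i)"
  using \<xi> by (simp add: point_of_def)

lemma Z_set_eq: "Z_set \<phi> \<xi> = {k. common_zero \<alpha> k}"
proof -
  have "inner_dvd (blaschke_factor (\<alpha> i)) (\<phi> i k) \<longleftrightarrow> \<phi> i k (\<alpha> i) = 0" for i k
  proof -
    obtain A l where "blaschke_factorization (\<phi> i k) A l" "inner_function (\<phi> i k)"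
      using \<phi>[of i k] by (auto simp: blaschke_product_def)
    then show ?thesis by (rule inner_dvd_blaschke_factor_iff[OF _ _ point_disc])
  qed
  then show ?thesis
    using point_disc by (simp add: Z_set_def common_zero_def prime_part_point del: mem_ball)
qed

lemma Q_join_eq:
  assumes "W \<subseteq> Z_set \<phi> \<xi>"
  shows "Q_join \<phi> \<xi> W = HN ` clspan {jetn \<alpha> j | j. j \<in> (\<Union>k\<in>W. box \<alpha> k)}"
proof -
  define n where "n k i = ord1 (p i k) (\<alpha> i)" for k i
  have ord: "blaschke_ord (\<phi> i k) (blaschke_factor (\<alpha> i)) = n k i" for i k
    unfolding n_def by (rule blaschke_ord_eq_ord1[OF point_disc p(2)])
  have model: "model_space (\<lambda>z. prime_part (\<xi> i) z ^ blaschke_ord (\<phi> i k) (prime_part (\<xi> i))) =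
      H1 ` clspan {jet (\<alpha> i) j | j. j < n k i}" if "k \<in> W" for k i
  proof -
    \<comment> \<open>Membership in \<open>Z_set\<close> makes all exponents positive, as the
      formula for powers of a Blaschke factor requires.\<close>
    have "common_zero \<alpha> k" using assms that by (auto simp: Z_set_eq)
    then have "0 < n k i"
      using ord1_p_pos_iff[OF point_disc] by (simp add: n_def common_zero_def)
    then show ?thesis
      unfolding prime_part_point ord by (intro model_space_blaschke_power point_disc) simp
  qed
  have sets: "{tens b | b. \<forall>i. b i \<in> {jet (\<alpha> i) j | j. j < n k i}} = {jetn \<alpha> j | j. j \<in> box \<alpha> k}" for k
  proof safe
    fix b assume "\<forall>i. b i \<in> {jet (\<alpha> i) j | j. j < n k i}"
    then have "\<forall>i. \<exists>j. b i = jet (\<alpha> i) j \<and> j < n k i" by simp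
    then obtain j where "\<And>i. b i = jet (\<alpha> i) (j i)" "\<And>i. j i < n k i" by metis
    then have "b = (\<lambda>i. jet (\<alpha> i) (j i))" "j \<in> box \<alpha> k"
      using point_disc by (auto simp: box_def n_def)
    then have "tens b = jetn \<alpha> j" "j \<in> box \<alpha> k"
      by (simp_all add: jetn_def)
    then show "\<exists>j. tens b = jetn \<alpha> j \<and> j \<in> box \<alpha> k" by blast
  next
    fix j assume "j \<in> box \<alpha> k"
    then show "\<exists>b. jetn \<alpha> j = tens b \<and> (\<forall>i. b i \<in> {jet (\<alpha> i) j | j. j < n k i})"
      by (intro exI[of _ "\<lambda>i. jet (\<alpha> i) (j i)"]) (auto simp: jetn_def box_def n_def)
  qed
  have "Q_join \<phi> \<xi> W = HN ` clspan (\<Union>k\<in>W. {jetn \<alpha> j | j. j \<in> box \<alpha> k})"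
    unfolding Q_join_def sets[symmetric]
    by (rule closed_span_UN_tensor[where V = "\<lambda>k i. model_space (\<lambda>z.
      prime_part (\<xi> i) z ^ blaschke_ord (\<phi> i k) (prime_part (\<xi> i)))"]) (rule model)
  also have "(\<Union>k\<in>W. {jetn \<alpha> j | j. j \<in> box \<alpha> k}) = {jetn \<alpha> j | j. j \<in> (\<Union>k\<in>W. box \<alpha> k)}"
    by blast
  finally show ?thesis .
qed

lemma orders_eq_UN_Z_set: "orders \<alpha> = (\<Union>k\<in>Z_set \<phi> \<xi>. box \<alpha> k)"
  unfolding orders_def Z_set_eq using box_nonempty_iff by blast

lemma Q_xi_eq_clspan: "Q_xi \<phi> \<xi> = HN ` clspan {jetn \<alpha> j | j. j \<in> orders \<alpha>}"
  unfolding Q_xi_def orders_eq_UN_Z_set by (rule Q_join_eq) simp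

text \<open>By \<open>jetn_mem_clspan_iff\<close> equal spaces have equal sets of orders, so the
  choice of W becomes a covering problem for boxes.\<close>

lemma Q_xi_eq_Q_join_iff:
  assumes "W \<subseteq> Z_set \<phi> \<xi>"
  shows "Q_xi \<phi> \<xi> = Q_join \<phi> \<xi> W \<longleftrightarrow> orders \<alpha> = (\<Union>k\<in>W. box \<alpha> k)"
proof
  assume "Q_xi \<phi> \<xi> = Q_join \<phi> \<xi> W"
  then have eq: "clspan {jetn \<alpha> j | j. j \<in> orders \<alpha>} = clspan {jetn \<alpha> j | j. j \<in> (\<Union>k\<in>W. box \<alpha> k)}"
    unfolding Q_xi_eq_clspan Q_join_eq[OF assms] inj_image_eq_iff[OF HN.inj_hfun] .
  show "orders \<alpha> = (\<Union>k\<in>W. box \<alpha> k)"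
  proof (rule set_eqI)
    fix j
    have "j \<in> orders \<alpha> \<longleftrightarrow> jetn \<alpha> j \<in> clspan {jetn \<alpha> m | m. m \<in> orders \<alpha>}"
      by (rule jetn_mem_clspan_iff[symmetric]) (rule point_disc)
    also have "\<dots> \<longleftrightarrow> j \<in> (\<Union>k\<in>W. box \<alpha> k)"
      unfolding eq by (rule jetn_mem_clspan_iff) (rule point_disc)
    finally show "j \<in> orders \<alpha> \<longleftrightarrow> j \<in> (\<Union>k\<in>W. box \<alpha> k)" .
  qed
qed (simp add: Q_xi_eq_clspan Q_join_eq[OF assms])

lemma co_rank_Q_xi:
  assumes "orders \<alpha> \<noteq> {}"
  shows "co_rank (Q_xi \<phi> \<xi>) = ecard (jet_family.maximal_orders orders \<alpha>)"
proof -
  interpret P: jet_family "point_orders \<alpha>" f by (rule jet_family_point_orders)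
  have "{jetn \<beta> j | \<beta> j. j \<in> point_orders \<alpha> \<beta>} = {jetn \<alpha> j | j. j \<in> orders \<alpha>}"
    by (auto simp: point_orders_def)
  then have "Q_xi \<phi> \<xi> = HN ` P.jet_space"
    by (simp add: Q_xi_eq_clspan P.jet_space_def)
  then have "co_rank (Q_xi \<phi> \<xi>) = (SUP \<beta>\<in>{\<beta>. point_orders \<alpha> \<beta> \<noteq> {}}. ecard (P.maximal_orders \<beta>))"
    by (simp add: co_rank_HN P.rank_jet_space)
  also have "{\<beta>. point_orders \<alpha> \<beta> \<noteq> {}} = {\<alpha>}"
    using assms by (auto simp: point_orders_def)
  also have "(SUP \<beta>\<in>{\<alpha>}. ecard (P.maximal_orders \<beta>)) = ecard (jet_family.maximal_orders orders \<alpha>)"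
    by (simp add: P.maximal_orders_def jet_family.maximal_orders_def[OF jet_family_orders] point_orders_def)
  finally show ?thesis .
qed

text \<open>Each box has a largest element, so it contains at most one maximal order.\<close>

lemma ecard_minimal_Z:
  assumes W: "minimal_Z \<phi> \<xi> W"
  shows "ecard W = ecard (jet_family.maximal_orders orders \<alpha>)"
proof (rule antisym)
  interpret jet_family orders f by (rule jet_family_orders)
  have WZ: "W \<subseteq> Z_set \<phi> \<xi>"
    using W by (simp add: minimal_Z_def)
  have cover: "orders \<alpha> = (\<Union>k\<in>W. box \<alpha> k)"
    using W Q_xi_eq_Q_join_iff[OF WZ] by (simp add: minimal_Z_def)
  have min: "ecard W \<le> ecard W'" if "W' \<subseteq> Z_set \<phi> \<xi>" "orders \<alpha> = (\<Union>k\<in>W'. box \<alpha> k)" for W'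
    using W that Q_xi_eq_Q_join_iff[OF that(1)] by (simp add: minimal_Z_def)
  have max_orders: "m \<in> orders \<alpha>" if "m \<in> maximal_orders \<alpha>" for m
    using that by (simp add: maximal_orders_def)
  then have "\<exists>k\<in>W. m \<in> box \<alpha> k" if "m \<in> maximal_orders \<alpha>" for m
    using cover that by blast
  then obtain \<kappa> where \<kappa>: "\<And>m. m \<in> maximal_orders \<alpha> \<Longrightarrow> \<kappa> m \<in> W \<and> m \<in> box \<alpha> (\<kappa> m)"
    by metis
  show "ecard W \<le> ecard (maximal_orders \<alpha>)"
  proof -
    \<comment> \<open>One box through each maximal order is enough because boxes are closed
      downwards.\<close>
    have "orders \<alpha> = (\<Union>k\<in>\<kappa> ` maximal_orders \<alpha>. box \<alpha> k)"
    proof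
      show "(\<Union>k\<in>\<kappa> ` maximal_orders \<alpha>. box \<alpha> k) \<subseteq> orders \<alpha>"
        by (auto simp: orders_def)
      show "orders \<alpha> \<subseteq> (\<Union>k\<in>\<kappa> ` maximal_orders \<alpha>. box \<alpha> k)"
      proof
        fix j assume "j \<in> orders \<alpha>"
        then obtain m where m: "m \<in> maximal_orders \<alpha>" "j \<le> m"
          using le_maximal_order by blast
        then have "j \<in> box \<alpha> (\<kappa> m)"
          using \<kappa>[OF m(1)] unfolding box_def le_fun_def by (auto intro: le_less_trans simp del: mem_ball)
        with m(1) show "j \<in> (\<Union>k\<in>\<kappa> ` maximal_orders \<alpha>. box \<alpha> k)" by blast
      qed
    qed
    moreover have "\<kappa> ` maximal_orders \<alpha> \<subseteq> Z_set \<phi> \<xi>"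
      using \<kappa> WZ by blast
    ultimately have "ecard W \<le> ecard (\<kappa> ` maximal_orders \<alpha>)"
      by (intro min)
    also have "\<dots> \<le> ecard (maximal_orders \<alpha>)"
      using finite_maximal_orders by (simp add: ecard_def card_image_le)
    finally show ?thesis .
  qed
  show "ecard (maximal_orders \<alpha>) \<le> ecard W"
  proof (cases "finite W")
    case True
    have "inj_on \<kappa> (maximal_orders \<alpha>)"
    proof (rule inj_onI)
      fix m m' assume m: "m \<in> maximal_orders \<alpha>" "m' \<in> maximal_orders \<alpha>" "\<kappa> m = \<kappa> m'"
      \<comment> \<open>The largest element of the box; the orders of the zeros are positive here,
        so subtracting 1 does not truncate.\<close>
      define top where "top i = ord1 (p i (\<kappa> m)) (\<alpha> i) - 1" for i
      have box: "m \<in> box \<alpha> (\<kappa> m)" "m' \<in> box \<alpha> (\<kappa> m)"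
        using \<kappa>[OF m(1)] \<kappa>[OF m(2)] by (simp_all add: m(3))
      then have less: "m i < ord1 (p i (\<kappa> m)) (\<alpha> i)" "m' i < ord1 (p i (\<kappa> m)) (\<alpha> i)" for i
        by (simp_all add: box_def)
      have "top i < ord1 (p i (\<kappa> m)) (\<alpha> i)" "m i \<le> top i" "m' i \<le> top i" for i
        using less[of i] by (auto simp: top_def)
      then have "top \<in> box \<alpha> (\<kappa> m)" "m \<le> top" "m' \<le> top"
        using point_disc by (auto simp: box_def le_fun_def)
      moreover from this(1) have "top \<in> orders \<alpha>" by (auto simp: orders_def)
      ultimately have "top = m" "top = m'"
        using m(1,2) by (auto simp: maximal_orders_def)
      then show "m = m'" by simp
    qed
    then have "card (maximal_orders \<alpha>) \<le> card W"
      using \<kappa> True by (intro card_inj_on_le) auto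
    then show ?thesis
      using True finite_maximal_orders by (simp add: ecard_def)
  qed (simp add: ecard_def)
qed

end

lemma co_rank_Q_Phi:
  "co_rank (Q_Phi \<phi>) = (SUP \<alpha>\<in>{\<alpha>. orders \<alpha> \<noteq> {}}. ecard (jet_family.maximal_orders orders \<alpha>))"
  unfolding Q_Phi_eq co_rank_HN by (rule jet_family.rank_jet_space[OF jet_family_orders])

text \<open>Several elements of \<Lambda> can share a point, their exponents coming from different
  k, but the quantities compared depend on the point alone. The sets of values agree, also when
  \<Lambda> is empty and both suprema are 0.\<close>

lemma SUP_Lambda:
  assumes "\<And>\<xi> \<alpha>. \<xi> \<in> Lambda \<phi> \<Longrightarrow> point_of \<xi> \<alpha> \<Longrightarrow> orders \<alpha> \<noteq> {} \<Longrightarrow> F \<xi> = (G \<alpha> :: enat)"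
  shows "(SUP \<xi>\<in>Lambda \<phi>. F \<xi>) = (SUP \<alpha>\<in>{\<alpha>. orders \<alpha> \<noteq> {}}. G \<alpha>)"
proof -
  have "F ` Lambda \<phi> = G ` {\<alpha>. orders \<alpha> \<noteq> {}}"
  proof (intro equalityI subsetI)
    fix y assume "y \<in> F ` Lambda \<phi>"
    then show "y \<in> G ` {\<alpha>. orders \<alpha> \<noteq> {}}"
      using Lambda_point assms by blast
  next
    fix y assume "y \<in> G ` {\<alpha>. orders \<alpha> \<noteq> {}}"
    then obtain \<alpha> where \<alpha>: "orders \<alpha> \<noteq> {}" "y = G \<alpha>" by blast
    then obtain \<xi> where "\<xi> \<in> Lambda \<phi>" "point_of \<xi> \<alpha>"
      using point_Lambda by blast
    with \<alpha> assms show "y \<in> F ` Lambda \<phi>" by (metis imageI)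
  qed
  then show ?thesis by simp
qed

end

theorem theorem5p1:
  fixes \<phi> :: "'n::finite \<Rightarrow> int \<Rightarrow> complex \<Rightarrow> complex"
    and \<phi>_lcm :: "'n \<Rightarrow> complex \<Rightarrow> complex"
    and Z_min :: "('n \<Rightarrow> complex \<Rightarrow> complex) \<Rightarrow> int set"
  assumes "CARD('n) \<ge> 2"
    and "\<And>i k. blaschke_product (\<phi> i k)"
    and "\<And>i. blaschke_lcm (\<phi> i) (\<phi>_lcm i)"
    and "\<And>\<xi>. \<xi> \<in> Lambda \<phi> \<Longrightarrow> minimal_Z \<phi> \<xi> (Z_min \<xi>)"
  shows "co_rank (Q_Phi \<phi>) = (SUP \<xi>\<in>Lambda \<phi>. co_rank (Q_xi \<phi> \<xi>)) \<and>
         (SUP \<xi>\<in>Lambda \<phi>. co_rank (Q_xi \<phi> \<xi>)) = (SUP \<xi>\<in>Lambda \<phi>. ecard (Z_min \<xi>))"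
proof -
  have hardy: "\<exists>q. q \<noteq> 0 \<and> (\<forall>z\<in>disc. H1 q z = \<psi> z)" if "blaschke_product \<psi>" for \<psi>
    using that blaschke_hardy unfolding blaschke_product_def by metis
  have "\<forall>i k. \<exists>q. q \<noteq> 0 \<and> (\<forall>z\<in>disc. H1 q z = \<phi> i k z)"
    using hardy assms(2) by blast
  then obtain p where p: "\<And>i k. p i k \<noteq> 0" "\<And>i k z. z \<in> disc \<Longrightarrow> H1 (p i k) z = \<phi> i k z"
    by metis
  have "\<forall>i. \<exists>q. q \<noteq> 0 \<and> (\<forall>z\<in>disc. H1 q z = \<phi>_lcm i z)"
    using hardy assms(3) by (simp add: blaschke_lcm_def)
  then obtain f where f: "\<And>i. f i \<noteq> 0" "\<And>i z. z \<in> disc \<Longrightarrow> H1 (f i) z = \<phi>_lcm i z"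
    by metis
  interpret blaschke_families \<phi> \<phi>_lcm p f
    by (rule blaschke_families.intro) (fact assms p f)+
  have 1: "(SUP \<xi>\<in>Lambda \<phi>. co_rank (Q_xi \<phi> \<xi>)) = co_rank (Q_Phi \<phi>)"
    unfolding co_rank_Q_Phi by (rule SUP_Lambda) (rule co_rank_Q_xi)
  have 2: "(SUP \<xi>\<in>Lambda \<phi>. ecard (Z_min \<xi>)) = co_rank (Q_Phi \<phi>)"
    unfolding co_rank_Q_Phi by (rule SUP_Lambda) (rule ecard_minimal_Z[OF _ assms(4)])
  from 1 2 show ?thesis by simp
qed

end
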